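(* Let $f,g\in L^2(\mathbb R^2,\mathbb H)$. Then $$\sum_{(k_1,k_2)\in\mathbb Z^2}e^{\frac{i}{b_1}(s_1+k_1)\tau_1+i\frac{a_1}{2b_1}(s_1+k_1)^2}\,f\!\left(t+\tfrac{s+(k_1,k_2)}{2}\right)\overline{g}\!\left(t-\tfrac{s+(k_1,k_2)}{2}\right)\,e^{\frac{j}{b_2}(s_2+k_2)\tau_2+j\frac{a_2}{2b_2}(s_2+k_2)^2}$$ $$=\sqrt{2\pi i b_1}\Big[\sum_{(k_1,k_2)\in\mathbb Z^2}e^{2\pi ik_1s_1}\,e^{2\pi ik_1(d_1\tau_1-b_1\eta_1)-i\frac{d_1}{2b_1}(4\pi^2b_1^2k_1^2+\tau_1^2)}\;\mathcal W^{A_1,A_2}_{f,g}\big(t,(2\pi b_1k_1,2\pi b_2k_2)\big)$$ $$\qquad\qquad\times e^{2\pi jk_2s_2}\,e^{2\pi jk_2(d_2\tau_2-b_2\eta_2)-j\frac{d_2}{2b_2}(4\pi^2b_2^2k_2^2+\tau_2^2)}\Big]\sqrt{2\pi jb_2}.$$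
   Context: $\mathbb H$ is the skew field of real quaternions with units $i,j,k$, conjugation $q\mapsto\overline q$ and modulus $|q|_Q=\sqrt{q\overline q}$. $L^2(\mathbb R^2,\mathbb H)$ is the space of $f:\mathbb R^2\to\mathbb H$ with $\int_{\mathbb R^2}|f(t)|_Q^2\,dt<\infty$; $\overline g$ denotes the function $x\mapsto\overline{g(x)}$. The variables are $t=(t_1,t_2)$, $s=(s_1,s_2)\in\mathbb R^2$. For $l=1,2$, $A_l$ stands for the real parameters $(a_l,b_l,c_l,d_l,\tau_l,\eta_l)$ with $a_ld_l-b_lc_l=1$ and $b_l\neq0$. For $\nu\in\{i,j\}$ the kernel is $$K^{\nu}_{A_l}(x,y)=\frac{1}{\sqrt{\nu2\pi b_l}}\exp\!\Big(\frac{\nu}{2b_l}\big(a_lx^2-2x(y-\tau_l)-2y(d_l\tau_l-b_l\eta_l)+d_l(y^2+\tau_l^2)\big)\Big),\qquad x,y\in\mathbb R,$$ with $\frac1{\sqrt\nu}=e^{-\nu\pi/4}$. The Wigner-Ville distribution associated with the two-sided quaternionic offset linear canonical transform (WVD-QOLCT), taken with respect to the pure unit quaternions $i$ (left) and $j$ (right), is $$\mathcal W^{A_1,A_2}_{f,g}(t,u)=\int_{\mathbb R^2}K^{i}_{A_1}(s_1,u_1)\,f\!\left(t+\tfrac s2\right)\overline{g}\!\left(t-\tfrac s2\right)\,K^{j}_{A_2}(s_2,u_2)\,ds,\qquad t,u\in\mathbb R^2 .$$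
   Formalization: For L² functions the right-hand series may diverge and values at single points are undefined; so the identity is stated for almost every s where the right-hand series converges unconditionally, and, with no convergence condition, in the sense of distributions in s, for every t. *)

theory Defs
  imports "HOL-Analysis.Analysis"
begin

section \<open>The skew field of real quaternions\<close>

codatatype quat = Quat (qre: real) (qim1: real) (qim2: real) (qim3: real)

lemma quat_eqI:
  "qre x = qre y \<Longrightarrow> qim1 x = qim1 y \<Longrightarrow> qim2 x = qim2 y \<Longrightarrow> qim3 x = qim3 y \<Longrightarrow> x = y"
  by (rule quat.expand) simp

lemma quat_eq_iff:
  "x = y \<longleftrightarrow> qre x = qre y \<and> qim1 x = qim1 y \<and> qim2 x = qim2 y \<and> qim3 x = qim3 y"
  by (auto intro: quat_eqI)

instantiation quat :: ab_group_add
begin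

primcorec zero_quat where
  "qre 0 = 0" | "qim1 0 = 0" | "qim2 0 = 0" | "qim3 0 = 0"

primcorec plus_quat where
  "qre (x + y) = qre x + qre y"
| "qim1 (x + y) = qim1 x + qim1 y"
| "qim2 (x + y) = qim2 x + qim2 y"
| "qim3 (x + y) = qim3 x + qim3 y"

primcorec uminus_quat where
  "qre (- x) = - qre x"
| "qim1 (- x) = - qim1 x"
| "qim2 (- x) = - qim2 x"
| "qim3 (- x) = - qim3 x"

primcorec minus_quat where
  "qre (x - y) = qre x - qre y"
| "qim1 (x - y) = qim1 x - qim1 y"
| "qim2 (x - y) = qim2 x - qim2 y"
| "qim3 (x - y) = qim3 x - qim3 y"

instance
  by standard (simp_all add: quat_eq_iff)

end

instantiation quat :: ring_1
begin

primcorec one_quat where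
  "qre 1 = 1" | "qim1 1 = 0" | "qim2 1 = 0" | "qim3 1 = 0"

primcorec times_quat where
  "qre (x * y) = qre x * qre y - qim1 x * qim1 y - qim2 x * qim2 y - qim3 x * qim3 y"
| "qim1 (x * y) = qre x * qim1 y + qim1 x * qre y + qim2 x * qim3 y - qim3 x * qim2 y"
| "qim2 (x * y) = qre x * qim2 y - qim1 x * qim3 y + qim2 x * qre y + qim3 x * qim1 y"
| "qim3 (x * y) = qre x * qim3 y + qim1 x * qim2 y - qim2 x * qim1 y + qim3 x * qre y"

instance
  by standard (simp_all add: quat_eq_iff algebra_simps)

end

instantiation quat :: real_algebra_1
begin

primcorec scaleR_quat where
  "qre (scaleR r x) = r * qre x"
| "qim1 (scaleR r x) = r * qim1 x"
| "qim2 (scaleR r x) = r * qim2 x"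
| "qim3 (scaleR r x) = r * qim3 x"

instance
  by standard (simp_all add: quat_eq_iff algebra_simps)

end

instantiation quat :: real_div_algebra
begin

primcorec inverse_quat where
  "qre (inverse x) = qre x / ((qre x)\<^sup>2 + (qim1 x)\<^sup>2 + (qim2 x)\<^sup>2 + (qim3 x)\<^sup>2)"
| "qim1 (inverse x) = - qim1 x / ((qre x)\<^sup>2 + (qim1 x)\<^sup>2 + (qim2 x)\<^sup>2 + (qim3 x)\<^sup>2)"
| "qim2 (inverse x) = - qim2 x / ((qre x)\<^sup>2 + (qim1 x)\<^sup>2 + (qim2 x)\<^sup>2 + (qim3 x)\<^sup>2)"
| "qim3 (inverse x) = - qim3 x / ((qre x)\<^sup>2 + (qim1 x)\<^sup>2 + (qim2 x)\<^sup>2 + (qim3 x)\<^sup>2)"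

definition "x div y = x * inverse y" for x y :: quat

lemma quat_norm_sq_eq_0_iff:
  fixes x :: quat
  shows "(qre x)\<^sup>2 + (qim1 x)\<^sup>2 + (qim2 x)\<^sup>2 + (qim3 x)\<^sup>2 = 0 \<longleftrightarrow> x = 0"
  by (simp add: quat_eq_iff add_nonneg_eq_0_iff)

instance
proof
  fix x y :: quat
  define N where "N = (qre x)\<^sup>2 + (qim1 x)\<^sup>2 + (qim2 x)\<^sup>2 + (qim3 x)\<^sup>2"
  have inv: "qre (inverse x) = qre x / N" "qim1 (inverse x) = - qim1 x / N"
    "qim2 (inverse x) = - qim2 x / N" "qim3 (inverse x) = - qim3 x / N"
    by (simp_all add: N_def)
  have N: "N \<noteq> 0 \<Longrightarrow> qre x * qre x / N + qim1 x * qim1 x / N + qim2 x * qim2 x / N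
      + qim3 x * qim3 x / N = 1"
    by (simp add: N_def flip: add_divide_distrib power2_eq_square)
  show "inverse x * x = 1" "x * inverse x = 1" if "x \<noteq> 0"
  proof -
    have "N \<noteq> 0"
      using that quat_norm_sq_eq_0_iff[of x] by (simp add: N_def)
    from N[OF this] show "inverse x * x = 1" "x * inverse x = 1"
      unfolding quat_eq_iff times_quat.sel inv by (simp_all add: mult.commute)
  qed
  show "x div y = x * inverse y"
    by (rule divide_quat_def)
  show "inverse 0 = (0 :: quat)"
    by (simp add: quat_eq_iff)
qed

end

instantiation quat :: real_normed_div_algebra
begin

definition norm_quat_def:
  "norm x = sqrt ((qre x)\<^sup>2 + (qim1 x)\<^sup>2 + (qim2 x)\<^sup>2 + (qim3 x)\<^sup>2)"

definition sgn_quat_def: "sgn x = x /\<^sub>R norm x" for x :: quat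

definition dist_quat_def: "dist x y = norm (x - y)" for x y :: quat

definition uniformity_quat_def:
  "(uniformity :: (quat \<times> quat) filter) = (INF e\<in>{0 <..}. principal {(x, y). dist x y < e})"

definition open_quat_def:
  "open (U :: quat set) \<longleftrightarrow> (\<forall>x\<in>U. eventually (\<lambda>(x', y). x' = x \<longrightarrow> y \<in> U) uniformity)"

instance
proof
  fix r :: real and x y :: quat and S :: "quat set"
  show "(norm x = 0) = (x = 0)"
    by (simp add: norm_quat_def quat_norm_sq_eq_0_iff)
  show "norm (x + y) \<le> norm x + norm y"
  proof -
    define v :: "quat \<Rightarrow> (real \<times> real) \<times> (real \<times> real)"
      where "v z = ((qre z, qim1 z), (qim2 z, qim3 z))" for z
    have "norm z = norm (v z)" for z
      by (simp add: norm_quat_def v_def norm_prod_def)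
    moreover have "v (x + y) = v x + v y"
      by (simp add: v_def)
    ultimately show ?thesis
      by (metis norm_triangle_ineq)
  qed
  show "norm (scaleR r x) = \<bar>r\<bar> * norm x"
    by (simp add: norm_quat_def power_mult_distrib distrib_left[symmetric] real_sqrt_mult)
  show "norm (x * y) = norm x * norm y"
    by (simp add: norm_quat_def real_sqrt_mult[symmetric] power2_eq_square algebra_simps)
qed (rule sgn_quat_def dist_quat_def open_quat_def uniformity_quat_def)+

end

instantiation quat :: real_inner
begin

definition inner_quat_def:
  "inner x y = qre x * qre y + qim1 x * qim1 y + qim2 x * qim2 y + qim3 x * qim3 y"

instance
proof
  fix x y z :: quat and r :: real
  show "inner x y = inner y x"
    by (simp add: inner_quat_def mult.commute)
  show "inner (x + y) z = inner x z + inner y z"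
    by (simp add: inner_quat_def distrib_right)
  show "inner (scaleR r x) y = r * inner x y"
    by (simp add: inner_quat_def distrib_left mult.assoc)
  show "0 \<le> inner x x"
    by (simp add: inner_quat_def)
  show "inner x x = 0 \<longleftrightarrow> x = 0"
    using quat_norm_sq_eq_0_iff[of x] by (simp add: inner_quat_def power2_eq_square)
  show "norm x = sqrt (inner x x)"
    by (simp add: inner_quat_def norm_quat_def power2_eq_square)
qed

end

definition qi :: quat where "qi = Quat 0 1 0 0"
definition qj :: quat where "qj = Quat 0 0 1 0"
definition qk :: quat where "qk = Quat 0 0 0 1"

lemma quat_units_sel [simp]:
  "qre qi = 0" "qim1 qi = 1" "qim2 qi = 0" "qim3 qi = 0"
  "qre qj = 0" "qim1 qj = 0" "qim2 qj = 1" "qim3 qj = 0"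
  "qre qk = 0" "qim1 qk = 0" "qim2 qk = 0" "qim3 qk = 1"
  by (simp_all add: qi_def qj_def qk_def)

lemma quat_units_mult:
  "qi * qi = -1" "qj * qj = -1" "qk * qk = -1"
  "qi * qj = qk" "qj * qk = qi" "qk * qi = qj"
  "qj * qi = - qk" "qk * qj = - qi" "qi * qk = - qj"
  by (simp_all add: quat_eq_iff)

text \<open>
  This instance makes the Bochner integral, infinite sums and the exponential function
  of the library available for quaternion-valued functions.
\<close>

instantiation quat :: euclidean_space
begin

definition Basis_quat_def: "Basis = {1, qi, qj, qk}"

instance
proof
  show "(Basis :: quat set) \<noteq> {}" and "finite (Basis :: quat set)"
    by (simp_all add: Basis_quat_def)
  show "inner u v = (if u = v then 1 else 0)"
    if "u \<in> Basis" "v \<in> Basis" for u v :: quat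
    using that by (auto simp: Basis_quat_def inner_quat_def quat_eq_iff)
  show "(\<forall>u\<in>Basis. inner x u = 0) \<longleftrightarrow> x = 0" for x :: quat
    unfolding Basis_quat_def ball_simps quat_eq_iff[of x] inner_quat_def by simp
qed

end

primcorec qcnj :: "quat \<Rightarrow> quat" where
  "qre (qcnj q) = qre q"
| "qim1 (qcnj q) = - qim1 q"
| "qim2 (qcnj q) = - qim2 q"
| "qim3 (qcnj q) = - qim3 q"

lemma norm_quat_conv_qcnj:
  "q * qcnj q = of_real ((norm q)\<^sup>2)" "norm q = sqrt (qre (q * qcnj q))"
  by (simp_all add: quat_eq_iff norm_quat_def of_real_def power2_eq_square)


section \<open>Square roots of real multiples of a pure unit quaternion\<close>

text \<open>
  For a pure unit quaternion \<open>\<nu>\<close>, the map \<open>x + \<i> y \<mapsto> x + y \<nu>\<close> identifies the complex numbers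
  with the subfield spanned by \<open>1\<close> and \<open>\<nu>\<close>.
\<close>

definition slice :: "quat \<Rightarrow> complex \<Rightarrow> quat" where
  "slice \<nu> z = of_real (Re z) + Im z *\<^sub>R \<nu>"

text \<open>
  The square root of \<open>\<nu> r\<close> for real \<open>r\<close> of either sign is the principal one, taken in that
  subfield. For \<open>r > 0\<close> it is \<open>exp (\<nu> \<pi> / 4) * sqrt r\<close>, as shown below; for \<open>r < 0\<close> it is
  \<open>exp (- \<nu> \<pi> / 4) * sqrt \<bar>r\<bar>\<close>.
\<close>

definition nu_sqrt :: "quat \<Rightarrow> real \<Rightarrow> quat" where
  "nu_sqrt \<nu> r = slice \<nu> (csqrt (\<i> * complex_of_real r))"

lemma bounded_linear_slice: "bounded_linear (slice \<nu>)"
  unfolding slice_def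
  by (intro bounded_linear_add bounded_linear_compose[OF bounded_linear_of_real]
      bounded_linear_compose[OF bounded_linear_scaleR_left] bounded_linear_Re bounded_linear_Im)

lemma slice_mult:
  assumes "\<nu> * \<nu> = -1"
  shows "slice \<nu> (z * w) = slice \<nu> z * slice \<nu> w"
proof -
  have "(Im z * Im w) *\<^sub>R (\<nu> * \<nu>) = of_real (- (Im z * Im w))"
    by (simp add: assms scaleR_conv_of_real)
  then show ?thesis
    by (simp add: slice_def scaleR_conv_of_real[symmetric] of_real_def algebra_simps)
qed

lemma slice_power:
  assumes "\<nu> * \<nu> = -1"
  shows "slice \<nu> (z ^ n) = slice \<nu> z ^ n"
  by (induction n) (simp_all add: slice_mult[OF assms], simp add: slice_def)

lemma slice_exp:
  assumes "\<nu> * \<nu> = -1"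
  shows "slice \<nu> (exp z) = exp (slice \<nu> z)"
proof -
  interpret bounded_linear "slice \<nu>"
    by (rule bounded_linear_slice)
  have "slice \<nu> (exp z) = (\<Sum>n. slice \<nu> (z ^ n /\<^sub>R fact n))"
    unfolding exp_def by (intro suminf summable_exp_generic)
  also have "\<dots> = exp (slice \<nu> z)"
    unfolding exp_def by (simp add: scaleR slice_power[OF assms])
  finally show ?thesis .
qed

lemma inverse_nu_sqrt_pos:
  assumes "\<nu> * \<nu> = -1" "r > 0"
  shows "inverse (nu_sqrt \<nu> r) = exp (- (pi / 4) *\<^sub>R \<nu>) /\<^sub>R sqrt r"
proof -
  have "csqrt (\<i> * complex_of_real r) = of_real (sqrt r) * exp (\<i> * of_real (pi / 4))"
  proof (rule csqrt_unique)
    have "(exp (\<i> * of_real (pi / 4)))\<^sup>2 = exp (\<i> * of_real (pi / 2))"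
      by (simp add: exp_double[symmetric])
    also have "\<dots> = \<i>"
      by (metis cis_conv_exp cis_pi_half)
    finally show "(of_real (sqrt r) * exp (\<i> * of_real (pi / 4)))\<^sup>2 = \<i> * of_real r"
      using assms(2)
      by (simp only: power_mult_distrib)
        (simp flip: of_real_power add: mult.commute)
    show "0 < Re (of_real (sqrt r) * exp (\<i> * of_real (pi / 4))) \<or>
      Re (of_real (sqrt r) * exp (\<i> * of_real (pi / 4))) = 0 \<and>
      0 \<le> Im (of_real (sqrt r) * exp (\<i> * of_real (pi / 4)))"
      using assms(2) by (simp add: Re_exp cos_45)
  qed
  then have "nu_sqrt \<nu> r = of_real (sqrt r) * exp ((pi / 4) *\<^sub>R \<nu>)"
    by (simp add: nu_sqrt_def slice_mult[OF assms(1)] slice_exp[OF assms(1)])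
      (simp add: slice_def)
  moreover have "inverse (exp ((pi / 4) *\<^sub>R \<nu>)) = exp (- (pi / 4) *\<^sub>R \<nu>)"
    using exp_minus_inverse[of "(pi / 4) *\<^sub>R \<nu>"] by (intro inverse_unique) simp
  ultimately show ?thesis
    by (simp add: inverse_scaleR_distrib flip: scaleR_conv_of_real)
qed


section \<open>The quaternionic Wigner-Ville distribution\<close>

definition L2_quat :: "(real \<times> real \<Rightarrow> quat) set" where
  "L2_quat = {f \<in> borel_measurable lebesgue. integrable lebesgue (\<lambda>t. (norm (f t))\<^sup>2)}"

record olct_param =
  pa :: real
  pb :: real
  pc :: real
  pd :: real
  p\<tau> :: real
  p\<eta> :: real

definition olct_admissible :: "olct_param \<Rightarrow> bool" where
  "olct_admissible A \<longleftrightarrow> pa A * pd A - pb A * pc A = 1 \<and> pb A \<noteq> 0"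

definition olct_kernel :: "quat \<Rightarrow> olct_param \<Rightarrow> real \<Rightarrow> real \<Rightarrow> quat" where
  "olct_kernel \<nu> A x y =
     inverse (nu_sqrt \<nu> (2 * pi * pb A)) *
     exp ((1 / (2 * pb A) *
           (pa A * x\<^sup>2 - 2 * x * (y - p\<tau> A) - 2 * y * (pd A * p\<tau> A - pb A * p\<eta> A)
            + pd A * (y\<^sup>2 + (p\<tau> A)\<^sup>2))) *\<^sub>R \<nu>)"

definition wvd_qolct ::
  "olct_param \<Rightarrow> olct_param \<Rightarrow> (real \<times> real \<Rightarrow> quat) \<Rightarrow> (real \<times> real \<Rightarrow> quat) \<Rightarrow>
   real \<times> real \<Rightarrow> real \<times> real \<Rightarrow> quat" where
  "wvd_qolct A1 A2 f g t u =
     (LINT s|lebesgue.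
        olct_kernel qi A1 (fst s) (fst u) * f (t + s /\<^sub>R 2) * qcnj (g (t - s /\<^sub>R 2)) *
        olct_kernel qj A2 (snd s) (snd u))"


section \<open>The two sides of the Poisson summation formula\<close>

text \<open>
  For square integrable \<open>f\<close> and \<open>g\<close>, the function \<open>s \<mapsto> f (t + s/2) * qcnj (g (t - s/2))\<close> is merely
  integrable. Hence the series of the left-hand terms, a periodization, converges only for almost
  every \<open>s\<close>, and the series of the right-hand terms, its two-sided Fourier series, may diverge.
  Equality of the two is therefore understood almost everywhere where the right-hand series
  converges and, without any convergence hypothesis, in the sense of distributions in \<open>s\<close>.
\<close>

definition poisson_lhs_term ::
  "olct_param \<Rightarrow> olct_param \<Rightarrow> (real \<times> real \<Rightarrow> quat) \<Rightarrow> (real \<times> real \<Rightarrow> quat) \<Rightarrow>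
   real \<times> real \<Rightarrow> real \<times> real \<Rightarrow> int \<times> int \<Rightarrow> quat" where
  "poisson_lhs_term A1 A2 f g t s = (\<lambda>(k1, k2).
     let x1 = fst s + real_of_int k1; x2 = snd s + real_of_int k2 in
     exp ((1 / pb A1 * x1 * p\<tau> A1 + pa A1 / (2 * pb A1) * x1\<^sup>2) *\<^sub>R qi) *
     f (t + (x1, x2) /\<^sub>R 2) * qcnj (g (t - (x1, x2) /\<^sub>R 2)) *
     exp ((1 / pb A2 * x2 * p\<tau> A2 + pa A2 / (2 * pb A2) * x2\<^sup>2) *\<^sub>R qj))"

definition poisson_factor :: "quat \<Rightarrow> olct_param \<Rightarrow> int \<Rightarrow> real \<Rightarrow> quat" where
  "poisson_factor \<nu> A k x =
     exp ((2 * pi * real_of_int k * x) *\<^sub>R \<nu>) *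
     exp ((2 * pi * real_of_int k * (pd A * p\<tau> A - pb A * p\<eta> A)
           - pd A / (2 * pb A) * (4 * pi\<^sup>2 * (pb A)\<^sup>2 * (real_of_int k)\<^sup>2 + (p\<tau> A)\<^sup>2)) *\<^sub>R \<nu>)"

definition poisson_rhs_term ::
  "olct_param \<Rightarrow> olct_param \<Rightarrow> (real \<times> real \<Rightarrow> quat) \<Rightarrow> (real \<times> real \<Rightarrow> quat) \<Rightarrow>
   real \<times> real \<Rightarrow> real \<times> real \<Rightarrow> int \<times> int \<Rightarrow> quat" where
  "poisson_rhs_term A1 A2 f g t s = (\<lambda>(k1, k2).
     poisson_factor qi A1 k1 (fst s) *
     wvd_qolct A1 A2 f g t (2 * pi * pb A1 * real_of_int k1, 2 * pi * pb A2 * real_of_int k2) *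
     poisson_factor qj A2 k2 (snd s))"

text \<open>
  Real-valued smooth functions of compact support on the plane. \<open>D m n\<close> is the partial
  derivative of order \<open>m\<close> in the first and \<open>n\<close> in the second variable; requiring all of them
  to be (Frechet) differentiable amounts to infinite differentiability.
\<close>

definition test_function :: "(real \<times> real \<Rightarrow> real) \<Rightarrow> bool" where
  "test_function \<phi> \<longleftrightarrow>
     compact (closure {s. \<phi> s \<noteq> 0}) \<and>
     (\<exists>D :: nat \<Rightarrow> nat \<Rightarrow> real \<times> real \<Rightarrow> real.
        D 0 0 = \<phi> \<and>
        (\<forall>m n s. (D m n has_derivative
                    (\<lambda>h. fst h * D (Suc m) n s + snd h * D m (Suc n) s)) (at s)))"

end

theory Submission
  imports Defs
begin

text \<open>
  Sampled at \<open>(2 \<pi> b\<^sub>1 k\<^sub>1, 2 \<pi> b\<^sub>2 k\<^sub>2)\<close>, the Wigner-Ville distribution is, up to factors that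
  cancel, the two-sided quaternionic Fourier coefficient \<open>c\<^sub>k\<close> of the integrable function
  \<open>h(s) = chirp * f(t + s/2) * cnj(g(t - s/2)) * chirp\<close>, so the claim is Poisson summation for \<open>h\<close>.
  Non-commutativity is harmless: tested against a real-valued \<open>\<phi>\<close>, the operator
  \<open>q \<mapsto> exp(i \<alpha>) q exp(j \<beta>)\<close> splits into four terms with real coefficients, and those containing
  a sine are odd in \<open>k\<close> and sum to zero. Hence the weak identity reduces to the scalar Poisson
  formula for \<open>\<phi>\<close>, whose coefficients decay quadratically by partial integration; that formula is
  obtained one variable at a time by Cesaro summation. As all terms of the right-hand series have
  modulus \<open>|c\<^sub>k|\<close> (up to a constant), its convergence at one point means \<open>\<Sum> |c\<^sub>k| < \<infinity>\<close>; then
  both sides are locally integrable with equal integrals against twice differentiable cutoffs of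
  boxes, and therefore equal almost everywhere.
\<close>

section \<open>Interchanging unconditional sums and integrals\<close>

text \<open>Pointwise Poisson summation is out of reach for an \<open>h\<close> that is merely
  integrable, so the formula is used only for the weight: Fubini moves the sum over \<open>k\<close>
  onto it, and both sides of the weak identity become the integral of the 1-periodized weight times
  \<open>h\<close>. Cesaro means spare a convergence theorem for Dirichlet kernels: summability is
  already known from the decay, so only the value of the sum has to be found. The one-variable
  formula asks for no more than a Lipschitz function, so that it applies again to partial Fourier
  coefficients as functions of the second variable. Two derivatives per variable are all that the
  decay costs; the locale \<open>bump\<close> therefore covers test functions as well as rational
  cutoffs. Lebesgue measurable \<open>f\<close> and \<open>g\<close> do not suit Fubini for
  \<open>lborel\<close>, so they are replaced by Borel representatives, which changes no value of
  the Wigner-Ville distribution. The square roots pass the exponentials because each lies in the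
  commutative subfield of its own unit, so that they end up outside the sum on the proper
  sides.\<close>

lemma has_sum_sum:
  fixes f :: "'i \<Rightarrow> 'k \<Rightarrow> 'b::{topological_comm_monoid_add, t2_space}"
  assumes "\<And>i. i \<in> I \<Longrightarrow> (f i has_sum s i) A"
  shows "((\<lambda>k. \<Sum>i\<in>I. f i k) has_sum (\<Sum>i\<in>I. s i)) A"
  using assms by (induction I rule: infinite_finite_induct) (auto intro!: has_sum_add)

text \<open>In finite dimension unconditional and absolute convergence coincide: each coordinate is
  a summable real family, hence absolutely summable, and the norm is at most the sum of the absolute
  coordinates.\<close>

lemma summable_on_iff_norm_summable_on:
  fixes f :: "'k \<Rightarrow> 'b::euclidean_space"
  shows "f summable_on A \<longleftrightarrow> (\<lambda>k. norm (f k)) summable_on A"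
proof
  assume f: "f summable_on A"
  have "(\<lambda>k. f k \<bullet> b) summable_on A" for b
    using summable_on_bounded_linear[OF bounded_linear_inner_left f] by simp
  then have "(\<lambda>k. \<bar>f k \<bullet> b\<bar>) summable_on A" for b
    by (simp add: summable_on_iff_abs_summable_on_real[symmetric] flip: real_norm_def)
  then have "(\<lambda>k. \<Sum>b\<in>Basis. \<bar>f k \<bullet> b\<bar>) summable_on A"
    by (rule has_sum_imp_summable[OF has_sum_sum[OF has_sum_infsum]])
  then show "(\<lambda>k. norm (f k)) summable_on A"
    by (rule summable_on_comparison_test) (auto simp: norm_le_l1)
qed (rule abs_summable_summable)

context
  fixes M :: "'a measure" and u :: "'k::countable \<Rightarrow> 'a \<Rightarrow> 'b::euclidean_space"
  assumes int: "\<And>k. integrable M (u k)"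
    and sm: "(\<lambda>k. \<integral>x. norm (u k x) \<partial>M) summable_on UNIV"
begin

text \<open>The theorems on integrating series are indexed by \<open>nat\<close>. The map
  \<open>to_nat\<close> is injective but need not be onto, so indices outside its range carry the
  term 0, which changes no sum.\<close>

private definition "ext g n = (if n \<in> range (to_nat :: 'k \<Rightarrow> nat) then g (from_nat n :: 'k) else 0)"
  for g :: "'k \<Rightarrow> 'c::real_normed_vector" and n :: nat

private lemma has_sum_ext: "(ext g has_sum s) UNIV \<longleftrightarrow> (g has_sum s) UNIV"
proof -
  have "(ext g has_sum s) UNIV \<longleftrightarrow> (ext g has_sum s) (range (to_nat :: 'k \<Rightarrow> nat))"
    by (rule has_sum_cong_neutral) (auto simp: ext_def)
  also have "\<dots> \<longleftrightarrow> (ext g \<circ> to_nat has_sum s) (UNIV :: 'k set)"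
    by (rule has_sum_reindex) auto
  also have "ext g \<circ> to_nat = g"
    by (auto simp: ext_def fun_eq_iff)
  finally show ?thesis .
qed

private lemma summable_ext: "(g :: 'k \<Rightarrow> 'c::real_normed_vector) summable_on UNIV \<longleftrightarrow> ext g summable_on UNIV"
  by (simp add: summable_on_def has_sum_ext)

private lemma infsum_ext: "infsum (g :: 'k \<Rightarrow> 'c::real_normed_vector) UNIV = infsum (ext g) UNIV"
  by (metis has_sum_ext has_sum_infsum infsumI infsum_not_exists summable_ext)

private definition "v n x = ext (\<lambda>k. u k x) n"

private lemma v_int: "integrable M (v n)"
  unfolding v_def ext_def using int by (cases "n \<in> range (to_nat :: 'k \<Rightarrow> nat)") auto

private lemma v_norm: "(\<lambda>n. norm (v n x)) = ext (\<lambda>k. norm (u k x))"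
  by (auto simp: v_def ext_def)

private lemma v_sm: "summable (\<lambda>n. \<integral>x. norm (v n x) \<partial>M)"
proof -
  have "(\<lambda>n. \<integral>x. norm (v n x) \<partial>M) = ext (\<lambda>k. \<integral>x. norm (u k x) \<partial>M)"
    by (auto simp: v_def ext_def fun_eq_iff)
  then show ?thesis using sm by (simp add: summable_ext summable_on_imp_summable)
qed

text \<open>By monotone convergence the integral of the sum of the norms is the sum of the
  integrals; this is finite, so the sum of the norms is finite almost everywhere.\<close>

private lemma AE_v: "AE x in M. summable (\<lambda>n. norm (v n x))"
proof -
  have [measurable]: "v n \<in> borel_measurable M" for n
    using v_int by auto
  have "(\<integral>\<^sup>+x. (\<Sum>n. ennreal (norm (v n x))) \<partial>M) = (\<Sum>n. \<integral>\<^sup>+x. ennreal (norm (v n x)) \<partial>M)"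
    by (intro nn_integral_suminf) auto
  also have "\<dots> = (\<Sum>n. ennreal (\<integral>x. norm (v n x) \<partial>M))"
    using v_int by (intro suminf_cong nn_integral_eq_integral) auto
  also have "\<dots> \<noteq> \<infinity>"
    using v_sm by (simp add: ennreal_suminf_neq_top)
  finally have "AE x in M. (\<Sum>n. ennreal (norm (v n x))) \<noteq> \<infinity>"
    by (intro nn_integral_PInf_AE) auto
  then show ?thesis
    by eventually_elim (auto intro: summable_suminf_not_top)
qed

lemma AE_summable_on_of_integrals: "AE x in M. (\<lambda>k. u k x) summable_on UNIV"
  using AE_v
proof eventually_elim
  case (elim x)
  then show ?case
    by (simp add: v_norm summable_on_iff_norm_summable_on[of "\<lambda>k. u k x"] summable_ext
      summable_on_UNIV_nonneg_real_iff ext_def)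
qed

private lemma summable_norm_v_iff: "summable (\<lambda>n. norm (v n x)) \<longleftrightarrow> (\<Sum>n. ennreal (norm (v n x))) \<noteq> top"
  (is "?l \<longleftrightarrow> ?r")
proof (rule iffI)
  assume ?l
  then show ?r
    by (rule ennreal_suminf_neq_top) (rule norm_ge_zero)
next
  assume ?r
  show ?l
    by (rule summable_suminf_not_top) (use \<open>?r\<close> in simp_all)
qed

text \<open>\<open>infsum\<close> is 0 off the set of summability. Writing that set as finiteness of
  a measurable \<open>ennreal\<close> series makes the whole expression measurable, which an almost
  everywhere identity alone would not give, since \<open>M\<close> may be incomplete.\<close>

private lemma infsum_v:
  "(\<Sum>\<^sub>\<infinity>k. u k x) = (if (\<Sum>n. ennreal (norm (v n x))) \<noteq> top then \<Sum>n. v n x else 0)"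
proof (cases "summable (\<lambda>n. norm (v n x))")
  case True
  then have "((\<lambda>n. v n x) has_sum (\<Sum>n. v n x)) UNIV"
    by (simp add: norm_summable_imp_has_sum summable_norm_cancel summable_sums)
  then have "((\<lambda>k. u k x) has_sum (\<Sum>n. v n x)) UNIV"
    unfolding v_def has_sum_ext .
  then show ?thesis using True
    by (simp add: summable_norm_v_iff infsumI)
next
  case False
  then have "\<not> (\<lambda>k. u k x) summable_on UNIV"
    by (simp add: v_norm summable_on_iff_norm_summable_on[of "\<lambda>k. u k x"] summable_ext
      summable_on_UNIV_nonneg_real_iff ext_def)
  with False show ?thesis by (simp add: infsum_not_exists summable_norm_v_iff)
qed

private lemma AE_infsum_v: "AE x in M. (\<Sum>n. v n x) = (\<Sum>\<^sub>\<infinity>k. u k x)"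
  using AE_v unfolding summable_norm_v_iff by eventually_elim (simp add: infsum_v)

private lemma infsum_measurable: "(\<lambda>x. \<Sum>\<^sub>\<infinity>k. u k x) \<in> borel_measurable M"
proof -
  have [measurable]: "v n \<in> borel_measurable M" for n
    using v_int by auto
  show ?thesis
    unfolding infsum_v by measurable
qed

lemma integrable_infsum: "integrable M (\<lambda>x. \<Sum>\<^sub>\<infinity>k. u k x)"
proof (rule integrable_cong_AE_imp)
  show "integrable M (\<lambda>x. \<Sum>n. v n x)"
    by (rule integrable_suminf[OF v_int AE_v v_sm])
qed (use infsum_measurable AE_infsum_v in auto)

lemma summable_on_integral: "(\<lambda>k. \<integral>x. u k x \<partial>M) summable_on UNIV"
  by (rule abs_summable_summable, rule summable_on_comparison_test[OF sm]) auto

lemma integral_infsum: "(\<integral>x. (\<Sum>\<^sub>\<infinity>k. u k x) \<partial>M) = (\<Sum>\<^sub>\<infinity>k. \<integral>x. u k x \<partial>M)"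
proof -
  have [measurable]: "v n \<in> borel_measurable M" for n
    using v_int by auto
  have "(\<integral>x. (\<Sum>\<^sub>\<infinity>k. u k x) \<partial>M) = (\<integral>x. (\<Sum>n. v n x) \<partial>M)"
    by (intro integral_cong_AE infsum_measurable borel_measurable_suminf)
      (use AE_infsum_v in \<open>auto simp: eq_commute\<close>)
  also have "\<dots> = (\<Sum>n. \<integral>x. v n x \<partial>M)"
    by (rule integral_suminf[OF v_int AE_v v_sm])
  also have "(\<lambda>n. \<integral>x. v n x \<partial>M) = ext (\<lambda>k. \<integral>x. u k x \<partial>M)"
    by (auto simp: v_def ext_def fun_eq_iff)
  also have "suminf \<dots> = infsum \<dots> UNIV"
    using summable_on_integral[unfolded summable_ext] by (simp add: has_sum_imp_sums sums_unique[symmetric])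
  finally show ?thesis by (simp add: infsum_ext)
qed

end

section \<open>Poisson summation in one variable\<close>

text \<open>On the first half of the interval the concave sine lies above its chord from 0 to pi/2;
  the other half follows by the symmetry s to 1 - s.\<close>

lemma sin_pi_ge:
  assumes "0 \<le> s" "s \<le> 1"
  shows "sin (pi * s) \<ge> 2 * min s (1 - s)"
proof -
  have *: "sin (pi * s) \<ge> 2 * s" if "0 \<le> s" "s \<le> 1/2" for s
  proof -
    have "concave_on {0..pi/2} sin"
      by (rule f''_le0_imp_concave[of _ _ cos "\<lambda>x. - sin x"])
        (auto intro!: derivative_eq_intros sin_ge_zero)
    from concave_onD[OF this, of "2 * s" 0 "pi / 2"] show ?thesis
      using that by (simp add: mult.commute)
  qed
  have "sin (pi * (1 - s)) = sin (pi * s)"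
    by (simp add: right_diff_distrib sin_diff)
  then show ?thesis
    using *[of s] *[of "1 - s"] assms by (cases "s \<le> 1/2") auto
qed

section \<open>Dirichlet and Fejer kernels\<close>

definition dirichlet :: "nat \<Rightarrow> real \<Rightarrow> real" where
  "dirichlet N s = (\<Sum>k\<in>{- int N..int N}. cos (2 * pi * real_of_int k * s))"

lemma dirichlet_0 [simp]: "dirichlet 0 s = 1"
  by (simp add: dirichlet_def)

lemma dirichlet_Suc: "dirichlet (Suc N) s = dirichlet N s + 2 * cos (2 * pi * real (Suc N) * s)"
proof -
  have *: "{- int (Suc N)..int (Suc N)} = insert (- int (Suc N)) (insert (int (Suc N)) {- int N..int N})"
    by auto
  have "cos (2 * pi * real_of_int (- int (Suc N)) * s) = cos (2 * pi * real (Suc N) * s)"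
    by (subst cos_minus[symmetric]) (simp add: algebra_simps)
  then show ?thesis
    unfolding dirichlet_def * by simp
qed

text \<open>Telescoping: the new term 2 cos A sin(pi s) is sin(A + pi s) - sin(A - pi s).\<close>

lemma dirichlet_mult_sin: "dirichlet N s * sin (pi * s) = sin ((2 * real N + 1) * (pi * s))"
proof (induction N)
  case (Suc N)
  define A where "A = 2 * pi * real (Suc N) * s"
  have *: "(2 * real (Suc N) + 1) * (pi * s) = A + pi * s" "(2 * real N + 1) * (pi * s) = A - pi * s"
    by (simp_all add: A_def algebra_simps)
  have "dirichlet (Suc N) s * sin (pi * s) = sin (A - pi * s) + 2 * cos A * sin (pi * s)"
    unfolding *(2)[symmetric] Suc[symmetric] by (simp only: dirichlet_Suc distrib_right A_def)
  also have "\<dots> = sin (A + pi * s)"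
    by (simp add: sin_add sin_diff)
  finally show ?case
    by (simp only: *)
qed auto

lemma sin_squared_diff: "(sin b)\<^sup>2 - (sin a)\<^sup>2 = sin (a + b) * sin (b - a)" for a b :: real
proof -
  have "sin (a + b) * sin (b - a) = (sin b)\<^sup>2 * (cos a)\<^sup>2 - (cos b)\<^sup>2 * (sin a)\<^sup>2"
    by (simp add: sin_add sin_diff algebra_simps power2_eq_square)
  then show ?thesis
    by (simp add: cos_squared_eq algebra_simps)
qed

text \<open>The sum is \<open>M\<close> times the Fejer kernel. Each summand times the squared sine
  is a difference of consecutive squared sines, so the sum telescopes.\<close>

lemma fejer_closed_form:
  "(\<Sum>N<M. dirichlet N s) * (sin (pi * s))\<^sup>2 = (sin (real M * (pi * s)))\<^sup>2"
proof (induction M)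
  case (Suc M)
  have *: "real M * (pi * s) + real (Suc M) * (pi * s) = (2 * real M + 1) * (pi * s)"
    "real (Suc M) * (pi * s) - real M * (pi * s) = pi * s"
    by (simp_all add: algebra_simps)
  have "(sin (real (Suc M) * (pi * s)))\<^sup>2 - (sin (real M * (pi * s)))\<^sup>2
     = dirichlet M s * (sin (pi * s))\<^sup>2"
    unfolding sin_squared_diff * dirichlet_mult_sin[symmetric] by (simp add: power2_eq_square)
  with Suc show ?case
    by (simp add: distrib_right)
qed auto

lemma tendsto_cesaro_mean:
  fixes a :: "nat \<Rightarrow> real"
  assumes "a \<longlonglongrightarrow> l"
  shows "(\<lambda>M. (\<Sum>n<M. a n) / real M) \<longlonglongrightarrow> l"
proof (rule LIMSEQ_I)
  fix e :: real
  assume "e > 0"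
  then obtain N where N: "\<And>n. n \<ge> N \<Longrightarrow> \<bar>a n - l\<bar> < e / 2"
    using LIMSEQ_D[OF assms, of "e / 2"] by auto
  \<comment> \<open>The head of the sum is the constant \<open>C\<close>, and \<open>K\<close> is
    chosen so that \<open>C < real M * (e / 2)\<close> for all \<open>M\<close> beyond
    \<open>K\<close>; the tail contributes at most \<open>e / 2\<close> per term.\<close>
  define C where "C = (\<Sum>n<N. \<bar>a n - l\<bar>)"
  have "C \<ge> 0" by (simp add: C_def sum_nonneg)
  obtain K :: nat where K: "real K > 2 * C / e" using reals_Archimedean2 by blast
  have "\<bar>(\<Sum>n<M. a n) / real M - l\<bar> < e" if M: "M \<ge> max (Suc N) (Suc K)" for M
  proof -
    have "(\<Sum>n<M. a n) / real M - l = (\<Sum>n<M. a n - l) / real M"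
      using M by (simp add: sum_subtractf field_simps)
    also have "\<bar>\<dots>\<bar> \<le> (\<Sum>n<M. \<bar>a n - l\<bar>) / real M"
      by (simp add: divide_right_mono)
    also have "(\<Sum>n<M. \<bar>a n - l\<bar>) < real M * e"
    proof -
      have "(\<Sum>n<M. \<bar>a n - l\<bar>) = C + (\<Sum>n=N..<M. \<bar>a n - l\<bar>)"
        unfolding C_def lessThan_atLeast0 using M by (subst sum.atLeastLessThan_concat) auto
      moreover have "(\<Sum>n=N..<M. \<bar>a n - l\<bar>) \<le> (\<Sum>n=N..<M. e / 2)"
        by (rule sum_mono) (use N in \<open>auto intro: less_imp_le\<close>)
      moreover have "\<dots> \<le> real M * (e / 2)"
        using \<open>e > 0\<close> by (simp add: mult_right_mono)
      moreover have "C < real M * (e / 2)"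
      proof -
        have "2 * C / e < real M" using K M by linarith
        then show ?thesis using \<open>e > 0\<close> by (simp add: field_simps)
      qed
      ultimately show ?thesis by simp
    qed
    finally have "\<bar>(\<Sum>n<M. a n) / real M - l\<bar> < (real M * e) / real M"
      using M by (simp add: divide_strict_right_mono)
    then show ?thesis using M by simp
  qed
  then show "\<exists>no. \<forall>n\<ge>no. norm ((\<Sum>n<n. a n) / real n - l) < e"
    by auto
qed

lemma abs_dirichlet_mult_sin_le: "\<bar>dirichlet N s\<bar> * \<bar>sin (pi * s)\<bar> \<le> 1"
  by (metis abs_mult abs_sin_le_one dirichlet_mult_sin)

lemma borel_measurable_dirichlet [measurable]: "dirichlet N \<in> borel_measurable borel"
  unfolding dirichlet_def[abs_def] by measurable

lemma abs_dirichlet_le: "\<bar>dirichlet N s\<bar> \<le> 2 * real N + 1"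
proof -
  have "\<bar>dirichlet N s\<bar> \<le> (\<Sum>k\<in>{- int N..int N}. 1)"
    unfolding dirichlet_def by (rule order.trans[OF sum_abs]) (intro sum_mono abs_cos_le_one)
  then show ?thesis by simp
qed

lemma dirichlet_periodic: "dirichlet N (s + real_of_int m) = dirichlet N s"
proof -
  have "cos (2 * pi * real_of_int k * (s + real_of_int m)) = cos (2 * pi * real_of_int k * s)" for k
  proof -
    have "2 * pi * real_of_int k * (s + real_of_int m) = 2 * pi * real_of_int k * s + 2 * pi * real_of_int (k * m)"
      by (simp add: algebra_simps)
    then show ?thesis
      by (simp add: cos_add sin_int_2pin cos_int_2pin del: of_int_mult)
  qed
  then show ?thesis by (simp add: dirichlet_def)
qed

text \<open>A function that vanishes linearly at both ends of the period absorbs the singularity of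
  the kernel, so dominated convergence replaces the usual splitting into a neighbourhood of 0 and
  its complement.\<close>

lemma fejer_tendsto_0:
  fixes h :: "real \<Rightarrow> real"
  assumes [measurable]: "h \<in> borel_measurable borel"
    and h: "\<And>s. 0 \<le> s \<Longrightarrow> s \<le> 1 \<Longrightarrow> \<bar>h s\<bar> \<le> L * min s (1 - s)"
  shows "(\<lambda>M. \<integral>s. indicator {0..<1} s * (h s * ((\<Sum>N<M. dirichlet N s) / real M)) \<partial>lborel) \<longlonglongrightarrow> 0"
proof -
  have L: "L \<ge> 0" using h[of "1/2"] by simp
  have sin_pos: "sin (pi * s) > 0" if "0 < s" "s < 1" for s
    using that by (intro sin_gt_zero) auto
  have "(\<lambda>M. \<integral>s. indicator {0..<1} s * (h s * ((\<Sum>N<M. dirichlet N s) / real M)) \<partial>lborel)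
    \<longlonglongrightarrow> integral\<^sup>L lborel (\<lambda>s::real. 0::real)"
  proof (rule integral_dominated_convergence)
    show "integrable lborel (\<lambda>s::real. indicator {0..<1} s * (L / 2))"
      by (intro integrable_mult_left integrable_real_indicator) auto
    show "AE s in lborel. (\<lambda>M. indicator {0..<1} s * (h s * ((\<Sum>N<M. dirichlet N s) / real M))) \<longlonglongrightarrow> 0"
    proof (rule AE_I2)
      fix s :: real
      show "(\<lambda>M. indicator {0..<1} s * (h s * ((\<Sum>N<M. dirichlet N s) / real M))) \<longlonglongrightarrow> 0"
      proof (cases "0 < s \<and> s < 1")
        case True
        define q where "q = (sin (pi * s))\<^sup>2"
        have q: "q > 0" using sin_pos[of s] True by (simp add: q_def)
        have "(\<lambda>M. (\<Sum>N<M. dirichlet N s) / real M) \<longlonglongrightarrow> 0"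
        proof (rule tendsto_0_le)
          show "(\<lambda>M. (1 / q) * (1 / real M)) \<longlonglongrightarrow> 0"
            by (intro tendsto_mult_right_zero lim_1_over_n)
          \<comment> \<open>For fixed \<open>s\<close> the closed form bounds the kernel sums
            uniformly in \<open>M\<close>, so their means are of order 1/M.\<close>
          have "\<bar>\<Sum>N<M. dirichlet N s\<bar> \<le> 1 / q" for M
          proof -
            have "(\<Sum>N<M. dirichlet N s) = (sin (real M * (pi * s)))\<^sup>2 / q"
              using fejer_closed_form[where M = M and s = s] q by (simp add: q_def field_simps)
            also have "\<bar>\<dots>\<bar> \<le> 1 / q"
              using q by (simp add: divide_right_mono abs_square_le_1)
            finally show ?thesis .
          qed
          then show "\<forall>\<^sub>F M in sequentially. norm ((\<Sum>N<M. dirichlet N s) / real M)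
              \<le> norm ((1 / q) * (1 / real M)) * 1"
            using q by (intro always_eventually allI) (simp add: abs_mult divide_right_mono flip: divide_divide_eq_left)
        qed
        then show ?thesis
          by (intro tendsto_mult_right_zero)
      next
        case False
        then have "s \<notin> {0..<1} \<or> s = 0" by auto
        then show ?thesis using h[of 0] by auto
      qed
    qed
    \<comment> \<open>The domination spends only one sine: the mean of the kernels times sin(pi s)
      is at most 1, and \<open>h\<close> is at most \<open>L / 2\<close> times that sine by
      \<open>sin_pi_ge\<close>.\<close>
    show "AE s in lborel. norm (indicator {0..<1} s * (h s * ((\<Sum>N<M. dirichlet N s) / real M)))
      \<le> indicator {0..<1} s * (L / 2)" for M
    proof (rule AE_I2)
      fix s :: real
      have "\<bar>h s\<bar> * (\<bar>\<Sum>N<M. dirichlet N s\<bar> / real M) \<le> L / 2" if s: "0 < s" "s < 1"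
      proof (cases "M = 0")
        case False
        have "\<bar>\<Sum>N<M. dirichlet N s\<bar> * sin (pi * s) \<le> (\<Sum>N<M. \<bar>dirichlet N s\<bar> * \<bar>sin (pi * s)\<bar>)"
          using sin_pos[OF s] by (subst sum_distrib_right[symmetric]) simp
        also have "\<dots> \<le> (\<Sum>N<M. 1)"
          by (intro sum_mono abs_dirichlet_mult_sin_le)
        finally have 1: "\<bar>\<Sum>N<M. dirichlet N s\<bar> / real M * sin (pi * s) \<le> 1"
          using False by (simp add: field_simps)
        have "\<bar>h s\<bar> \<le> L * (sin (pi * s) / 2)"
          using h[of s] mult_left_mono[OF sin_pi_ge[of s] L] s by simp
        then have "\<bar>h s\<bar> * (\<bar>\<Sum>N<M. dirichlet N s\<bar> / real M) \<le> L * (sin (pi * s) / 2) * (\<bar>\<Sum>N<M. dirichlet N s\<bar> / real M)"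
          by (rule mult_right_mono) simp
        also have "\<dots> = L / 2 * (\<bar>\<Sum>N<M. dirichlet N s\<bar> / real M * sin (pi * s))"
          by simp
        also have "\<dots> \<le> L / 2 * 1"
          using L 1 by (intro mult_left_mono) auto
        finally show ?thesis by simp
      qed (use L in simp)
      moreover have "h 0 = 0" using h[of 0] by simp
      ultimately show "norm (indicator {0..<1} s * (h s * ((\<Sum>N<M. dirichlet N s) / real M)))
          \<le> indicator {0..<1} s * (L / 2)"
        using L by (cases "s = 0") (auto simp: indicator_def abs_mult)
    qed
  qed measurable
  then show ?thesis by simp
qed

lemma integral_indicator_Ico_eq_Icc:
  fixes f :: "real \<Rightarrow> real"
  assumes [measurable]: "f \<in> borel_measurable borel"
  shows "(\<integral>s. indicator {a..<b} s * f s \<partial>lborel) = (\<integral>s. indicator {a..b} s * f s \<partial>lborel)"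
  by (rule integral_cong_AE) (use AE_lborel_singleton[of b] in \<open>auto simp: indicator_def elim!: eventually_mono\<close>)

lemma integral_cos_unit_interval:
  "(\<integral>s. indicator {0..<1} s * cos (2 * pi * real_of_int k * s) \<partial>lborel) = (if k = 0 then 1 else 0)"
proof (cases "k = 0")
  case False
  define w where "w = 2 * pi * real_of_int k"
  have w: "w \<noteq> 0" using False by (simp add: w_def)
  have "(\<integral>s. cos (w * s) * indicator {0..1} s \<partial>lborel) = sin (w * 1) / w - sin (w * 0) / w"
    by (rule integral_FTC_Icc_real) (use w in \<open>auto intro!: derivative_eq_intros continuous_intros\<close>)
  also have "\<dots> = 0"
    unfolding w_def using sin_int_2pin[of k] by simp
  finally show ?thesis
    using False by (subst integral_indicator_Ico_eq_Icc) (auto simp: w_def mult.commute)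
qed auto

lemma integrable_bounded_indicator_Ico:
  fixes f :: "real \<Rightarrow> real"
  assumes [measurable]: "f \<in> borel_measurable borel"
    and "\<And>s. s \<in> {a..<b} \<Longrightarrow> \<bar>f s\<bar> \<le> B"
  shows "integrable lborel (\<lambda>s. indicator {a..<b} s * f s)"
proof (rule Bochner_Integration.integrable_bound)
  have "emeasure lborel {a..<b} < \<infinity>"
    by (cases "a \<le> b") auto
  then show "integrable lborel (\<lambda>s. indicator {a..<b} s * B)"
    by (intro integrable_mult_left integrable_real_indicator) auto
qed (use assms(2) in \<open>auto simp: indicator_def intro!: AE_I2 order.trans[OF _ abs_ge_self]\<close>)

lemma integral_dirichlet_unit_interval:
  "(\<integral>s. indicator {0..<1} s * dirichlet N s \<partial>lborel) = 1"
proof -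
  have "(\<integral>s. indicator {0..<1} s * dirichlet N s \<partial>lborel)
      = (\<Sum>k\<in>{- int N..int N}. \<integral>s. indicator {0..<1} s * cos (2 * pi * real_of_int k * s) \<partial>lborel)"
    unfolding dirichlet_def sum_distrib_left
    by (intro Bochner_Integration.integral_sum integrable_bounded_indicator_Ico[where B = 1]) auto
  then show ?thesis
    by (simp add: integral_cos_unit_interval)
qed

lemma lipschitz_abs_imp_continuous_on:
  fixes \<psi> :: "real \<Rightarrow> real"
  assumes "\<And>x y. \<bar>\<psi> x - \<psi> y\<bar> \<le> L * \<bar>x - y\<bar>"
  shows "continuous_on UNIV \<psi>"
proof -
  have "L \<ge> 0" using assms[of 0 1] by simp
  then have "L-lipschitz_on UNIV \<psi>"
    using assms by (auto simp: lipschitz_on_def dist_real_def)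
  then show ?thesis by (rule lipschitz_on_continuous_on)
qed

section \<open>Fejer means of a Lipschitz function of bounded support\<close>

context
  fixes \<psi> :: "real \<Rightarrow> real" and L :: real and R :: nat
  assumes lip: "\<And>x y. \<bar>\<psi> x - \<psi> y\<bar> \<le> L * \<bar>x - y\<bar>"
    and supp: "\<And>x. \<bar>x\<bar> > real R \<Longrightarrow> \<psi> x = 0"
begin

private lemma measurable_psi: "\<psi> \<in> borel_measurable borel"
  by (rule borel_measurable_continuous_onI, rule lipschitz_abs_imp_continuous_on[OF lip])

text \<open>For \<open>s\<close> in the closed interval [0, 1] the window contains every integer
  \<open>m\<close> with |s + m| at most \<open>R\<close>. The index \<open>- int R - 1\<close>
  matters only at the end point 1, where it makes the value agree with the one at 0.\<close>

private definition "periodization s = (\<Sum>m\<in>{- int R - 1..int R}. \<psi> (s + real_of_int m))"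

private lemma measurable_periodization: "periodization \<in> borel_measurable borel"
  using measurable_psi[measurable] unfolding periodization_def[abs_def] by measurable

private lemma psi_bounded: "\<bar>\<psi> x\<bar> \<le> L * (2 * real R + 2)"
proof (cases "\<bar>x\<bar> > real R")
  case False
  have "L \<ge> 0" using lip[of 0 1] by simp
  have "\<bar>\<psi> x\<bar> = \<bar>\<psi> x - \<psi> (real R + 1)\<bar>"
    using supp[of "real R + 1"] by simp
  also have "\<dots> \<le> L * \<bar>x - (real R + 1)\<bar>" by (rule lip)
  also have "\<dots> \<le> L * (2 * real R + 2)"
    using False \<open>L \<ge> 0\<close> by (intro mult_left_mono) auto
  finally show ?thesis .
next
  case True
  then show ?thesis using lip[of 0 1] supp[of x] by simp
qed

private lemma bound_nonneg: "0 \<le> L * (2 * real R + 2)"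
  using psi_bounded[of 0] by linarith

text \<open>Unfolding: the line is cut into unit intervals, each is shifted to [0, 1), and the
  kernel, being 1-periodic, is unaffected by the shift.\<close>

private lemma integral_mult_dirichlet:
  "(\<integral>s. \<psi> s * dirichlet N s \<partial>lborel)
     = (\<integral>s. indicator {0..<1} s * (periodization s * dirichlet N s) \<partial>lborel)"
proof -
  note [measurable] = measurable_psi measurable_periodization
  have bnd: "\<bar>\<psi> x * dirichlet N y\<bar> \<le> L * (2 * real R + 2) * (2 * real N + 1)" for x y
    unfolding abs_mult by (intro mult_mono psi_bounded abs_dirichlet_le) (use lip[of 0 1] in auto)
  \<comment> \<open>Only the interval starting at the floor of \<open>s\<close> contributes;
    half-open intervals avoid counting integers twice.\<close>
  have split: "\<psi> s * dirichlet N s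
      = (\<Sum>m\<in>{- int R - 1..int R}. indicator {real_of_int m..<real_of_int m + 1} s * (\<psi> s * dirichlet N s))" for s
  proof (cases "\<bar>s\<bar> > real R")
    case False
    have "(\<Sum>m\<in>{- int R - 1..int R}. indicator {real_of_int m..<real_of_int m + 1} s * (\<psi> s * dirichlet N s))
       = (\<Sum>m\<in>{\<lfloor>s\<rfloor>}. indicator {real_of_int m..<real_of_int m + 1} s * (\<psi> s * dirichlet N s))"
    proof (rule sum.mono_neutral_right)
      show "{\<lfloor>s\<rfloor>} \<subseteq> {- int R - 1..int R}"
        using False by (auto simp: le_floor_iff floor_le_iff)
      show "\<forall>m\<in>{- int R - 1..int R} - {\<lfloor>s\<rfloor>}.
          indicator {real_of_int m..<real_of_int m + 1} s * (\<psi> s * dirichlet N s) = 0"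
        by (auto simp: indicator_def floor_unique)
    qed auto
    then show ?thesis by simp
  qed (use supp in simp)
  have "(\<integral>s. \<psi> s * dirichlet N s \<partial>lborel) = (\<Sum>m\<in>{- int R - 1..int R}.
      \<integral>s. indicator {real_of_int m..<real_of_int m + 1} s * (\<psi> s * dirichlet N s) \<partial>lborel)"
    by (subst split, rule Bochner_Integration.integral_sum, rule integrable_bounded_indicator_Ico[OF _ bnd])
      measurable
  also have "\<dots> = (\<Sum>m\<in>{- int R - 1..int R}.
      \<integral>s. indicator {0..<1} s * (\<psi> (s + real_of_int m) * dirichlet N s) \<partial>lborel)"
  proof (rule sum.cong)
    fix m :: int
    have "indicator {real_of_int m..<real_of_int m + 1} (real_of_int m + 1 * s)
        * (\<psi> (real_of_int m + 1 * s) * dirichlet N (real_of_int m + 1 * s))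
      = indicator {0..<1} s * (\<psi> (s + real_of_int m) * dirichlet N s)" for s :: real
      using dirichlet_periodic[of N s m] by (auto simp: indicator_def add.commute)
    then show "(\<integral>s. indicator {real_of_int m..<real_of_int m + 1} s * (\<psi> s * dirichlet N s) \<partial>lborel)
       = (\<integral>s. indicator {0..<1} s * (\<psi> (s + real_of_int m) * dirichlet N s) \<partial>lborel)"
      by (subst lborel_integral_real_affine[of 1 _ "real_of_int m"]) auto
  qed simp
  also have "\<dots> = (\<integral>s. indicator {0..<1} s * (periodization s * dirichlet N s) \<partial>lborel)"
    unfolding periodization_def sum_distrib_right sum_distrib_left
    by (rule Bochner_Integration.integral_sum[symmetric], rule integrable_bounded_indicator_Ico[OF _ bnd])
      measurable
  finally show ?thesis .
qed

private lemma periodization_0: "periodization 0 = (\<Sum>m\<in>{- int R..int R}. \<psi> (real_of_int m))"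
proof -
  have "{- int R - 1..int R} = insert (- int R - 1) {- int R..int R}" by auto
  then show ?thesis using supp[of "- real R - 1"] by (simp add: periodization_def)
qed

private lemma periodization_1: "periodization 1 = periodization 0"
proof -
  have "periodization 1 = (\<Sum>m\<in>{- int R..int R + 1}. \<psi> (real_of_int m))"
    unfolding periodization_def
    by (rule sum.reindex_bij_witness[of _ "\<lambda>m. m - 1" "\<lambda>m. m + 1"]) (auto simp: add.commute)
  also have "{- int R..int R + 1} = insert (int R + 1) {- int R..int R}" by auto
  finally show ?thesis using supp[of "real R + 1"] by (simp add: periodization_0 add.commute)
qed

private lemma periodization_lipschitz:
  "\<bar>periodization x - periodization y\<bar> \<le> real (2 * R + 2) * L * \<bar>x - y\<bar>"
proof -
  have "\<bar>periodization x - periodization y\<bar>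
    \<le> (\<Sum>m\<in>{- int R - 1..int R}. \<bar>\<psi> (x + real_of_int m) - \<psi> (y + real_of_int m)\<bar>)"
    unfolding periodization_def by (simp flip: sum_subtractf)
  also have "\<dots> \<le> (\<Sum>m\<in>{- int R - 1..int R}. L * \<bar>x - y\<bar>)"
    by (intro sum_mono order.trans[OF lip]) simp
  finally show ?thesis by (simp add: algebra_simps)
qed

text \<open>The kernels have integral 1 over a period, so subtracting the constant
  \<open>periodization 0\<close> leaves a function that vanishes at 0 and also at 1. Its Lipschitz
  constant is \<open>L\<close> times the number \<open>2 * R + 2\<close> of translates.\<close>

lemma fejer_tendsto:
  "(\<lambda>M. (\<Sum>N<M. \<integral>s. \<psi> s * dirichlet N s \<partial>lborel) / real M)
     \<longlonglongrightarrow> (\<Sum>m\<in>{- int R..int R}. \<psi> (real_of_int m))"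
proof -
  note [measurable] = measurable_psi measurable_periodization
  define B where "B = real (2 * R + 2) * (L * (2 * real R + 2))"
  have pB: "\<bar>periodization s\<bar> \<le> B" for s
  proof -
    have "\<bar>periodization s\<bar> \<le> (\<Sum>m\<in>{- int R - 1..int R}. L * (2 * real R + 2))"
      unfolding periodization_def by (rule order.trans[OF sum_abs]) (intro sum_mono psi_bounded)
    then show ?thesis by (simp add: B_def algebra_simps)
  qed
  have B: "B \<ge> 0" using pB[of 0] by simp
  have int1: "integrable lborel (\<lambda>s. indicator {0..<1} s * (periodization s * dirichlet N s))" for N
    by (rule integrable_bounded_indicator_Ico[where B = "B * (2 * real N + 1)"])
      (auto simp: abs_mult intro!: mult_mono pB abs_dirichlet_le B)
  have int2: "integrable lborel (\<lambda>s. indicator {0..<1} s * dirichlet N s)" for N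
    by (rule integrable_bounded_indicator_Ico[where B = "2 * real N + 1"])
      (auto intro!: abs_dirichlet_le)
  let ?h = "\<lambda>s. periodization s - periodization 0"
  have "(\<lambda>M. \<integral>s. indicator {0..<1} s * (?h s * ((\<Sum>N<M. dirichlet N s) / real M)) \<partial>lborel) \<longlonglongrightarrow> 0"
  proof (rule fejer_tendsto_0)
    show "\<bar>?h s\<bar> \<le> real (2 * R + 2) * L * min s (1 - s)" if "0 \<le> s" "s \<le> 1" for s
      using periodization_lipschitz[of s 0] periodization_lipschitz[of s 1] that
      by (auto simp: periodization_1 min_def)
  qed measurable
  then have *: "(\<lambda>M. (\<integral>s. indicator {0..<1} s * (?h s * ((\<Sum>N<M. dirichlet N s) / real M)) \<partial>lborel)
     + periodization 0) \<longlonglongrightarrow> 0 + periodization 0"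
    by (intro tendsto_intros)
  have "(\<integral>s. indicator {0..<1} s * (?h s * ((\<Sum>N<M. dirichlet N s) / real M)) \<partial>lborel) + periodization 0
    = (\<Sum>N<M. \<integral>s. \<psi> s * dirichlet N s \<partial>lborel) / real M" if "M > 0" for M
  proof -
    have "(\<integral>s. indicator {0..<1} s * (?h s * ((\<Sum>N<M. dirichlet N s) / real M)) \<partial>lborel)
      = (\<integral>s. (\<Sum>N<M. (indicator {0..<1} s * (periodization s * dirichlet N s)
          - periodization 0 * (indicator {0..<1} s * dirichlet N s)) / real M) \<partial>lborel)"
      by (rule Bochner_Integration.integral_cong)
        (simp_all add: sum_distrib_left sum_divide_distrib algebra_simps diff_divide_distrib flip: sum_subtractf)
    also have "\<dots> = (\<Sum>N<M. ((\<integral>s. indicator {0..<1} s * (periodization s * dirichlet N s) \<partial>lborel)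
          - periodization 0 * (\<integral>s. indicator {0..<1} s * dirichlet N s \<partial>lborel)) / real M)"
      using int1 int2 by simp
    also have "\<dots> = (\<Sum>N<M. \<integral>s. \<psi> s * dirichlet N s \<partial>lborel) / real M - periodization 0"
      using that by (simp add: integral_mult_dirichlet integral_dirichlet_unit_interval sum_subtractf
          diff_divide_distrib flip: sum_divide_distrib)
    finally show ?thesis by simp
  qed
  then have "\<forall>\<^sub>F M in sequentially.
      (\<integral>s. indicator {0..<1} s * (?h s * ((\<Sum>N<M. dirichlet N s) / real M)) \<partial>lborel) + periodization 0
    = (\<Sum>N<M. \<integral>s. \<psi> s * dirichlet N s \<partial>lborel) / real M"
    by (intro eventually_mono[OF eventually_gt_at_top[of 0]])
  from Lim_transform_eventually[OF * this] show ?thesis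
    by (simp add: periodization_0)
qed

text \<open>Summability makes the symmetric partial sums converge to the unconditional sum; their
  Cesaro means then have the same limit, and \<open>fejer_tendsto\<close> evaluates it.\<close>

lemma poisson_summation_1d:
  assumes sm: "(\<lambda>k. \<integral>s. \<psi> s * cos (2 * pi * real_of_int k * s) \<partial>lborel) summable_on UNIV"
  shows "(\<Sum>\<^sub>\<infinity>k. \<integral>s. \<psi> s * cos (2 * pi * real_of_int k * s) \<partial>lborel)
    = (\<Sum>m\<in>{- int R..int R}. \<psi> (real_of_int m))"
proof -
  note [measurable] = measurable_psi
  define a where "a k = (\<integral>s. \<psi> s * cos (2 * pi * real_of_int k * s) \<partial>lborel)" for k :: int
  have int: "integrable lborel (\<lambda>s. \<psi> s * cos (2 * pi * real_of_int k * s))" for k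
  proof -
    have "\<bar>\<psi> s * cos (2 * pi * real_of_int k * s)\<bar> \<le> L * (2 * real R + 2) * 1" for s
      unfolding abs_mult by (intro mult_mono psi_bounded abs_cos_le_one bound_nonneg) simp
    then have "integrable lborel (\<lambda>s. indicator {- real R - 1..<real R + 1} s * (\<psi> s * cos (2 * pi * real_of_int k * s)))"
      by (intro integrable_bounded_indicator_Ico) measurable
    also have "(\<lambda>s. indicator {- real R - 1..<real R + 1} s * (\<psi> s * cos (2 * pi * real_of_int k * s)))
      = (\<lambda>s. \<psi> s * cos (2 * pi * real_of_int k * s))"
    proof
      fix s show "indicator {- real R - 1..<real R + 1} s * (\<psi> s * cos (2 * pi * real_of_int k * s))
        = \<psi> s * cos (2 * pi * real_of_int k * s)"
        using supp[of s] by (cases "\<bar>s\<bar> > real R") (auto simp: indicator_def)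
    qed
    finally show ?thesis .
  qed
  have sumD: "(\<integral>s. \<psi> s * dirichlet N s \<partial>lborel) = sum a {- int N..int N}" for N
    unfolding dirichlet_def sum_distrib_left a_def
    by (rule Bochner_Integration.integral_sum) (rule int)
  \<comment> \<open>Symmetric intervals eventually contain every finite set of integers, so the
    unconditional sum may be evaluated along them.\<close>
  have "filterlim (\<lambda>N. {- int N..int N}) (finite_subsets_at_top UNIV) sequentially"
  proof (rule filterlim_finite_subsets_at_top[THEN iffD2], intro allI impI)
    fix X :: "int set"
    assume X: "finite X \<and> X \<subseteq> UNIV"
    obtain b where b: "\<And>x. x \<in> X \<Longrightarrow> \<bar>x\<bar> \<le> b"
      using X finite_imageI[of X abs] by (meson bdd_above_finite bdd_above.E imageI)
    have "X \<subseteq> {- int N..int N}" if "N \<ge> nat b" for N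
    proof
      fix x assume "x \<in> X"
      with b[of x] that show "x \<in> {- int N..int N}" by auto
    qed
    then show "\<forall>\<^sub>F N in sequentially. finite {- int N..int N} \<and> X \<subseteq> {- int N..int N} \<and> {- int N..int N} \<subseteq> UNIV"
      by (intro eventually_mono[OF eventually_ge_at_top[of "nat b"]]) auto
  qed
  moreover have "(sum a \<longlongrightarrow> (\<Sum>\<^sub>\<infinity>k. a k)) (finite_subsets_at_top UNIV)"
    using sm unfolding a_def by (rule infsum_tendsto)
  ultimately have "(\<lambda>N. sum a {- int N..int N}) \<longlonglongrightarrow> (\<Sum>\<^sub>\<infinity>k. a k)"
    by (rule filterlim_compose[rotated])
  then have "(\<lambda>M. (\<Sum>N<M. sum a {- int N..int N}) / real M) \<longlonglongrightarrow> (\<Sum>\<^sub>\<infinity>k. a k)"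
    by (rule tendsto_cesaro_mean)
  from LIMSEQ_unique[OF this fejer_tendsto[unfolded sumD]] show ?thesis
    by (simp only: a_def)
qed

end

section \<open>Poisson summation in two variables\<close>

lemma integrable_continuous_compact_support:
  fixes f :: "'a::euclidean_space \<Rightarrow> 'b::{banach, second_countable_topology}"
  assumes "continuous_on UNIV f" "compact K" "\<And>x. x \<notin> K \<Longrightarrow> f x = 0"
  shows "integrable lborel f"
proof -
  have "integrable lborel (\<lambda>x. indicator K x *\<^sub>R f x)"
    using assms(1,2) by (intro borel_integrable_compact) (auto intro: continuous_on_subset)
  also have "(\<lambda>x. indicator K x *\<^sub>R f x) = f"
    using assms(3) by (auto simp: indicator_def fun_eq_iff)
  finally show ?thesis .
qed

text \<open>The form without side conditions lets this act as a rewrite rule: if \<open>f\<close> is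
  not measurable, neither is its translate, and both integrals are 0 by convention.\<close>

lemma integral_lborel_translate:
  fixes f :: "'a::euclidean_space \<Rightarrow> 'b::{banach, second_countable_topology}"
  shows "(\<integral>x. f (c + x) \<partial>lborel) = (\<integral>x. f x \<partial>lborel)"
proof (cases "f \<in> borel_measurable borel")
  case [measurable]: True
  have "(\<integral>x. f x \<partial>lborel) = (\<integral>x. f x \<partial>distr lborel borel ((+) c))"
    by (simp add: lborel_distr_plus)
  also have "\<dots> = (\<integral>x. f (c + x) \<partial>lborel)"
    by (rule integral_distr) measurable
  finally show ?thesis ..
next
  case False
  have "(\<lambda>x. f (c + x)) \<notin> borel_measurable borel"
  proof
    assume [measurable]: "(\<lambda>x. f (c + x)) \<in> borel_measurable borel"
    have "(\<lambda>x. f (c + (- c + x))) \<in> borel_measurable borel"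
      by (rule measurable_compose[of "\<lambda>x. - c + x" borel borel "\<lambda>x. f (c + x)"]) measurable
    with False show False by simp
  qed
  with False have "\<not> integrable lborel f" "\<not> integrable lborel (\<lambda>x. f (c + x))"
    using borel_measurable_integrable[of lborel f] borel_measurable_integrable[of lborel "\<lambda>x. f (c + x)"]
    by auto
  then show ?thesis by (simp add: not_integrable_integral_eq)
qed

lemma integrable_lborel_translate:
  fixes f :: "'a::euclidean_space \<Rightarrow> 'b::{banach, second_countable_topology}"
  assumes "integrable lborel f"
  shows "integrable lborel (\<lambda>x. f (c + x))"
proof -
  have [measurable]: "f \<in> borel_measurable borel" using assms by auto
  have "integrable (distr lborel borel ((+) c)) f"
    using assms by (simp add: lborel_distr_plus)
  then show ?thesis
    by (subst (asm) integrable_distr_eq) measurable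
qed

text \<open>Integrating by parts twice costs the factor \<open>-1 / (2 \<pi> k)\<^sup>2\<close>, except for \<open>k = 0\<close>, where nothing is done.\<close>

definition fourier_weight :: "int \<Rightarrow> real" where
  "fourier_weight k = (if k = 0 then 1 else - 1 / (2 * pi * real_of_int k)\<^sup>2)"

definition fourier_order :: "int \<Rightarrow> nat" where
  "fourier_order k = (if k = 0 then 0 else 2)"

lemma fourier_order_le: "fourier_order k \<le> 2"
  by (simp add: fourier_order_def)

lemma summable_on_fourier_weight: "(\<lambda>k. \<bar>fourier_weight k\<bar>) summable_on UNIV"
proof -
  have nat: "(\<lambda>n::nat. 1 / (2 * pi * real n)\<^sup>2) summable_on UNIV"
  proof (rule norm_summable_imp_summable_on)
    have "summable (\<lambda>n::nat. 1 / (2 * pi)\<^sup>2 * inverse (real n ^ 2))"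
      by (intro summable_mult inverse_power_summable) simp
    then show "summable (\<lambda>n. norm (1 / (2 * pi * real n)\<^sup>2))"
      by (simp add: power_mult_distrib field_simps)
  qed
  define g where "g k = 1 / (2 * pi * real_of_int k)\<^sup>2" for k
  have 1: "g summable_on range int" "g summable_on range (\<lambda>n. - int n)"
    using nat by (subst summable_on_reindex; simp add: inj_on_def g_def o_def)+
  have "g summable_on range int \<union> range (\<lambda>n. - int n)"
    by (intro summable_on_union 1)
  moreover have "k \<in> range int \<union> range (\<lambda>n. - int n)" for k
    by (cases k rule: int_cases2) auto
  then have "range int \<union> range (\<lambda>n. - int n) = UNIV"
    by blast
  ultimately have "g summable_on UNIV"
    by simp
  \<comment> \<open>Division by zero gives \<open>g 0 = 0\<close>, whereas the weight at 0 is 1;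
    this single value is added here.\<close>
  then have "(\<lambda>k. g k + (if k = 0 then 1 else 0)) summable_on UNIV"
    by (rule summable_on_add) (rule finite_nonzero_values_imp_summable_on, auto)
  then show ?thesis
    by (rule summable_on_comparison_test) (auto simp: g_def fourier_weight_def)
qed

lemma summable_on_fourier_weight_prod:
  "(\<lambda>k. \<bar>fourier_weight (fst k)\<bar> * \<bar>fourier_weight (snd k)\<bar>) summable_on UNIV"
proof -
  have "(\<lambda>k. \<bar>fourier_weight (fst k)\<bar> * \<bar>fourier_weight (snd k)\<bar>) summable_on UNIV \<times> UNIV"
    by (rule summable_on_SigmaI[where g = "\<lambda>k. \<bar>fourier_weight k\<bar> * (\<Sum>\<^sub>\<infinity>l. \<bar>fourier_weight l\<bar>)"])
      (auto intro!: has_sum_cmult_right summable_on_cmult_left summable_on_fourier_weight has_sum_infsum)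
  then show ?thesis by simp
qed

text \<open>The phase \<alpha> treats sine and cosine, and later a shift of the origin, in one
  statement.\<close>

lemma fourier_by_parts:
  fixes \<psi> \<psi>' \<psi>'' :: "real \<Rightarrow> real"
  assumes d1: "\<And>x. (\<psi> has_real_derivative \<psi>' x) (at x)"
    and d2: "\<And>x. (\<psi>' has_real_derivative \<psi>'' x) (at x)"
    and c: "continuous_on UNIV \<psi>''"
    and supp: "\<And>x. \<bar>x\<bar> > real R \<Longrightarrow> \<psi> x = 0 \<and> \<psi>' x = 0 \<and> \<psi>'' x = 0"
    and w: "w \<noteq> 0"
  shows "(\<integral>s. \<psi> s * cos (w * s - \<alpha>) \<partial>lborel) = - 1 / w\<^sup>2 * (\<integral>s. \<psi>'' s * cos (w * s - \<alpha>) \<partial>lborel)"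
proof -
  \<comment> \<open>\<open>F\<close> collects the boundary terms of both partial integrations; in
    its derivative the terms with \<open>\<psi>'\<close> times the sine cancel. It is evaluated at
    distance 1 outside [-R, R], where it vanishes.\<close>
  define F where "F s = \<psi> s * sin (w * s - \<alpha>) / w + \<psi>' s * cos (w * s - \<alpha>) / w\<^sup>2" for s
  define f where "f s = \<psi> s * cos (w * s - \<alpha>) + \<psi>'' s * cos (w * s - \<alpha>) / w\<^sup>2" for s
  have cont: "isCont \<psi> x" "isCont \<psi>' x" "isCont \<psi>'' x" for x
    using DERIV_isCont[OF d1] DERIV_isCont[OF d2] c by (auto simp: continuous_on_eq_continuous_at)
  have int: "integrable lborel (\<lambda>s. \<psi> s * cos (w * s - \<alpha>))" "integrable lborel (\<lambda>s. \<psi>'' s * cos (w * s - \<alpha>))"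
    using supp cont by (auto intro!: integrable_continuous_compact_support[where K = "{- real R..real R}"]
        continuous_intros simp: continuous_on_eq_continuous_at)
  have "(\<integral>s. f s * indicator {- real R - 1..real R + 1} s \<partial>lborel) = F (real R + 1) - F (- real R - 1)"
  proof (rule integral_FTC_Icc_real)
    fix s :: real
    have "((\<lambda>s. sin (w * s - \<alpha>)) has_real_derivative cos (w * s - \<alpha>) * w) (at s)"
      and "((\<lambda>s. cos (w * s - \<alpha>)) has_real_derivative - sin (w * s - \<alpha>) * w) (at s)"
      by (auto intro!: derivative_eq_intros)
    then have "(F has_real_derivative
        (\<psi>' s * sin (w * s - \<alpha>) + cos (w * s - \<alpha>) * w * \<psi> s) / w
        + (\<psi>'' s * cos (w * s - \<alpha>) + - sin (w * s - \<alpha>) * w * \<psi>' s) / w\<^sup>2) (at s)"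
      unfolding F_def by (intro DERIV_add DERIV_cdivide DERIV_mult d1 d2)
    also have "(\<psi>' s * sin (w * s - \<alpha>) + cos (w * s - \<alpha>) * w * \<psi> s) / w
        + (\<psi>'' s * cos (w * s - \<alpha>) + - sin (w * s - \<alpha>) * w * \<psi>' s) / w\<^sup>2 = f s"
      using w by (simp add: f_def add_divide_distrib diff_divide_distrib power2_eq_square)
    finally show "(F has_real_derivative f s) (at s)" .
    show "isCont f s"
      unfolding f_def by (intro continuous_intros cont) (use w in auto)
  qed auto
  also have "F (real R + 1) - F (- real R - 1) = 0"
    using supp by (simp add: F_def)
  also have "(\<lambda>s. f s * indicator {- real R - 1..real R + 1} s) = f"
  proof
    fix s show "f s * indicator {- real R - 1..real R + 1} s = f s"
      using supp[of s] by (cases "\<bar>s\<bar> > real R") (auto simp: f_def indicator_def)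
  qed
  also have "integral\<^sup>L lborel f = (\<integral>s. \<psi> s * cos (w * s - \<alpha>) \<partial>lborel)
      + (\<integral>s. \<psi>'' s * cos (w * s - \<alpha>) \<partial>lborel) / w\<^sup>2"
    unfolding f_def using int by simp
  finally show ?thesis by simp
qed

definition square :: "nat \<Rightarrow> (real \<times> real) set" where
  "square R = {- real R..real R} \<times> {- real R..real R}"

lemma mem_square_iff: "s \<in> square R \<longleftrightarrow> \<bar>fst s\<bar> \<le> real R \<and> \<bar>snd s\<bar> \<le> real R"
  by (cases s) (auto simp: square_def)

lemma compact_square: "compact (square R)"
  unfolding square_def by (intro compact_Times compact_Icc)

lemma square_measurable [measurable]: "square R \<in> sets borel"
  using compact_imp_closed[OF compact_square] by auto

definition int_pair :: "int \<times> int \<Rightarrow> real \<times> real" where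
  "int_pair k = (real_of_int (fst k), real_of_int (snd k))"

text \<open>
  \<open>D m n\<close> plays the partial derivative of order \<open>(m, n)\<close>. Only orders up to \<open>2\<close> in each variable are
  required, so that explicit cutoffs of boxes qualify besides the test functions.
\<close>

locale bump =
  fixes D :: "nat \<Rightarrow> nat \<Rightarrow> real \<times> real \<Rightarrow> real" and R :: nat
  assumes cont: "m \<le> 2 \<Longrightarrow> n \<le> 2 \<Longrightarrow> continuous_on UNIV (D m n)"
    and supp: "m \<le> 2 \<Longrightarrow> n \<le> 2 \<Longrightarrow> \<bar>fst s\<bar> > real R \<or> \<bar>snd s\<bar> > real R \<Longrightarrow> D m n s = 0"
    and deriv1: "m < 2 \<Longrightarrow> n \<le> 2 \<Longrightarrow> ((\<lambda>x. D m n (x, y)) has_real_derivative D (Suc m) n (x, y)) (at x)"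
    and deriv2: "m \<le> 2 \<Longrightarrow> n < 2 \<Longrightarrow> ((\<lambda>y. D m n (x, y)) has_real_derivative D m (Suc n) (x, y)) (at y)"
begin

abbreviation "\<phi> \<equiv> D 0 0"

lemma supp_square: "m \<le> 2 \<Longrightarrow> n \<le> 2 \<Longrightarrow> s \<notin> square R \<Longrightarrow> D m n s = 0"
  using supp[of m n s] by (auto simp: mem_square_iff)

lemma cont_compose [continuous_intros]:
  "m \<le> 2 \<Longrightarrow> n \<le> 2 \<Longrightarrow> continuous_on S f \<Longrightarrow> continuous_on S (\<lambda>x. D m n (f x))"
  by (rule continuous_on_compose2[OF cont]) auto

lemma integrable_D:
  assumes "m \<le> 2" "n \<le> 2"
  shows "integrable lborel (\<lambda>s. D m n s * cos (a * fst s - \<alpha>) * cos (b * snd s - \<beta>))"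
    and "integrable lborel (D m n)"
  using assms compact_square supp_square
  by (auto intro!: integrable_continuous_compact_support[where K = "square R"] continuous_intros cont)

lemma integrable_D_section1:
  assumes "m \<le> 2" "n \<le> 2"
  shows "integrable lborel (\<lambda>x. D m n (x, y) * cos (a * x - \<alpha>))"
  using assms supp by (auto intro!: integrable_continuous_compact_support[where K = "{- real R..real R}"] continuous_intros)

text \<open>The phases \<alpha> and \<beta> let these integrals stand for all products of sines and
  cosines, centred at any point.\<close>

definition coef :: "nat \<Rightarrow> nat \<Rightarrow> int \<times> int \<Rightarrow> real \<Rightarrow> real \<Rightarrow> real" where
  "coef m n k \<alpha> \<beta> = (\<integral>s. D m n s * cos (2 * pi * real_of_int (fst k) * fst s - \<alpha>)
     * cos (2 * pi * real_of_int (snd k) * snd s - \<beta>) \<partial>lborel)"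

lemma coef_iterated1:
  assumes "m \<le> 2" "n \<le> 2"
  shows "coef m n k \<alpha> \<beta> = (\<integral>y. cos (2 * pi * real_of_int (snd k) * y - \<beta>)
     * (\<integral>x. D m n (x, y) * cos (2 * pi * real_of_int (fst k) * x - \<alpha>) \<partial>lborel) \<partial>lborel)"
proof -
  define f where "f x y = cos (2 * pi * real_of_int (snd k) * y - \<beta>)
      * (D m n (x, y) * cos (2 * pi * real_of_int (fst k) * x - \<alpha>))" for x y
  have eq: "(\<lambda>s. D m n s * cos (2 * pi * real_of_int (fst k) * fst s - \<alpha>)
      * cos (2 * pi * real_of_int (snd k) * snd s - \<beta>)) = case_prod f"
    by (auto simp: f_def fun_eq_iff)
  have "integrable (lborel \<Otimes>\<^sub>M lborel) (case_prod f)"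
    using integrable_D(1)[OF assms] unfolding lborel_prod eq[symmetric] .
  from lborel_pair.integral_snd[OF this] show ?thesis
    unfolding coef_def eq lborel_prod by (simp add: f_def)
qed

lemma coef_iterated2:
  assumes "m \<le> 2" "n \<le> 2"
  shows "coef m n k \<alpha> \<beta> = (\<integral>x. cos (2 * pi * real_of_int (fst k) * x - \<alpha>)
     * (\<integral>y. D m n (x, y) * cos (2 * pi * real_of_int (snd k) * y - \<beta>) \<partial>lborel) \<partial>lborel)"
proof -
  define f where "f x y = cos (2 * pi * real_of_int (fst k) * x - \<alpha>)
      * (D m n (x, y) * cos (2 * pi * real_of_int (snd k) * y - \<beta>))" for x y
  have eq: "(\<lambda>s. D m n s * cos (2 * pi * real_of_int (fst k) * fst s - \<alpha>)
      * cos (2 * pi * real_of_int (snd k) * snd s - \<beta>)) = case_prod f"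
    by (auto simp: f_def fun_eq_iff)
  have "integrable (lborel \<Otimes>\<^sub>M lborel) (case_prod f)"
    using integrable_D(1)[OF assms] unfolding lborel_prod eq[symmetric] .
  from lborel_pair.integral_fst[OF this] show ?thesis
    unfolding coef_def eq lborel_prod by (simp add: f_def case_prod_beta')
qed

lemma section_by_parts1:
  assumes "n \<le> 2"
  shows "(\<integral>x. D 0 n (x, y) * cos (2 * pi * real_of_int k * x - \<alpha>) \<partial>lborel)
    = fourier_weight k * (\<integral>x. D (fourier_order k) n (x, y) * cos (2 * pi * real_of_int k * x - \<alpha>) \<partial>lborel)"
proof (cases "k = 0")
  case False
  have "(\<integral>x. D 0 n (x, y) * cos ((2 * pi * real_of_int k) * x - \<alpha>) \<partial>lborel)
    = - 1 / (2 * pi * real_of_int k)\<^sup>2 * (\<integral>x. D 2 n (x, y) * cos ((2 * pi * real_of_int k) * x - \<alpha>) \<partial>lborel)"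
    by (rule fourier_by_parts[where R = R and \<psi>' = "\<lambda>x. D 1 n (x, y)"])
      (use assms False deriv1[of 0 n y] deriv1[of 1 n y] supp in
        \<open>auto intro!: continuous_intros simp: numeral_2_eq_2\<close>)
  then show ?thesis using False by (simp add: fourier_weight_def fourier_order_def)
qed (simp add: fourier_weight_def fourier_order_def)

lemma section_by_parts2:
  assumes "m \<le> 2"
  shows "(\<integral>y. D m 0 (x, y) * cos (2 * pi * real_of_int k * y - \<alpha>) \<partial>lborel)
    = fourier_weight k * (\<integral>y. D m (fourier_order k) (x, y) * cos (2 * pi * real_of_int k * y - \<alpha>) \<partial>lborel)"
proof (cases "k = 0")
  case False
  have "(\<integral>y. D m 0 (x, y) * cos ((2 * pi * real_of_int k) * y - \<alpha>) \<partial>lborel)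
    = - 1 / (2 * pi * real_of_int k)\<^sup>2 * (\<integral>y. D m 2 (x, y) * cos ((2 * pi * real_of_int k) * y - \<alpha>) \<partial>lborel)"
    by (rule fourier_by_parts[where R = R and \<psi>' = "\<lambda>y. D m 1 (x, y)"])
      (use assms False deriv2[of m 0 x] deriv2[of m 1 x] supp in
        \<open>auto intro!: continuous_intros simp: numeral_2_eq_2\<close>)
  then show ?thesis using False by (simp add: fourier_weight_def fourier_order_def)
qed (simp add: fourier_weight_def fourier_order_def)

text \<open>Fubini in one order allows partial integration in \<open>x\<close> for each fixed
  \<open>y\<close>, Fubini in the other order the same in \<open>y\<close>. The mixed derivative
  \<open>D 2 2\<close> occurs, so \<open>bump\<close> bounds the orders in each variable
  separately.\<close>

lemma coef_by_parts:
  "coef 0 0 k \<alpha> \<beta> = fourier_weight (fst k) * (fourier_weight (snd k)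
     * coef (fourier_order (fst k)) (fourier_order (snd k)) k \<alpha> \<beta>)"
proof -
  have "coef 0 0 k \<alpha> \<beta> = fourier_weight (fst k) * coef (fourier_order (fst k)) 0 k \<alpha> \<beta>"
    by (subst (1 2) coef_iterated1) (simp_all add: fourier_order_le section_by_parts1[of 0]
        mult.left_commute[of _ "fourier_weight (fst k)"])
  also have "coef (fourier_order (fst k)) 0 k \<alpha> \<beta>
      = fourier_weight (snd k) * coef (fourier_order (fst k)) (fourier_order (snd k)) k \<alpha> \<beta>"
    by (subst (1 2) coef_iterated2) (simp_all add: fourier_order_le section_by_parts2[OF fourier_order_le]
        mult.left_commute[of _ "fourier_weight (snd k)"])
  finally show ?thesis .
qed

text \<open>A crude uniform constant: the sum of all nine integrals dominates whichever pair of
  orders \<open>fourier_order\<close> selects.\<close>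

definition decay_const :: real where
  "decay_const = (\<Sum>m\<le>2. \<Sum>n\<le>2. \<integral>s. \<bar>D m n s\<bar> \<partial>lborel)"

lemma abs_coef_le:
  "\<bar>coef 0 0 k \<alpha> \<beta>\<bar> \<le> decay_const * (\<bar>fourier_weight (fst k)\<bar> * \<bar>fourier_weight (snd k)\<bar>)"
proof -
  have "\<bar>coef m n k \<alpha> \<beta>\<bar> \<le> decay_const" if mn: "m \<le> 2" "n \<le> 2" for m n
  proof -
    have "\<bar>coef m n k \<alpha> \<beta>\<bar> \<le> (\<integral>s. \<bar>D m n s\<bar> \<partial>lborel)"
      unfolding coef_def
    proof (rule integral_abs_bound[THEN order.trans], rule integral_mono)
      fix s :: "real \<times> real"
      have "\<bar>D m n s\<bar> * \<bar>cos (2 * pi * real_of_int (fst k) * fst s - \<alpha>)\<bar>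
          * \<bar>cos (2 * pi * real_of_int (snd k) * snd s - \<beta>)\<bar> \<le> \<bar>D m n s\<bar> * 1 * 1"
        by (intro mult_mono abs_cos_le_one) auto
      then show "\<bar>D m n s * cos (2 * pi * real_of_int (fst k) * fst s - \<alpha>)
          * cos (2 * pi * real_of_int (snd k) * snd s - \<beta>)\<bar> \<le> \<bar>D m n s\<bar>"
        by (simp add: abs_mult)
    qed (use integrable_D[OF mn] in auto)
    also have "\<dots> \<le> (\<Sum>n\<le>2. \<integral>s. \<bar>D m n s\<bar> \<partial>lborel)"
      using mn by (intro member_le_sum) auto
    also have "\<dots> \<le> decay_const"
      unfolding decay_const_def
      using mn by (intro member_le_sum[of m _ "\<lambda>m. \<Sum>n\<le>2. \<integral>s. \<bar>D m n s\<bar> \<partial>lborel"] sum_nonneg) auto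
    finally show ?thesis .
  qed
  from mult_left_mono[OF this[OF fourier_order_le fourier_order_le],
      of "\<bar>fourier_weight (fst k)\<bar> * \<bar>fourier_weight (snd k)\<bar>" "fst k" "snd k"]
  show ?thesis
    unfolding coef_by_parts abs_mult by (simp add: mult.assoc mult.commute[of decay_const])
qed

lemma summable_on_coef: "(\<lambda>k. coef 0 0 k (\<alpha> k) (\<beta> k)) summable_on UNIV"
proof (rule abs_summable_summable, rule summable_on_comparison_test)
  show "(\<lambda>k. decay_const * (\<bar>fourier_weight (fst k)\<bar> * \<bar>fourier_weight (snd k)\<bar>)) summable_on UNIV"
    by (intro summable_on_cmult_right summable_on_fourier_weight_prod)
qed (use abs_coef_le in auto)

lemma bounded_D: assumes "m \<le> 2" "n \<le> 2" obtains B where "B \<ge> 0" "\<And>s. \<bar>D m n s\<bar> \<le> B"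
proof -
  have "compact (D m n ` square R)"
    using assms by (intro compact_continuous_image continuous_on_subset[OF cont] compact_square) auto
  then obtain B where B: "\<And>s. s \<in> square R \<Longrightarrow> \<bar>D m n s\<bar> \<le> B"
    by (meson bounded_real compact_imp_bounded imageI)
  show ?thesis
  proof (rule that[of "max B 0"])
    fix s show "\<bar>D m n s\<bar> \<le> max B 0"
      using B[of s] supp_square[OF assms, of s] by (cases "s \<in> square R") auto
  qed auto
qed

lemma lipschitz1: obtains L where "L \<ge> 0" "\<And>x x' y. \<bar>\<phi> (x, y) - \<phi> (x', y)\<bar> \<le> L * \<bar>x - x'\<bar>"
proof -
  obtain B where B: "B \<ge> 0" "\<And>s. \<bar>D 1 0 s\<bar> \<le> B" using bounded_D[of 1 0] by auto
  have "norm (\<phi> (x, y) - \<phi> (x', y)) \<le> B * norm (x - x')" for x x' y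
    by (rule field_differentiable_bound[where S = UNIV and f' = "\<lambda>x. D 1 0 (x, y)" and f = "\<lambda>x. \<phi> (x, y)"])
      (use B deriv1[of 0 0] in auto)
  with B that show ?thesis by simp
qed

lemma lipschitz2: obtains L where "L \<ge> 0" "\<And>x y y'. \<bar>\<phi> (x, y) - \<phi> (x, y')\<bar> \<le> L * \<bar>y - y'\<bar>"
proof -
  obtain B where B: "B \<ge> 0" "\<And>s. \<bar>D 0 1 s\<bar> \<le> B" using bounded_D[of 0 1] by auto
  have "norm (\<phi> (x, y) - \<phi> (x, y')) \<le> B * norm (y - y')" for x y y'
    by (rule field_differentiable_bound[where S = UNIV and f' = "\<lambda>y. D 0 1 (x, y)" and f = "\<lambda>y. \<phi> (x, y)"])
      (use B deriv2[of 0 0] in auto)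
  with B that show ?thesis by simp
qed

definition partial_coef :: "int \<Rightarrow> real \<Rightarrow> real" where
  "partial_coef k y = (\<integral>x. \<phi> (x, y) * cos (2 * pi * real_of_int k * x) \<partial>lborel)"

text \<open>This does not follow from the decay of \<open>coef\<close>, because \<open>y\<close> is
  a fixed point here and not integrated; two partial integrations in \<open>x\<close> again give
  inverse squares.\<close>

lemma summable_on_partial_coef: "(\<lambda>k. partial_coef k y) summable_on UNIV"
proof -
  obtain B where B: "B \<ge> 0" "\<And>m. m \<in> {0, 2} \<Longrightarrow> (\<integral>x. \<bar>D m 0 (x, y)\<bar> \<partial>lborel) \<le> B"
  proof (rule that)
    show "(\<integral>x. \<bar>D m 0 (x, y)\<bar> \<partial>lborel) \<le> (\<integral>x. \<bar>D 0 0 (x, y)\<bar> \<partial>lborel) + (\<integral>x. \<bar>D 2 0 (x, y)\<bar> \<partial>lborel)"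
      if "m \<in> {0, 2}" for m using that by auto
  qed auto
  have "\<bar>partial_coef k y\<bar> \<le> B * \<bar>fourier_weight k\<bar>" for k
  proof -
    have "\<bar>\<integral>x. D (fourier_order k) 0 (x, y) * cos (2 * pi * real_of_int k * x - 0) \<partial>lborel\<bar>
       \<le> (\<integral>x. \<bar>D (fourier_order k) 0 (x, y)\<bar> \<partial>lborel)"
    proof (rule integral_abs_bound[THEN order.trans], rule integral_mono)
      show "integrable lborel (\<lambda>x. \<bar>D (fourier_order k) 0 (x, y) * cos (2 * pi * real_of_int k * x - 0)\<bar>)"
        by (intro integrable_abs integrable_D_section1 fourier_order_le) simp
      show "integrable lborel (\<lambda>x. \<bar>D (fourier_order k) 0 (x, y)\<bar>)"
        using integrable_abs[OF integrable_D_section1[OF fourier_order_le[of k], of 0 y 0 0]] by simp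
    qed (simp add: abs_mult mult_left_le)
    also have "\<dots> \<le> B"
      by (rule B) (simp add: fourier_order_def)
    finally have "\<bar>fourier_weight k\<bar> * \<bar>\<integral>x. D (fourier_order k) 0 (x, y) * cos (2 * pi * real_of_int k * x - 0) \<partial>lborel\<bar>
        \<le> \<bar>fourier_weight k\<bar> * B"
      by (rule mult_left_mono) simp
    then show ?thesis
      using section_by_parts1[of 0 y k 0] by (simp add: partial_coef_def abs_mult mult.commute)
  qed
  then show ?thesis
    by (intro abs_summable_summable[OF summable_on_comparison_test[OF
          summable_on_cmult_right[OF summable_on_fourier_weight, of B]]]) auto
qed

lemma poisson_partial: "(\<Sum>\<^sub>\<infinity>k. partial_coef k y) = (\<Sum>m\<in>{- int R..int R}. \<phi> (real_of_int m, y))"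
proof -
  obtain L where L: "L \<ge> 0" "\<And>x x' y. \<bar>\<phi> (x, y) - \<phi> (x', y)\<bar> \<le> L * \<bar>x - x'\<bar>"
    using lipschitz1 by blast
  show ?thesis
    using summable_on_partial_coef[of y] unfolding partial_coef_def
    by (intro poisson_summation_1d[where L = L]) (use L supp in auto)
qed

text \<open>This regularity in \<open>y\<close> admits \<open>partial_coef k\<close> to the
  one-dimensional formula. The constant found is the Lipschitz constant of \<phi> in
  \<open>y\<close> times the length 2R of the interval that carries it in \<open>x\<close>.\<close>

lemma partial_coef_lipschitz:
  obtains L where "\<And>y y'. \<bar>partial_coef k y - partial_coef k y'\<bar> \<le> L * \<bar>y - y'\<bar>"
proof -
  obtain L where L: "L \<ge> 0" "\<And>x y y'. \<bar>\<phi> (x, y) - \<phi> (x, y')\<bar> \<le> L * \<bar>y - y'\<bar>"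
    using lipschitz2 by blast
  have int: "integrable lborel (\<lambda>x. \<phi> (x, y) * cos (2 * pi * real_of_int k * x))" for y
    using integrable_D_section1[of 0 0 y "2 * pi * real_of_int k" 0] by simp
  have "\<bar>partial_coef k y - partial_coef k y'\<bar> \<le> L * 2 * real R * \<bar>y - y'\<bar>" for y y'
  proof -
    have "\<bar>partial_coef k y - partial_coef k y'\<bar>
      = \<bar>\<integral>x. (\<phi> (x, y) - \<phi> (x, y')) * cos (2 * pi * real_of_int k * x) \<partial>lborel\<bar>"
      unfolding partial_coef_def using int by (simp add: left_diff_distrib)
    also have "\<dots> \<le> (\<integral>x. indicator {- real R..real R} x * (L * \<bar>y - y'\<bar>) \<partial>lborel)"
    proof (rule integral_abs_bound[THEN order.trans], rule integral_mono)
      fix x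
      have "\<bar>\<phi> (x, y) - \<phi> (x, y')\<bar> * \<bar>cos (2 * pi * real_of_int k * x)\<bar> \<le> (L * \<bar>y - y'\<bar>) * 1"
        using L by (intro mult_mono) auto
      then show "\<bar>(\<phi> (x, y) - \<phi> (x, y')) * cos (2 * pi * real_of_int k * x)\<bar>
          \<le> indicator {- real R..real R} x * (L * \<bar>y - y'\<bar>)"
        using supp[of 0 0 "(x, y)"] supp[of 0 0 "(x, y')"] by (auto simp: indicator_def abs_mult)
    qed (use int in \<open>auto simp: left_diff_distrib\<close>)
    also have "\<dots> = L * 2 * real R * \<bar>y - y'\<bar>"
      by simp
    finally show ?thesis .
  qed
  then show ?thesis by (rule that)
qed

text \<open>The sum over pairs is iterated. For a fixed first index the inner sum is the
  one-dimensional formula in \<open>y\<close>; its value is a finite sum over \<open>n\<close>,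
  which is pulled out before the formula is used once more in \<open>x\<close>.\<close>

lemma poisson_summation_2d_at_0:
  "(\<Sum>\<^sub>\<infinity>k. coef 0 0 k 0 0) = (\<Sum>n\<in>{- int R..int R}. \<Sum>m\<in>{- int R..int R}. \<phi> (real_of_int m, real_of_int n))"
proof -
  have inner: "(\<Sum>\<^sub>\<infinity>l. coef 0 0 (k, l) 0 0) = (\<Sum>n\<in>{- int R..int R}. partial_coef k (real_of_int n))" for k
  proof -
    obtain L where L: "\<And>y y'. \<bar>partial_coef k y - partial_coef k y'\<bar> \<le> L * \<bar>y - y'\<bar>"
      using partial_coef_lipschitz by blast
    have eq: "coef 0 0 (k, l) 0 0 = (\<integral>y. partial_coef k y * cos (2 * pi * real_of_int l * y) \<partial>lborel)" for l
      by (subst coef_iterated1) (simp_all add: partial_coef_def mult.commute)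
    have "(\<lambda>l. coef 0 0 (k, l) 0 0) summable_on UNIV"
      using summable_on_reindex[of "Pair k" UNIV "\<lambda>k. coef 0 0 k 0 0"] summable_on_coef[of "\<lambda>_. 0" "\<lambda>_. 0"]
      by (auto simp: o_def inj_on_def intro: summable_on_subset)
    then show ?thesis
      unfolding eq
      by (intro poisson_summation_1d[OF L]) (use supp in \<open>simp_all add: partial_coef_def\<close>)
  qed
  have "(\<Sum>\<^sub>\<infinity>k. coef 0 0 k 0 0) = (\<Sum>\<^sub>\<infinity>k. \<Sum>\<^sub>\<infinity>l. coef 0 0 (k, l) 0 0)"
    using infsum_Sigma_banach[of "\<lambda>k. coef 0 0 k 0 0" UNIV "\<lambda>_. UNIV"]
      summable_on_coef[of "\<lambda>_. 0" "\<lambda>_. 0"] by simp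
  also have "\<dots> = (\<Sum>\<^sub>\<infinity>k. \<Sum>n\<in>{- int R..int R}. partial_coef k (real_of_int n))"
    by (simp add: inner)
  also have "\<dots> = (\<Sum>n\<in>{- int R..int R}. \<Sum>\<^sub>\<infinity>k. partial_coef k (real_of_int n))"
    by (rule infsumI, rule has_sum_sum) (auto intro!: has_sum_infsum summable_on_partial_coef)
  finally show ?thesis by (simp add: poisson_partial)
qed

end

section \<open>Translation to an arbitrary point and parity in the index\<close>

context bump
begin

text \<open>Reduces summation over the lattice shifted by \<open>x\<close> to the formula at 0; the
  radius is enlarged to keep the shifted support inside the square.\<close>

lemma bump_translate:
  obtains R' where "bump (\<lambda>m n s. D m n (x + s)) R'"
proof (rule that)
  define R' where "R' = R + nat \<lceil>max \<bar>fst x\<bar> \<bar>snd x\<bar>\<rceil>"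
  have R': "real R' \<ge> real R + \<bar>fst x\<bar>" "real R' \<ge> real R + \<bar>snd x\<bar>"
    unfolding R'_def by linarith+
  show "bump (\<lambda>m n s. D m n (x + s)) R'"
  proof
    show "D m n (x + s) = 0"
      if "m \<le> 2" "n \<le> 2" "\<bar>fst s\<bar> > real R' \<or> \<bar>snd s\<bar> > real R'" for m n s
      using that R' by (intro supp) auto
    show "((\<lambda>a. D m n (x + (a, b))) has_real_derivative D (Suc m) n (x + (a, b))) (at a)"
      if "m < 2" "n \<le> 2" for m n a b
      using that DERIV_shift[THEN iffD1, OF deriv1[of m n "snd x + b" "a + fst x"]]
      by (simp add: plus_prod_def add.commute)
    show "((\<lambda>b. D m n (x + (a, b))) has_real_derivative D m (Suc n) (x + (a, b))) (at b)"
      if "m \<le> 2" "n < 2" for m n a b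
      using that DERIV_shift[THEN iffD1, OF deriv2[of m n "fst x + a" "b + snd x"]]
      by (simp add: plus_prod_def add.commute)
  qed (auto intro!: continuous_intros)
qed

lemma infsum_int_pair:
  "(\<Sum>\<^sub>\<infinity>k. \<phi> (int_pair k)) = (\<Sum>n\<in>{- int R..int R}. \<Sum>m\<in>{- int R..int R}. \<phi> (real_of_int m, real_of_int n))"
proof -
  have "(\<Sum>\<^sub>\<infinity>k. \<phi> (int_pair k)) = (\<Sum>\<^sub>\<infinity>k\<in>{- int R..int R} \<times> {- int R..int R}. \<phi> (int_pair k))"
  proof (rule infsum_cong_neutral)
    fix k assume "k \<in> UNIV - {- int R..int R} \<times> {- int R..int R}"
    then have "\<bar>fst (int_pair k)\<bar> > real R \<or> \<bar>snd (int_pair k)\<bar> > real R"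
      by (cases k) (auto simp: int_pair_def)
    then show "\<phi> (int_pair k) = 0" by (intro supp) auto
  qed auto
  also have "\<dots> = (\<Sum>m\<in>{- int R..int R}. \<Sum>n\<in>{- int R..int R}. \<phi> (real_of_int m, real_of_int n))"
    by (simp add: sum.cartesian_product int_pair_def case_prod_beta')
  also have "\<dots> = (\<Sum>n\<in>{- int R..int R}. \<Sum>m\<in>{- int R..int R}. \<phi> (real_of_int m, real_of_int n))"
    by (rule sum.swap)
  finally show ?thesis .
qed

text \<open>With sines and cosines for \<open>u\<close> and \<open>v\<close>, these are the real
  coefficients of \<open>q\<close>, \<open>qi * q\<close>, \<open>q * qj\<close> and
  \<open>qi * q * qj\<close> once a two-sided character is paired with \<phi>.\<close>

definition trig_coef :: "(real \<Rightarrow> real) \<Rightarrow> (real \<Rightarrow> real) \<Rightarrow> real \<times> real \<Rightarrow> int \<times> int \<Rightarrow> real" where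
  "trig_coef u v x k = (\<integral>s. \<phi> s * u (2 * pi * real_of_int (fst k) * (fst s - fst x))
     * v (2 * pi * real_of_int (snd k) * (snd s - snd x)) \<partial>lborel)"

lemma sin_cos_shift: "sin y = cos (y - pi / 2)" for y :: real
  by (simp add: cos_diff)

text \<open>Both the sine and the centre \<open>x\<close> are absorbed in phases. These depend on
  \<open>k\<close>, which is why \<open>summable_on_coef\<close> admits phases varying with
  \<open>k\<close>.\<close>

lemma trig_coef_eq_coef:
  assumes "u \<in> {sin, cos}" "v \<in> {sin, cos}"
  obtains \<alpha> \<beta> where "\<And>k. trig_coef u v x k = coef 0 0 k (\<alpha> k) (\<beta> k)"
proof -
  have *: "\<exists>\<gamma>. \<forall>k y. u (2 * pi * real_of_int k * (y - z)) = cos (2 * pi * real_of_int k * y - \<gamma> k)"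
    if "u \<in> {sin, cos}" for u :: "real \<Rightarrow> real" and z
  proof (cases "u = cos")
    case True
    then show ?thesis
      by (intro exI[of _ "\<lambda>k. 2 * pi * real_of_int k * z"]) (simp add: right_diff_distrib)
  next
    case False
    with that have "u = sin" by simp
    then show ?thesis
      by (intro exI[of _ "\<lambda>k. 2 * pi * real_of_int k * z + pi / 2"])
        (simp add: right_diff_distrib sin_cos_shift diff_diff_eq)
  qed
  obtain \<gamma> where g: "\<And>k y. u (2 * pi * real_of_int k * (y - fst x)) = cos (2 * pi * real_of_int k * y - \<gamma> k)"
    using *[OF assms(1)] by blast
  obtain \<gamma>' where g': "\<And>k y. v (2 * pi * real_of_int k * (y - snd x)) = cos (2 * pi * real_of_int k * y - \<gamma>' k)"
    using *[OF assms(2)] by blast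
  show ?thesis
    by (rule that[of "\<lambda>k. \<gamma> (fst k)" "\<lambda>k. \<gamma>' (snd k)"]) (simp add: trig_coef_def coef_def g g')
qed

lemma abs_trig_coef_le:
  assumes "u \<in> {sin, cos}" "v \<in> {sin, cos}"
  shows "\<bar>trig_coef u v x k\<bar> \<le> decay_const * (\<bar>fourier_weight (fst k)\<bar> * \<bar>fourier_weight (snd k)\<bar>)"
  by (rule trig_coef_eq_coef[OF assms, of x]) (use abs_coef_le in simp)

lemma summable_on_trig_coef:
  assumes "u \<in> {sin, cos}" "v \<in> {sin, cos}"
  shows "trig_coef u v x summable_on UNIV"
proof -
  obtain \<alpha> \<beta> where "\<And>k. trig_coef u v x k = coef 0 0 k (\<alpha> k) (\<beta> k)"
    using trig_coef_eq_coef[OF assms] by blast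
  then have "trig_coef u v x = (\<lambda>k. coef 0 0 k (\<alpha> k) (\<beta> k))" by auto
  then show ?thesis using summable_on_coef by simp
qed

lemma integrable_trig_coef:
  assumes "u \<in> {sin, cos}" "v \<in> {sin, cos}"
  shows "integrable lborel (\<lambda>s. \<phi> s * u (2 * pi * real_of_int (fst k) * (fst s - fst x))
     * v (2 * pi * real_of_int (snd k) * (snd s - snd x)))"
proof -
  have "continuous_on UNIV u" "continuous_on UNIV v"
    using assms by (auto intro: continuous_intros)
  then have "continuous_on UNIV (\<lambda>s::real \<times> real. u (2 * pi * real_of_int (fst k) * (fst s - fst x)))"
    "continuous_on UNIV (\<lambda>s::real \<times> real. v (2 * pi * real_of_int (snd k) * (snd s - snd x)))"
    by (auto intro!: continuous_intros elim!: continuous_on_compose2)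
  then show ?thesis
    using compact_square supp_square
    by (intro integrable_continuous_compact_support[where K = "square R"] continuous_on_mult cont) auto
qed

theorem poisson_summation_2d:
  "(\<Sum>\<^sub>\<infinity>k. trig_coef cos cos x k) = (\<Sum>\<^sub>\<infinity>k. \<phi> (x + int_pair k))"
proof -
  obtain R' where "bump (\<lambda>m n s. D m n (x + s)) R'" by (rule bump_translate)
  then interpret T: bump "\<lambda>m n s. D m n (x + s)" R' .
  have "trig_coef cos cos x k = T.coef 0 0 k 0 0" for k
    unfolding trig_coef_def T.coef_def
    by (subst integral_lborel_translate[of _ x, symmetric]) simp
  then show ?thesis
    using T.poisson_summation_2d_at_0 T.infsum_int_pair by simp
qed

lemma infsum_odd:
  fixes f :: "'k \<Rightarrow> real"
  assumes "bij \<sigma>" "\<And>k. f (\<sigma> k) = - f k"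
  shows "infsum f UNIV = 0"
proof -
  have "infsum f UNIV = (\<Sum>\<^sub>\<infinity>k. f (\<sigma> k))"
    using infsum_reindex_bij_betw[OF assms(1), of f] by simp
  also have "\<dots> = - infsum f UNIV"
    by (simp add: assms(2) infsum_uminus)
  finally show ?thesis by simp
qed

lemma trig_coef_neg1:
  "trig_coef sin v x (- fst k, snd k) = - trig_coef sin v x k"
  by (simp add: trig_coef_def flip: integral_minus)

lemma trig_coef_neg2:
  "trig_coef u sin x (fst k, - snd k) = - trig_coef u sin x k"
  by (simp add: trig_coef_def flip: integral_minus)

text \<open>Reflecting the index in the variable that carries the sine permutes the pairs and flips
  the sign of every coefficient.\<close>

lemma infsum_trig_coef_sin:
  "(\<Sum>\<^sub>\<infinity>k. trig_coef sin v x k) = 0" "(\<Sum>\<^sub>\<infinity>k. trig_coef u sin x k) = 0"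
proof -
  have "bij (\<lambda>k::int \<times> int. (- fst k, snd k))" "bij (\<lambda>k::int \<times> int. (fst k, - snd k))"
    by (rule o_bij[where g = "\<lambda>k. (- fst k, snd k)"] o_bij[where g = "\<lambda>k. (fst k, - snd k)"]; auto)+
  from this[THEN infsum_odd] show "(\<Sum>\<^sub>\<infinity>k. trig_coef sin v x k) = 0" "(\<Sum>\<^sub>\<infinity>k. trig_coef u sin x k) = 0"
    by (simp_all only: trig_coef_neg1 trig_coef_neg2)
qed

end

section \<open>Two-sided quaternionic Fourier coefficients\<close>

lemma exp_scaleR_unit:
  assumes "\<nu> * \<nu> = (-1 :: quat)"
  shows "exp (a *\<^sub>R \<nu>) = cos a *\<^sub>R 1 + sin a *\<^sub>R \<nu>"
proof -
  have "exp (a *\<^sub>R \<nu>) = exp (slice \<nu> (\<i> * of_real a))"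
    by (simp add: slice_def)
  also have "\<dots> = slice \<nu> (cis a)"
    by (simp add: slice_exp[OF assms] cis_conv_exp)
  finally show ?thesis
    by (simp add: slice_def scaleR_conv_of_real)
qed

lemma exp_qi: "exp (a *\<^sub>R qi) = cos a *\<^sub>R 1 + sin a *\<^sub>R qi"
  and exp_qj: "exp (a *\<^sub>R qj) = cos a *\<^sub>R 1 + sin a *\<^sub>R qj"
  by (rule exp_scaleR_unit; simp add: quat_units_mult)+

lemma norm_quat_units [simp]: "norm qi = 1" "norm qj = 1"
  by (simp_all add: norm_quat_def)

lemma norm_exp_qi [simp]: "norm (exp (a *\<^sub>R qi)) = 1"
  and norm_exp_qj [simp]: "norm (exp (a *\<^sub>R qj)) = 1"
  by (simp_all add: exp_qi exp_qj norm_quat_def)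

lemma exp_scaleR_add: "exp (a *\<^sub>R \<nu>) * exp (b *\<^sub>R \<nu>) = exp ((a + b) *\<^sub>R (\<nu> :: quat))"
  by (simp add: scaleR_add_left exp_add_commuting)

definition twist :: "int \<times> int \<Rightarrow> real \<times> real \<Rightarrow> quat \<Rightarrow> quat" where
  "twist k y q = exp ((2 * pi * real_of_int (fst k) * fst y) *\<^sub>R qi) * q
     * exp ((2 * pi * real_of_int (snd k) * snd y) *\<^sub>R qj)"

lemma norm_twist [simp]: "norm (twist k y q) = norm q"
  by (simp add: twist_def norm_mult)

text \<open>On each side of \<open>q\<close> only exponentials of a single unit meet, so they
  commute and \<open>twist k\<close> is an action of the additive group of the plane. By
  \<open>norm_twist\<close> it is isometric, which keeps the estimates independent of
  \<open>k\<close>.\<close>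

lemma twist_twist: "twist k y (twist k z q) = twist k (y + z) q"
proof -
  have "twist k y (twist k z q)
     = (exp ((2 * pi * real_of_int (fst k) * fst y) *\<^sub>R qi) * exp ((2 * pi * real_of_int (fst k) * fst z) *\<^sub>R qi)) * q
     * (exp ((2 * pi * real_of_int (snd k) * snd z) *\<^sub>R qj) * exp ((2 * pi * real_of_int (snd k) * snd y) *\<^sub>R qj))"
    by (simp add: twist_def mult.assoc)
  then show ?thesis
    unfolding exp_scaleR_add by (simp add: twist_def algebra_simps)
qed

lemma bounded_linear_twist: "bounded_linear (twist k y)"
  unfolding twist_def
  by (intro bounded_linear_compose[OF bounded_linear_mult_left] bounded_linear_mult_right)

lemma twist_expand:
  "twist k y q =
     (cos (2 * pi * real_of_int (fst k) * fst y) * cos (2 * pi * real_of_int (snd k) * snd y)) *\<^sub>R q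
   + (sin (2 * pi * real_of_int (fst k) * fst y) * cos (2 * pi * real_of_int (snd k) * snd y)) *\<^sub>R (qi * q)
   + (cos (2 * pi * real_of_int (fst k) * fst y) * sin (2 * pi * real_of_int (snd k) * snd y)) *\<^sub>R (q * qj)
   + (sin (2 * pi * real_of_int (fst k) * fst y) * sin (2 * pi * real_of_int (snd k) * snd y)) *\<^sub>R (qi * q * qj)"
  by (simp add: twist_def exp_qi exp_qj algebra_simps)

lemma measurable_twist [measurable (raw)]:
  assumes [measurable]: "f \<in> borel_measurable M" "h \<in> borel_measurable M"
  shows "(\<lambda>x. twist k (f x) (h x)) \<in> borel_measurable M"
proof -
  have [measurable]: "(\<lambda>x. fst (f x)) \<in> borel_measurable M" "(\<lambda>x. snd (f x)) \<in> borel_measurable M"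
    by (rule measurable_compose[OF assms(1)], rule borel_measurable_continuous_onI, intro continuous_intros)+
  show ?thesis
    unfolding twist_expand by measurable
qed

definition fourier_coef :: "(real \<times> real \<Rightarrow> quat) \<Rightarrow> int \<times> int \<Rightarrow> quat" where
  "fourier_coef h k = (\<integral>x. twist k (- x) (h x) \<partial>lborel)"

lemma integrable_twist:
  assumes "integrable lborel h" and [measurable]: "f \<in> borel_measurable borel"
  shows "integrable lborel (\<lambda>x. twist k (f x) (h x))"
proof (rule Bochner_Integration.integrable_bound[OF assms(1)])
  have [measurable]: "h \<in> borel_measurable borel" using assms(1) by auto
  show "(\<lambda>x. twist k (f x) (h x)) \<in> borel_measurable lborel" by measurable
qed auto

section \<open>The two-sided Fourier series tested against a smooth weight\<close>

context bump
begin

lemma measurable_phi [measurable]: "\<phi> \<in> borel_measurable borel"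
  by (intro borel_measurable_continuous_onI cont) auto

text \<open>The kernel that appears when the integral over \<open>s\<close> is taken before the one
  in \<open>fourier_coef\<close>. Decay in \<open>k\<close> then comes from \<phi>, whereas the
  coefficients of an integrable \<open>h\<close> need not be summable.\<close>

definition smoothed_twist :: "real \<times> real \<Rightarrow> quat \<Rightarrow> int \<times> int \<Rightarrow> quat" where
  "smoothed_twist x q k = (\<integral>s. \<phi> s *\<^sub>R twist k (s - x) q \<partial>lborel)"

lemma smoothed_twist_expand:
  "smoothed_twist x q k = trig_coef cos cos x k *\<^sub>R q + trig_coef sin cos x k *\<^sub>R (qi * q)
     + trig_coef cos sin x k *\<^sub>R (q * qj) + trig_coef sin sin x k *\<^sub>R (qi * q * qj)"
proof -
  have "smoothed_twist x q k = (\<integral>s.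
       (\<phi> s * cos (2 * pi * real_of_int (fst k) * (fst s - fst x)) * cos (2 * pi * real_of_int (snd k) * (snd s - snd x))) *\<^sub>R q
     + (\<phi> s * sin (2 * pi * real_of_int (fst k) * (fst s - fst x)) * cos (2 * pi * real_of_int (snd k) * (snd s - snd x))) *\<^sub>R (qi * q)
     + (\<phi> s * cos (2 * pi * real_of_int (fst k) * (fst s - fst x)) * sin (2 * pi * real_of_int (snd k) * (snd s - snd x))) *\<^sub>R (q * qj)
     + (\<phi> s * sin (2 * pi * real_of_int (fst k) * (fst s - fst x)) * sin (2 * pi * real_of_int (snd k) * (snd s - snd x))) *\<^sub>R (qi * q * qj)
     \<partial>lborel)"
    unfolding smoothed_twist_def twist_expand by (simp add: scaleR_add_right mult.assoc)
  also have "\<dots> = trig_coef cos cos x k *\<^sub>R q + trig_coef sin cos x k *\<^sub>R (qi * q)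
     + trig_coef cos sin x k *\<^sub>R (q * qj) + trig_coef sin sin x k *\<^sub>R (qi * q * qj)"
    unfolding trig_coef_def
    by (subst Bochner_Integration.integral_add integral_scaleR_left,
        (intro Bochner_Integration.integrable_add integrable_scaleR_left integrable_trig_coef; simp)+)+ simp
  finally show ?thesis .
qed

text \<open>The factor 4 counts the components of \<open>smoothed_twist\<close>, each bounded by one
  share.\<close>

definition decay :: "int \<times> int \<Rightarrow> real" where
  "decay k = 4 * (decay_const * (\<bar>fourier_weight (fst k)\<bar> * \<bar>fourier_weight (snd k)\<bar>))"

lemma summable_on_decay: "decay summable_on UNIV"
  unfolding decay_def[abs_def] by (intro summable_on_cmult_right summable_on_fourier_weight_prod)

lemma norm_smoothed_twist_le: "norm (smoothed_twist x q k) \<le> decay k * norm q"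
proof -
  have *: "norm (trig_coef u v x k *\<^sub>R p) \<le> decay k / 4 * norm q"
    if "u \<in> {sin, cos}" "v \<in> {sin, cos}" "norm p = norm q" for u v p
    using abs_trig_coef_le[OF that(1,2), of x k] that(3) by (simp add: decay_def mult_right_mono)
  have "norm (smoothed_twist x q k) \<le> decay k / 4 * norm q + decay k / 4 * norm q + decay k / 4 * norm q + decay k / 4 * norm q"
    unfolding smoothed_twist_expand by (intro norm_triangle_mono *) (simp_all add: norm_mult)
  then show ?thesis by (simp add: mult.commute)
qed

text \<open>The three components with a sine vanish, so \<open>q\<close> comes out multiplied by a
  real number, with no trace left of the two-sided twist.\<close>

lemma infsum_smoothed_twist: "(\<Sum>\<^sub>\<infinity>k. smoothed_twist x q k) = (\<Sum>\<^sub>\<infinity>k. \<phi> (x + int_pair k)) *\<^sub>R q"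
proof -
  have *: "((\<lambda>k. trig_coef u v x k *\<^sub>R p) has_sum (\<Sum>\<^sub>\<infinity>k. trig_coef u v x k) *\<^sub>R p) UNIV"
    if "u \<in> {sin, cos}" "v \<in> {sin, cos}" for u v and p :: quat
    using has_sum_bounded_linear[OF bounded_linear_scaleR_left[of p] has_sum_infsum[OF summable_on_trig_coef[OF that, of x]]]
    by simp
  have "((\<lambda>k. smoothed_twist x q k) has_sum
      ((\<Sum>\<^sub>\<infinity>k. trig_coef cos cos x k) *\<^sub>R q + (\<Sum>\<^sub>\<infinity>k. trig_coef sin cos x k) *\<^sub>R (qi * q)
     + (\<Sum>\<^sub>\<infinity>k. trig_coef cos sin x k) *\<^sub>R (q * qj) + (\<Sum>\<^sub>\<infinity>k. trig_coef sin sin x k) *\<^sub>R (qi * q * qj))) UNIV"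
    unfolding smoothed_twist_expand by (intro has_sum_add *) auto
  then show ?thesis
    by (intro infsumI) (simp add: infsum_trig_coef_sin poisson_summation_2d)
qed

lemma measurable_smoothed_twist [measurable]:
  assumes [measurable]: "h \<in> borel_measurable borel"
  shows "(\<lambda>x. smoothed_twist x (h x) k) \<in> borel_measurable borel"
proof -
  have "(\<lambda>x. \<integral>s. \<phi> s *\<^sub>R twist k (s - x) (h x) \<partial>lborel) \<in> borel_measurable lborel"
    by (rule lborel.borel_measurable_lebesgue_integral) measurable
  then show ?thesis by (simp add: smoothed_twist_def)
qed

context
  fixes h :: "real \<times> real \<Rightarrow> quat"
  assumes h: "integrable lborel h"
begin

private lemma measurable_h: "h \<in> borel_measurable borel"
  using h by auto

private lemma integrable_smoothed_twist: "integrable lborel (\<lambda>x. smoothed_twist x (h x) k)"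
  by (rule Bochner_Integration.integrable_bound[OF integrable_mult_right[of "decay k", OF integrable_norm[OF h]]])
    (use measurable_h in \<open>auto intro!: AE_I2 order.trans[OF norm_smoothed_twist_le]\<close>)

private lemma summable_on_norm_smoothed_twist: "(\<lambda>k. \<integral>x. norm (smoothed_twist x (h x) k) \<partial>lborel) summable_on UNIV"
proof (rule summable_on_comparison_test)
  show "(\<lambda>k. decay k * (\<integral>x. norm (h x) \<partial>lborel)) summable_on UNIV"
    by (intro summable_on_cmult_left summable_on_decay)
  show "(\<integral>x. norm (smoothed_twist x (h x) k) \<partial>lborel) \<le> decay k * (\<integral>x. norm (h x) \<partial>lborel)" for k
    unfolding integral_mult_right_zero[symmetric]
    by (intro integral_mono integrable_norm integrable_smoothed_twist integrable_mult_right h norm_smoothed_twist_le)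
qed auto

text \<open>Fubini applies because \<open>twist\<close> is isometric: the norm of the integrand is
  |\<phi>(s)| times \<open>norm (h x)\<close>. The integral over \<open>x\<close> returns the
  Fourier coefficient once \<open>twist_twist\<close> has separated \<open>s\<close>.\<close>

lemma integral_phi_twist_fourier_coef:
  "(\<integral>s. \<phi> s *\<^sub>R twist k s (fourier_coef h k) \<partial>lborel) = (\<integral>x. smoothed_twist x (h x) k \<partial>lborel)"
proof -
  note [measurable] = measurable_h
  define F where "F s x = \<phi> s *\<^sub>R twist k (s - x) (h x)" for s x
  have [measurable]: "case_prod F \<in> borel_measurable (lborel \<Otimes>\<^sub>M lborel)"
    unfolding F_def[abs_def] by measurable
  have Fint: "integrable lborel (F s)" for s
    unfolding F_def by (intro integrable_scaleR_right integrable_twist h) measurable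
  have "integrable (lborel \<Otimes>\<^sub>M lborel) (case_prod F)"
  proof (rule lborel_pair.Fubini_integrable)
    have "integrable lborel (\<lambda>s. \<bar>\<phi> s\<bar> * (\<integral>x. norm (h x) \<partial>lborel))"
      using integrable_D(2)[of 0 0] by (intro integrable_mult_left integrable_abs) auto
    then show "integrable lborel (\<lambda>s. \<integral>x. norm (case_prod F (s, x)) \<partial>lborel)"
      by (simp add: F_def)
  qed (use Fint in auto)
  from lborel_pair.Fubini_integral[OF this]
  have "(\<integral>x. (\<integral>s. F s x \<partial>lborel) \<partial>lborel) = (\<integral>s. (\<integral>x. F s x \<partial>lborel) \<partial>lborel)" .
  moreover have "(\<integral>x. F s x \<partial>lborel) = \<phi> s *\<^sub>R twist k s (fourier_coef h k)" for s
  proof -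
    have "(\<integral>x. twist k (s - x) (h x) \<partial>lborel) = (\<integral>x. twist k s (twist k (- x) (h x)) \<partial>lborel)"
      by (simp add: twist_twist)
    also have "\<dots> = twist k s (fourier_coef h k)"
      unfolding fourier_coef_def
      by (intro integral_bounded_linear bounded_linear_twist integrable_twist h) measurable
    finally show ?thesis by (simp add: F_def)
  qed
  ultimately have "(\<integral>x. (\<integral>s. F s x \<partial>lborel) \<partial>lborel)
      = (\<integral>s. \<phi> s *\<^sub>R twist k s (fourier_coef h k) \<partial>lborel)"
    by simp
  then show ?thesis by (simp add: F_def smoothed_twist_def)
qed

lemma summable_on_phi_twist_fourier_coef:
  "(\<lambda>k. \<integral>s. \<phi> s *\<^sub>R twist k s (fourier_coef h k) \<partial>lborel) summable_on UNIV"
  unfolding integral_phi_twist_fourier_coef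
  by (rule summable_on_integral[OF integrable_smoothed_twist summable_on_norm_smoothed_twist])

text \<open>The bound \<open>decay k * norm (h x)\<close> lets the sum over \<open>k\<close> pass
  under the integral of \<open>h\<close>; Poisson summation is then used for each \<open>x\<close>
  separately.\<close>

lemma infsum_phi_twist_fourier_coef:
  "(\<Sum>\<^sub>\<infinity>k. \<integral>s. \<phi> s *\<^sub>R twist k s (fourier_coef h k) \<partial>lborel)
     = (\<integral>x. (\<Sum>\<^sub>\<infinity>k. \<phi> (x + int_pair k)) *\<^sub>R h x \<partial>lborel)"
  unfolding integral_phi_twist_fourier_coef infsum_smoothed_twist[symmetric]
  by (rule integral_infsum[OF integrable_smoothed_twist summable_on_norm_smoothed_twist, symmetric])

end

end

section \<open>Periodization and almost everywhere equality\<close>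

definition periodic_sum :: "(real \<times> real \<Rightarrow> 'b::euclidean_space) \<Rightarrow> real \<times> real \<Rightarrow> 'b" where
  "periodic_sum h s = (\<Sum>\<^sub>\<infinity>k. h (s + int_pair k))"

text \<open>Serves to count the integer translates of a support of radius \<open>R\<close> that meet
  a given point.\<close>

lemma card_int_ball:
  fixes x :: real and R :: nat
  shows "finite {k. \<bar>x - real_of_int k\<bar> \<le> real R}" "card {k. \<bar>x - real_of_int k\<bar> \<le> real R} \<le> 2 * R + 1"
proof -
  have eq: "{k. \<bar>x - real_of_int k\<bar> \<le> real R} = {\<lceil>x - real R\<rceil>..\<lfloor>x + real R\<rfloor>}"
    unfolding set_eq_iff mem_Collect_eq atLeastAtMost_iff ceiling_le_iff le_floor_iff by linarith
  show "finite {k. \<bar>x - real_of_int k\<bar> \<le> real R}" unfolding eq by simp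
  have "\<lfloor>x + real R\<rfloor> - \<lceil>x - real R\<rceil> + 1 \<le> 2 * int R + 1" by linarith
  then show "card {k. \<bar>x - real_of_int k\<bar> \<le> real R} \<le> 2 * R + 1" unfolding eq by simp
qed

section \<open>Periodization tested against a bounded weight of bounded support\<close>

context
  fixes h :: "real \<times> real \<Rightarrow> 'b::euclidean_space" and \<phi> :: "real \<times> real \<Rightarrow> real" and B :: real and R :: nat
  assumes h: "integrable lborel h"
    and phi_measurable: "\<phi> \<in> borel_measurable borel"
    and bnd: "\<And>s. \<bar>\<phi> s\<bar> \<le> B"
    and supp: "\<And>s. \<bar>fst s\<bar> > real R \<or> \<bar>snd s\<bar> > real R \<Longrightarrow> \<phi> s = 0"
begin

private lemma measurable_h: "h \<in> borel_measurable borel"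
  using h by auto

text \<open>At most (2R + 1)^2 translates of the support contain \<open>s\<close>, whatever the
  finite set \<open>F\<close>. This overlap count takes the place of smoothness, so indicators of
  squares qualify as weights.\<close>

private lemma sum_translates_le:
  assumes "finite F"
  shows "(\<Sum>k\<in>F. \<bar>\<phi> (s - int_pair k)\<bar>) \<le> B * (2 * real R + 1)\<^sup>2"
proof -
  define S where "S = {k. \<bar>fst s - real_of_int k\<bar> \<le> real R} \<times> {k. \<bar>snd s - real_of_int k\<bar> \<le> real R}"
  have fin: "finite S"
    unfolding S_def by (intro finite_cartesian_product card_int_ball)
  have B: "B \<ge> 0" using bnd[of 0] by linarith
  have "(\<Sum>k\<in>F. \<bar>\<phi> (s - int_pair k)\<bar>) \<le> (\<Sum>k\<in>F \<union> S. \<bar>\<phi> (s - int_pair k)\<bar>)"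
    using assms fin by (intro sum_mono2) auto
  also have "\<dots> = (\<Sum>k\<in>S. \<bar>\<phi> (s - int_pair k)\<bar>)"
  proof (rule sum.mono_neutral_right)
    show "\<forall>k\<in>F \<union> S - S. \<bar>\<phi> (s - int_pair k)\<bar> = 0"
    proof
      fix k assume "k \<in> F \<union> S - S"
      then have "\<bar>fst (s - int_pair k)\<bar> > real R \<or> \<bar>snd (s - int_pair k)\<bar> > real R"
        by (cases k) (auto simp: S_def int_pair_def not_le)
      then show "\<bar>\<phi> (s - int_pair k)\<bar> = 0" by (simp add: supp)
    qed
  qed (use assms fin in auto)
  also have "\<dots> \<le> real (card S) * B"
    using bnd by (intro sum_bounded_above)
  also have "real (card S) * B \<le> real ((2 * R + 1) * (2 * R + 1)) * B"
    unfolding S_def card_cartesian_product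
    by (intro mult_right_mono of_nat_mono mult_mono card_int_ball B) auto
  also have "\<dots> = B * (2 * real R + 1)\<^sup>2"
    by (simp add: power2_eq_square algebra_simps)
  finally show ?thesis .
qed

private lemma integrable_weighted: "integrable lborel (\<lambda>s. \<phi> (f s) *\<^sub>R h s)"
  if [measurable]: "f \<in> borel_measurable borel" for f
proof (rule Bochner_Integration.integrable_bound[OF integrable_mult_right[of B, OF integrable_norm[OF h]]])
  have "B \<ge> 0" using bnd[of 0] by linarith
  then show "AE s in lborel. norm (\<phi> (f s) *\<^sub>R h s) \<le> norm (B * norm (h s))"
    using bnd by (intro AE_I2) (simp add: abs_mult mult_right_mono)
qed (use measurable_h[measurable] phi_measurable[measurable] in measurable)

private lemma integrable_translate: "integrable lborel (\<lambda>s. \<phi> s *\<^sub>R h (s + int_pair k))"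
proof -
  have "integrable lborel (\<lambda>s. \<phi> (s - int_pair k) *\<^sub>R h s)"
    by (rule integrable_weighted) measurable
  from integrable_lborel_translate[OF this, of "int_pair k"] show ?thesis
    by (simp add: add.commute)
qed

private lemma integral_translate:
  fixes F :: "'b \<Rightarrow> 'c::{banach, second_countable_topology}"
  shows "(\<integral>s. F (\<phi> s *\<^sub>R h (s + int_pair k)) \<partial>lborel) = (\<integral>s. F (\<phi> (s - int_pair k) *\<^sub>R h s) \<partial>lborel)"
  by (subst integral_lborel_translate[of _ "int_pair k", symmetric]) (simp add: add.commute)

text \<open>With the translation on \<phi>, the overlap count bounds every finite partial sum by the
  same multiple of the integral of \<open>norm (h s)\<close>.\<close>

private lemma summable_weighted:
  "(\<lambda>k. \<integral>s. norm (\<phi> (s - int_pair k) *\<^sub>R h s) \<partial>lborel) summable_on UNIV"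
proof (rule nonneg_bounded_partial_sums_imp_summable_on)
  show "\<forall>\<^sub>F F in finite_subsets_at_top UNIV. (\<Sum>k\<in>F. \<integral>s. norm (\<phi> (s - int_pair k) *\<^sub>R h s) \<partial>lborel)
      \<le> B * (2 * real R + 1)\<^sup>2 * (\<integral>s. norm (h s) \<partial>lborel)"
  proof (rule eventually_finite_subsets_at_top_weakI)
    fix F :: "(int \<times> int) set"
    assume F: "finite F"
    have int: "integrable lborel (\<lambda>s. norm (\<phi> (s - int_pair k) *\<^sub>R h s))" for k
      by (intro integrable_norm integrable_weighted) measurable
    have "(\<Sum>k\<in>F. \<integral>s. norm (\<phi> (s - int_pair k) *\<^sub>R h s) \<partial>lborel)
       = (\<integral>s. (\<Sum>k\<in>F. norm (\<phi> (s - int_pair k) *\<^sub>R h s)) \<partial>lborel)"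
      using int by (intro Bochner_Integration.integral_sum[symmetric])
    also have "\<dots> \<le> (\<integral>s. B * (2 * real R + 1)\<^sup>2 * norm (h s) \<partial>lborel)"
    proof (rule integral_mono)
      show "(\<Sum>k\<in>F. norm (\<phi> (s - int_pair k) *\<^sub>R h s)) \<le> B * (2 * real R + 1)\<^sup>2 * norm (h s)" for s
        using mult_right_mono[OF sum_translates_le[OF F, of s], of "norm (h s)"]
        by (simp add: sum_distrib_right)
    qed (use int in \<open>auto intro!: integrable_mult_right integrable_norm h\<close>)
    finally show "(\<Sum>k\<in>F. \<integral>s. norm (\<phi> (s - int_pair k) *\<^sub>R h s) \<partial>lborel)
      \<le> B * (2 * real R + 1)\<^sup>2 * (\<integral>s. norm (h s) \<partial>lborel)" by simp
  qed
qed auto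

private lemma summable_translates:
  "(\<lambda>k. \<integral>s. norm (\<phi> s *\<^sub>R h (s + int_pair k)) \<partial>lborel) summable_on UNIV"
  using summable_weighted unfolding integral_translate .

lemma AE_summable_on_phi_translates:
  "AE s in lborel. (\<lambda>k. \<phi> s *\<^sub>R h (s + int_pair k)) summable_on UNIV"
  by (rule AE_summable_on_of_integrals[OF integrable_translate summable_translates])

lemma integrable_phi_periodic_sum: "integrable lborel (\<lambda>s. \<phi> s *\<^sub>R periodic_sum h s)"
  using integrable_infsum[OF integrable_translate summable_translates]
  by (simp add: periodic_sum_def infsum_scaleR_right)

text \<open>Periodization is transposed: a change of variable moves the translation from
  \<open>h\<close> to \<phi>, and the reflection of \<open>k\<close> turns differences into
  sums.\<close>

lemma integral_phi_periodic_sum: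
  "(\<integral>s. \<phi> s *\<^sub>R periodic_sum h s \<partial>lborel) = (\<integral>s. (\<Sum>\<^sub>\<infinity>k. \<phi> (s + int_pair k)) *\<^sub>R h s \<partial>lborel)"
proof -
  have "(\<integral>s. \<phi> s *\<^sub>R periodic_sum h s \<partial>lborel) = (\<Sum>\<^sub>\<infinity>k. \<integral>s. \<phi> s *\<^sub>R h (s + int_pair k) \<partial>lborel)"
    using integral_infsum[OF integrable_translate summable_translates]
    by (simp add: periodic_sum_def infsum_scaleR_right)
  also have "\<dots> = (\<Sum>\<^sub>\<infinity>k. \<integral>s. \<phi> (s - int_pair k) *\<^sub>R h s \<partial>lborel)"
    using integral_translate[of "\<lambda>x. x"] by simp
  also have "\<dots> = (\<integral>s. (\<Sum>\<^sub>\<infinity>k. \<phi> (s - int_pair k) *\<^sub>R h s) \<partial>lborel)"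
    by (rule integral_infsum[symmetric, OF integrable_weighted summable_weighted]) measurable
  moreover have "(\<Sum>\<^sub>\<infinity>k. \<phi> (s - int_pair k) *\<^sub>R h s) = (\<Sum>\<^sub>\<infinity>k. \<phi> (s + int_pair k)) *\<^sub>R h s" for s
  proof -
    have "(\<Sum>\<^sub>\<infinity>k. \<phi> (s - int_pair k) *\<^sub>R h s) = (\<Sum>\<^sub>\<infinity>k. \<phi> (s + int_pair k) *\<^sub>R h s)"
      by (rule infsum_reindex_bij_witness[of _ uminus uminus]) (auto simp: int_pair_def minus_prod_def plus_prod_def)
    also have "\<dots> = (\<Sum>\<^sub>\<infinity>k. \<phi> (s + int_pair k)) *\<^sub>R h s"
    proof (rule infsum_scaleR_left, rule finite_nonzero_values_imp_summable_on)
      have "{k. \<phi> (s + int_pair k) \<noteq> 0}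
          \<subseteq> {k. \<bar>- fst s - real_of_int k\<bar> \<le> real R} \<times> {k. \<bar>- snd s - real_of_int k\<bar> \<le> real R}"
      proof
        fix k assume "k \<in> {k. \<phi> (s + int_pair k) \<noteq> 0}"
        with supp[of "s + int_pair k"] have "\<bar>fst (s + int_pair k)\<bar> \<le> real R \<and> \<bar>snd (s + int_pair k)\<bar> \<le> real R"
          by force
        then show "k \<in> {k. \<bar>- fst s - real_of_int k\<bar> \<le> real R} \<times> {k. \<bar>- snd s - real_of_int k\<bar> \<le> real R}"
          by (cases k) (auto simp: int_pair_def)
      qed
      then show "finite {k \<in> UNIV. \<phi> (s + int_pair k) \<noteq> 0}"
        by (simp add: finite_subset[OF _ finite_cartesian_product[OF card_int_ball(1) card_int_ball(1)]])
    qed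
    finally show ?thesis .
  qed
  ultimately show ?thesis by simp
qed

end

lemma eventually_mem_square: "\<forall>\<^sub>F R in sequentially. s \<in> square R"
proof -
  have "s \<in> square R" if "R \<ge> nat \<lceil>max \<bar>fst s\<bar> \<bar>snd s\<bar>\<rceil>" for R
    using that unfolding mem_square_iff by linarith
  then show ?thesis unfolding eventually_sequentially by blast
qed

lemma integrable_square_periodic_sum:
  assumes "integrable lborel h"
  shows "integrable lborel (\<lambda>s. indicator (square R) s *\<^sub>R periodic_sum h s)"
  by (rule integrable_phi_periodic_sum[OF assms, where B = 1 and R = R])
    (measurable, auto simp: mem_square_iff)

text \<open>With the indicator of a square as weight the claim holds on that square; countably many
  squares exhaust the plane.\<close>

lemma AE_summable_on_translates:
  fixes h :: "real \<times> real \<Rightarrow> 'b::euclidean_space"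
  assumes "integrable lborel h"
  shows "AE s in lborel. (\<lambda>k. h (s + int_pair k)) summable_on UNIV"
proof -
  have "AE s in lborel. (\<lambda>k. indicator (square R) s *\<^sub>R h (s + int_pair k)) summable_on UNIV" for R
    by (rule AE_summable_on_phi_translates[OF assms, where B = 1 and R = R])
      (measurable, auto simp: mem_square_iff)
  then have "AE s in lborel. \<forall>R. (\<lambda>k. indicator (square R) s *\<^sub>R h (s + int_pair k)) summable_on UNIV"
    by (simp add: AE_all_countable)
  then show ?thesis
  proof eventually_elim
    case (elim s)
    obtain R where "s \<in> square R"
      using eventually_happens[OF eventually_mem_square[of s]] by auto
    then show ?case using elim[rule_format, of R] by simp
  qed
qed

section \<open>Twice differentiable cutoffs and functions with vanishing box integrals\<close>

lemma has_real_derivative_max_0_power: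
  "((\<lambda>x. max 0 x ^ Suc (Suc n)) has_real_derivative real (Suc (Suc n)) * max 0 x ^ Suc n) (at x)"
proof -
  consider "x > 0" | "x < 0" | "x = 0" by linarith
  then show ?thesis
  proof cases
    case 1
    have "((\<lambda>x. x ^ Suc (Suc n)) has_real_derivative real (Suc (Suc n)) * max 0 x ^ Suc n) (at x)"
      using 1 DERIV_pow[of "Suc (Suc n)" x] by simp
    then show ?thesis
      by (rule has_field_derivative_transform_within_open[of _ _ _ "{0<..}"]) (use 1 in auto)
  next
    case 2
    have "((\<lambda>x. 0) has_real_derivative real (Suc (Suc n)) * max 0 x ^ Suc n) (at x)"
      using 2 by simp
    then show ?thesis
      by (rule has_field_derivative_transform_within_open[of _ _ _ "{..<0}"]) (use 2 in auto)
  next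
    case 3
    \<comment> \<open>At 0 the difference quotient is bounded by |h|^(n + 1); an exponent of at
      least 2 is what makes this tend to 0.\<close>
    have "(\<lambda>h::real. (max 0 h ^ Suc (Suc n)) / h) \<midarrow>0\<rightarrow> 0"
    proof (rule tendsto_0_le)
      have "((\<lambda>h::real. h ^ Suc n) \<longlongrightarrow> 0 ^ Suc n) (at 0)"
        by (intro tendsto_intros)
      then show "((\<lambda>h::real. h ^ Suc n) \<longlongrightarrow> 0) (at 0)" by simp
      have "norm (max 0 h ^ Suc (Suc n) / h) \<le> norm (h ^ Suc n) * 1" for h :: real
        by (cases "h > 0") (auto simp: max_def power_Suc)
      then show "\<forall>\<^sub>F h in at 0. norm (max 0 h ^ Suc (Suc n) / h) \<le> norm ((h::real) ^ Suc n) * 1"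
        by (intro always_eventually allI)
    qed
    with 3 show ?thesis by (simp add: DERIV_def)
  qed
qed

text \<open>For \<open>a < b\<close> the quadratic is positive exactly on the open interval. The
  cube of its positive part is twice continuously differentiable, and the quotient stays in [0, 1]
  and tends to the indicator of the interval as \<open>N\<close> grows.\<close>

definition cutoff :: "real \<Rightarrow> real \<Rightarrow> nat \<Rightarrow> real \<Rightarrow> real" where
  "cutoff a b N x = (let p = max 0 ((x - a) * (b - x)) ^ 3 in real N * p / (1 + real N * p))"

lemma cutoff_bounds: "0 \<le> cutoff a b N x" "cutoff a b N x \<le> 1"
  by (auto simp: cutoff_def Let_def divide_le_eq_1 add_pos_nonneg)

lemma max_0_quadratic_eq_0:
  fixes a b x :: real
  assumes "a < b" "x \<notin> {a<..<b}"
  shows "max 0 ((x - a) * (b - x)) = 0"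
proof -
  have "x \<le> a \<or> b \<le> x" using assms by auto
  then have "(x - a) * (b - x) \<le> 0"
    using assms by (auto intro: mult_nonpos_nonneg mult_nonneg_nonpos)
  then show ?thesis by simp
qed

lemma cutoff_eq_0: "a < b \<Longrightarrow> x \<notin> {a<..<b} \<Longrightarrow> cutoff a b N x = 0"
  unfolding cutoff_def max_0_quadratic_eq_0 by simp

lemma cutoff_tendsto:
  assumes "a < b"
  shows "(\<lambda>N. cutoff a b N x) \<longlonglongrightarrow> indicator {a<..<b} x"
proof (cases "x \<in> {a<..<b}")
  case True
  define p where "p = max 0 ((x - a) * (b - x)) ^ 3"
  have p: "p > 0" using True by (auto simp: p_def max_def)
  have "(\<lambda>N. 1 - inverse (1 + real N * p)) \<longlonglongrightarrow> 1 - 0"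
    by (intro tendsto_intros tendsto_inverse_0_at_top filterlim_tendsto_add_at_top[OF tendsto_const]
        filterlim_at_top_mult_tendsto_pos[OF tendsto_const p] filterlim_real_sequentially)
  also have "(\<lambda>N. 1 - inverse (1 + real N * p)) = (\<lambda>N. cutoff a b N x)"
  proof
    fix N
    have "1 + real N * p > 0" using p by (simp add: add_pos_nonneg)
    then have "1 - inverse (1 + real N * p) = (1 + real N * p - 1) / (1 + real N * p)"
      unfolding diff_divide_distrib inverse_eq_divide by simp
    then show "1 - inverse (1 + real N * p) = cutoff a b N x"
      by (simp add: cutoff_def flip: p_def)
  qed
  finally show ?thesis using True by simp
next
  case False
  then show ?thesis using cutoff_eq_0[OF assms False] by simp
qed

lemma cutoff_derivatives:
  assumes "a < b"
  obtains U where "U 0 = cutoff a b N"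
    and "\<And>m x. m < 2 \<Longrightarrow> (U m has_real_derivative U (Suc m) x) (at x)"
    and "\<And>m. m \<le> 2 \<Longrightarrow> continuous_on UNIV (U m)"
    and "\<And>m x. m \<le> 2 \<Longrightarrow> x \<notin> {a<..<b} \<Longrightarrow> U m x = 0"
proof -
  define r where "r x = (x - a) * (b - x)" for x
  define r' where "r' x = a + b - 2 * x" for x
  define p where "p x = max 0 (r x) ^ 3" for x
  define p' where "p' x = 3 * max 0 (r x) ^ 2 * r' x" for x
  \<comment> \<open>The last term comes from the second derivative -2 of \<open>r\<close>.\<close>
  define p'' where "p'' x = 6 * max 0 (r x) * (r' x)\<^sup>2 - 6 * max 0 (r x) ^ 2" for x
  \<comment> \<open>With v = 1 + N p the cutoff is 1 - 1/v; \<open>U1\<close> and \<open>U2\<close>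
    are the first two derivatives of that expression.\<close>
  define U1 where "U1 x = real N * p' x / (1 + real N * p x)\<^sup>2" for x
  define U2 where "U2 x = real N * p'' x / (1 + real N * p x)\<^sup>2
      - 2 * (real N)\<^sup>2 * (p' x)\<^sup>2 / (1 + real N * p x) ^ 3" for x
  have pos: "1 + real N * p x > 0" for x by (simp add: p_def add_pos_nonneg)
  then have nz: "1 + real N * p x \<noteq> 0" for x by (simp add: less_imp_neq[symmetric])
  have r: "(r has_real_derivative r' x) (at x)" "(r' has_real_derivative - 2) (at x)" for x
    unfolding r_def[abs_def] r'_def[abs_def] by (auto intro!: derivative_eq_intros)
  have d1: "(p has_real_derivative p' x) (at x)" for x
    using DERIV_chain2[OF has_real_derivative_max_0_power[of 1] r(1), of x]
    by (simp add: p_def[abs_def] p'_def numeral_3_eq_3 numeral_2_eq_2)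
  have "((\<lambda>x. max 0 (r x) ^ 2) has_real_derivative 2 * max 0 (r x) * r' x) (at x)" for x
    using DERIV_chain2[OF has_real_derivative_max_0_power[of 0] r(1), of x]
    by (simp add: numeral_2_eq_2)
  then have "((\<lambda>x. 3 * max 0 (r x) ^ 2 * r' x) has_real_derivative
      (3 * (2 * max 0 (r x) * r' x)) * r' x + (- 2) * (3 * max 0 (r x) ^ 2)) (at x)" for x
    by (intro DERIV_mult DERIV_cmult r)
  then have d2: "(p' has_real_derivative p'' x) (at x)" for x
    by (simp add: p'_def[abs_def] p''_def power2_eq_square algebra_simps)
  have cont: "continuous_on UNIV p" "continuous_on UNIV p'" "continuous_on UNIV p''"
    unfolding p_def p'_def p''_def r_def r'_def by (intro continuous_intros)+
  have D0: "(cutoff a b N has_real_derivative U1 x) (at x)" for x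
  proof -
    have c: "cutoff a b N = (\<lambda>x. real N * p x / (1 + real N * p x))"
      by (auto simp: cutoff_def p_def r_def Let_def)
    have "((\<lambda>x. real N * p x / (1 + real N * p x)) has_real_derivative
        ((real N * p' x) * (1 + real N * p x) - (real N * p x) * (0 + real N * p' x))
          / ((1 + real N * p x) * (1 + real N * p x))) (at x)"
      by (intro DERIV_divide DERIV_cmult DERIV_add DERIV_const d1 nz)
    also have "((real N * p' x) * (1 + real N * p x) - (real N * p x) * (0 + real N * p' x))
          / ((1 + real N * p x) * (1 + real N * p x)) = U1 x"
      by (simp add: U1_def power2_eq_square algebra_simps)
    finally show ?thesis unfolding c .
  qed
  have D1: "(U1 has_real_derivative U2 x) (at x)" for x
  proof -
    have "((\<lambda>x. real N * p' x / (1 + real N * p x)\<^sup>2) has_real_derivative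
        ((real N * p'' x) * (1 + real N * p x)\<^sup>2
           - (real N * p' x) * (of_nat 2 * ((0 + real N * p' x) * (1 + real N * p x) ^ (2 - Suc 0))))
          / ((1 + real N * p x)\<^sup>2 * (1 + real N * p x)\<^sup>2)) (at x)"
      by (intro DERIV_divide DERIV_cmult DERIV_add DERIV_const d1 d2 DERIV_power power_not_zero nz)
    also have "((real N * p'' x) * (1 + real N * p x)\<^sup>2
           - (real N * p' x) * (of_nat 2 * ((0 + real N * p' x) * (1 + real N * p x) ^ (2 - Suc 0))))
          / ((1 + real N * p x)\<^sup>2 * (1 + real N * p x)\<^sup>2) = U2 x"
    proof -
      define e where "e = 1 + real N * p x"
      have "e \<noteq> 0" using nz by (simp add: e_def)
      then show ?thesis
        unfolding U2_def e_def[symmetric] by (simp add: field_simps power2_eq_square power3_eq_cube)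
    qed
    finally show ?thesis unfolding U1_def[abs_def] .
  qed
  define U where "U m = (if m = 0 then cutoff a b N else if m = 1 then U1 else U2)" for m :: nat
  show ?thesis
  proof (rule that)
    show "U 0 = cutoff a b N" by (simp add: U_def)
    show "(U m has_real_derivative U (Suc m) x) (at x)" if "m < 2" for m x
      using that D0 D1 by (cases m) (auto simp: U_def)
    have "continuous_on UNIV (cutoff a b N)" "continuous_on UNIV U1"
      using D0 D1 by (auto intro!: continuous_at_imp_continuous_on DERIV_isCont)
    moreover have "continuous_on UNIV U2"
      unfolding U2_def using nz by (intro continuous_intros cont) auto
    ultimately show "continuous_on UNIV (U m)" if "m \<le> 2" for m
      by (auto simp: U_def)
    show "U m x = 0" if "m \<le> 2" "x \<notin> {a<..<b}" for m x
    proof -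
      \<comment> \<open>This factor is contained in \<open>p'\<close> and in both terms of
        \<open>p''\<close>, so every order vanishes off the interval.\<close>
      have "max 0 (r x) = 0"
        unfolding r_def by (rule max_0_quadratic_eq_0[OF assms that(2)])
      then show ?thesis
        using cutoff_eq_0[OF assms that(2)]
        by (auto simp: U_def U1_def U2_def p'_def p''_def)
    qed
  qed
qed

lemma bump_product:
  fixes U V :: "nat \<Rightarrow> real \<Rightarrow> real"
  assumes "\<And>m x. m < 2 \<Longrightarrow> (U m has_real_derivative U (Suc m) x) (at x)"
    and "\<And>m. m \<le> 2 \<Longrightarrow> continuous_on UNIV (U m)"
    and "\<And>m x. m \<le> 2 \<Longrightarrow> \<bar>x\<bar> > real R \<Longrightarrow> U m x = 0"
    and "\<And>m x. m < 2 \<Longrightarrow> (V m has_real_derivative V (Suc m) x) (at x)"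
    and "\<And>m. m \<le> 2 \<Longrightarrow> continuous_on UNIV (V m)"
    and "\<And>m x. m \<le> 2 \<Longrightarrow> \<bar>x\<bar> > real R \<Longrightarrow> V m x = 0"
  shows "bump (\<lambda>m n s. U m (fst s) * V n (snd s)) R"
proof
  fix m n :: nat and x y :: real
  show "((\<lambda>x. U m (fst (x, y)) * V n (snd (x, y))) has_real_derivative U (Suc m) (fst (x, y)) * V n (snd (x, y))) (at x)"
    if "m < 2" "n \<le> 2"
    using DERIV_cmult_right[OF assms(1)[OF that(1)], where c = "V n y"] by simp
  show "((\<lambda>y. U m (fst (x, y)) * V n (snd (x, y))) has_real_derivative U m (fst (x, y)) * V (Suc n) (snd (x, y))) (at y)"
    if "m \<le> 2" "n < 2"
    using DERIV_cmult[OF assms(4)[OF that(2)], where c = "U m x"] by simp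
next
  fix m n :: nat
  assume mn: "m \<le> 2" "n \<le> 2"
  show "continuous_on UNIV (\<lambda>s. U m (fst s) * V n (snd s))"
    by (intro continuous_on_mult continuous_on_compose2[OF assms(2)[OF mn(1)]]
        continuous_on_compose2[OF assms(5)[OF mn(2)]]) (auto intro!: continuous_intros)
qed (use assms(3,6) in auto)

text \<open>Cutoffs recover integrals over boxes, boxes generate the Borel sets, and an integrable
  function with zero integral over every Borel set vanishes almost everywhere. Since
  \<open>u\<close> is only locally integrable, this is done on one bounded box at a time.\<close>

lemma AE_zero_of_bump_integrals:
  fixes u :: "real \<times> real \<Rightarrow> 'b::euclidean_space"
  assumes loc: "\<And>R. integrable lborel (\<lambda>s. indicator (square R) s *\<^sub>R u s)"
    and zero: "\<And>D R. bump D R \<Longrightarrow> (\<integral>s. D 0 0 s *\<^sub>R u s \<partial>lborel) = 0"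
  shows "AE s in lborel. u s = 0"
proof -
  have [measurable]: "(\<lambda>s. indicator (square R) s *\<^sub>R u s) \<in> borel_measurable borel" for R
    using loc[of R] by auto
  have [measurable]: "u \<in> borel_measurable borel"
  proof (rule borel_measurable_LIMSEQ_metric)
    show "(\<lambda>R. indicator (square R) s *\<^sub>R u s) \<longlonglongrightarrow> u s" for s
      by (rule tendsto_eventually, rule eventually_mono[OF eventually_mem_square[of s]]) simp
  qed measurable
  have box0: "(\<integral>s. indicator (box a b) s *\<^sub>R u s \<partial>lborel) = 0" for a b :: "real \<times> real"
  proof (cases "fst a < fst b \<and> snd a < snd b")
    case True
    define R where "R = nat \<lceil>\<bar>fst a\<bar> + \<bar>fst b\<bar> + \<bar>snd a\<bar> + \<bar>snd b\<bar>\<rceil>"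
    have R: "real R \<ge> \<bar>fst a\<bar> + \<bar>fst b\<bar> + \<bar>snd a\<bar> + \<bar>snd b\<bar>"
      unfolding R_def by linarith
    define \<phi> where "\<phi> N s = cutoff (fst a) (fst b) N (fst s) * cutoff (snd a) (snd b) N (snd s)" for N s
    have \<phi>0: "(\<integral>s. \<phi> N s *\<^sub>R u s \<partial>lborel) = 0" and [measurable]: "\<phi> N \<in> borel_measurable borel" for N
    proof -
      obtain U where U: "U 0 = cutoff (fst a) (fst b) N"
          "\<And>m x. m < 2 \<Longrightarrow> (U m has_real_derivative U (Suc m) x) (at x)"
          "\<And>m. m \<le> 2 \<Longrightarrow> continuous_on UNIV (U m)"
          "\<And>m x. m \<le> 2 \<Longrightarrow> x \<notin> {fst a<..<fst b} \<Longrightarrow> U m x = 0"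
        using cutoff_derivatives[of "fst a" "fst b" N] True by metis
      obtain V where V: "V 0 = cutoff (snd a) (snd b) N"
          "\<And>m x. m < 2 \<Longrightarrow> (V m has_real_derivative V (Suc m) x) (at x)"
          "\<And>m. m \<le> 2 \<Longrightarrow> continuous_on UNIV (V m)"
          "\<And>m x. m \<le> 2 \<Longrightarrow> x \<notin> {snd a<..<snd b} \<Longrightarrow> V m x = 0"
        using cutoff_derivatives[of "snd a" "snd b" N] True by metis
      have "x \<notin> {fst a<..<fst b}" "x \<notin> {snd a<..<snd b}" if "\<bar>x\<bar> > real R" for x
        using that R by auto
      then interpret bump "\<lambda>m n s. U m (fst s) * V n (snd s)" R
        by (intro bump_product U V) auto
      have "\<phi> N = (\<lambda>s. U 0 (fst s) * V 0 (snd s))"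
        by (simp add: \<phi>_def fun_eq_iff U V)
      with measurable_phi zero[OF bump_axioms] show "(\<integral>s. \<phi> N s *\<^sub>R u s \<partial>lborel) = 0"
        "\<phi> N \<in> borel_measurable borel" by auto
    qed
    \<comment> \<open>All cutoffs are dominated by the indicator of one square containing the box,
      on which \<open>u\<close> is integrable.\<close>
    have "(\<lambda>N. \<integral>s. \<phi> N s *\<^sub>R u s \<partial>lborel) \<longlonglongrightarrow> (\<integral>s. indicator (box a b) s *\<^sub>R u s \<partial>lborel)"
    proof (rule integral_dominated_convergence)
      show "integrable lborel (\<lambda>s. norm (indicator (square R) s *\<^sub>R u s))"
        by (intro integrable_norm loc)
      have "(\<lambda>N. \<phi> N s) \<longlonglongrightarrow> indicator (box a b) s" for s
      proof -
        have "(\<lambda>N. \<phi> N s) \<longlonglongrightarrow> indicator {fst a<..<fst b} (fst s) * indicator {snd a<..<snd b} (snd s)"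
          unfolding \<phi>_def using True by (intro tendsto_mult cutoff_tendsto) auto
        also have "indicator {fst a<..<fst b} (fst s) * indicator {snd a<..<snd b} (snd s)
            = (indicator (box a b) s :: real)"
          by (cases s) (auto simp: indicator_def box_prod)
        finally show ?thesis .
      qed
      then show "AE s in lborel. (\<lambda>N. \<phi> N s *\<^sub>R u s) \<longlonglongrightarrow> indicator (box a b) s *\<^sub>R u s"
        by (intro AE_I2 tendsto_intros)
      have "\<bar>\<phi> N s\<bar> \<le> indicator (square R) s" for N s
      proof (cases "fst s \<in> {fst a<..<fst b} \<and> snd s \<in> {snd a<..<snd b}")
        case in_box: True
        then have "s \<in> square R" using R by (auto simp: mem_square_iff)
        moreover have "\<bar>\<phi> N s\<bar> \<le> 1 * 1"
          unfolding \<phi>_def abs_mult by (intro mult_mono) (auto simp: cutoff_bounds)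
        ultimately show ?thesis by simp
      next
        case False
        then have "\<phi> N s = 0"
          using True cutoff_eq_0[of "fst a" "fst b" "fst s" N] cutoff_eq_0[of "snd a" "snd b" "snd s" N]
          by (auto simp: \<phi>_def)
        then show ?thesis by simp
      qed
      then show "AE s in lborel. norm (\<phi> N s *\<^sub>R u s) \<le> norm (indicator (square R) s *\<^sub>R u s)" for N
        by (intro AE_I2) (simp add: mult_right_mono)
    qed measurable
    then show ?thesis
      unfolding \<phi>0 by (simp add: LIMSEQ_const_iff)
  next
    case False
    then have "box a b = {}" by (auto simp: box_prod)
    then show ?thesis by simp
  qed
  have "AE s in lborel. indicator (box (- (real R, real R)) (real R, real R)) s *\<^sub>R u s = 0" for R
  proof (rule sigma_finite_measure.density_zero[OF lborel.sigma_finite_measure_axioms])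
    define K where "K = box (- (real R, real R)) (real R, real R)"
    define v where "v s = indicator K s *\<^sub>R u s" for s
    have [measurable]: "K \<in> sets borel" by (simp add: K_def)
    have "K \<subseteq> square R" by (auto simp: K_def box_prod mem_square_iff)
    have v: "integrable lborel v"
    proof (rule Bochner_Integration.integrable_bound[OF loc[of R]])
      show "AE s in lborel. norm (v s) \<le> norm (indicator (square R) s *\<^sub>R u s)"
        using \<open>K \<subseteq> square R\<close> by (intro AE_I2) (auto simp: v_def indicator_def)
    qed (simp add: v_def[abs_def])
    then show "integrable lborel (\<lambda>s. indicator (box (- (real R, real R)) (real R, real R)) s *\<^sub>R u s)"
      by (simp add: v_def[abs_def] K_def)
    have si: "set_integrable lborel A v" if "A \<in> sets borel" for A
      using v that by (auto simp: set_integrable_def intro: integrable_mult_indicator)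
    define G where "G = range (\<lambda>(a, b). box a b :: (real \<times> real) set)"
    have G: "Int_stable G" "G \<subseteq> Pow UNIV"
      by (auto simp: G_def Int_stable_def box_Int_box)
    have sets_G: "sets borel = sigma_sets UNIV G"
      unfolding G_def by (subst borel_eq_box) (rule sets_measure_of, simp)
    \<comment> \<open>The integral of \<open>v\<close> over the plane is one of \<open>u\<close>
      over \<open>K\<close>; complements reduce to it.\<close>
    have total: "set_lebesgue_integral lborel UNIV v = 0"
      using box0 by (simp add: set_lebesgue_integral_def v_def K_def)
    have "set_lebesgue_integral lborel A v = 0" if "A \<in> sigma_sets UNIV G" for A
      using G that
    proof (induction rule: sigma_sets_induct_disjoint)
      case (basic A)
      then obtain a b where A: "A = box a b" by (auto simp: G_def)
      \<comment> \<open>Boxes are stable under intersection, so \<open>box0\<close> also covers the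
        part of \<open>A\<close> inside \<open>K\<close>.\<close>
      obtain c d where "A \<inter> K = box c d" unfolding A K_def box_Int_box by blast
      moreover have "set_lebesgue_integral lborel A v = (\<integral>s. indicator (A \<inter> K) s *\<^sub>R u s \<partial>lborel)"
        by (simp add: set_lebesgue_integral_def v_def indicator_inter_arith)
      ultimately show ?case by (simp add: box0)
    next
      case empty
      show ?case by (simp add: set_lebesgue_integral_def)
    next
      case (compl A)
      then have A: "A \<in> sets borel" by (simp add: sets_G)
      have "set_lebesgue_integral lborel (A \<union> (UNIV - A)) v
        = set_lebesgue_integral lborel A v + set_lebesgue_integral lborel (UNIV - A) v"
        by (rule set_integral_Un) (use A in \<open>auto intro: si\<close>)
      with compl total show ?case by simp
    next
      case (union A)
      then have A: "A i \<in> sets borel" for i by (auto simp: sets_G)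
      have "set_lebesgue_integral lborel (\<Union>i. A i) v = (\<Sum>i. set_lebesgue_integral lborel (A i) v)"
        using A union(1) by (intro lebesgue_integral_countable_add si) (auto simp: disjoint_family_on_def)
      with union show ?case by simp
    qed
    then show "set_lebesgue_integral lborel A (\<lambda>s. indicator (box (- (real R, real R)) (real R, real R)) s *\<^sub>R u s) = 0"
      if "A \<in> sets lborel" for A
      using that by (simp add: v_def[abs_def] K_def sets_G)
  qed
  then have "AE s in lborel. \<forall>R::nat. indicator (box (- (real R, real R)) (real R, real R)) s *\<^sub>R u s = 0"
    unfolding AE_all_countable by blast
  then show ?thesis
  proof eventually_elim
    case (elim s)
    define R where "R = Suc (nat \<lceil>max \<bar>fst s\<bar> \<bar>snd s\<bar>\<rceil>)"
    have "\<bar>fst s\<bar> < real R" "\<bar>snd s\<bar> < real R" unfolding R_def by linarith+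
    then have "s \<in> box (- (real R, real R)) (real R, real R)"
      by (cases s) (auto simp: box_prod)
    with elim[rule_format, of R] show ?case by simp
  qed
qed

text \<open>Both integrals equal that of the periodized weight times \<open>h\<close>: on the left
  by transposing the periodization, on the right by Poisson summation for \<phi>.\<close>

lemma (in bump) weak_inversion:
  assumes h: "integrable lborel h"
  shows "integrable lborel (\<lambda>s. \<phi> s *\<^sub>R periodic_sum h s)"
    and "(\<integral>s. \<phi> s *\<^sub>R periodic_sum h s \<partial>lborel)
      = (\<Sum>\<^sub>\<infinity>k. \<integral>s. \<phi> s *\<^sub>R twist k s (fourier_coef h k) \<partial>lborel)"
proof -
  obtain B where "B \<ge> 0" and B: "\<And>s. \<bar>\<phi> s\<bar> \<le> B" by (rule bounded_D[of 0 0]) auto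
  have supp: "\<phi> s = 0" if "\<bar>fst s\<bar> > real R \<or> \<bar>snd s\<bar> > real R" for s
    using supp[of 0 0 s] that by simp
  show "integrable lborel (\<lambda>s. \<phi> s *\<^sub>R periodic_sum h s)"
    by (rule integrable_phi_periodic_sum[OF h measurable_phi B supp])
  show "(\<integral>s. \<phi> s *\<^sub>R periodic_sum h s \<partial>lborel)
      = (\<Sum>\<^sub>\<infinity>k. \<integral>s. \<phi> s *\<^sub>R twist k s (fourier_coef h k) \<partial>lborel)"
    using integral_phi_periodic_sum[OF h measurable_phi B supp] infsum_phi_twist_fourier_coef[OF h]
    by simp
qed

lemma (in bump) integrable_phi_twist: "integrable lborel (\<lambda>s. \<phi> s *\<^sub>R twist k s q)"
proof -
  have "integrable lborel (\<lambda>s. \<phi> s *\<^sub>R q)"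
    using integrable_D(2)[of 0 0] by (intro integrable_scaleR_left) auto
  then have "integrable lborel (\<lambda>s. twist k s (\<phi> s *\<^sub>R q))"
    by (rule integrable_twist) measurable
  then show ?thesis
    by (simp add: linear_simps(5)[OF bounded_linear_twist])
qed

lemma AE_periodic_sum_eq:
  assumes h: "integrable lborel h" and sm: "(\<lambda>k. norm (fourier_coef h k)) summable_on UNIV"
  shows "AE s in lborel. periodic_sum h s = (\<Sum>\<^sub>\<infinity>k. twist k s (fourier_coef h k))"
proof -
  define G where "G s = (\<Sum>\<^sub>\<infinity>k. twist k s (fourier_coef h k))" for s
  \<comment> \<open>Stated for every integrable weight, since it serves both indicators of squares
    and bumps.\<close>
  have *: "integrable lborel (\<lambda>s. \<phi> s *\<^sub>R G s)"
    "(\<integral>s. \<phi> s *\<^sub>R G s \<partial>lborel) = (\<Sum>\<^sub>\<infinity>k. \<integral>s. \<phi> s *\<^sub>R twist k s (fourier_coef h k) \<partial>lborel)"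
    if \<phi>: "integrable lborel \<phi>" for \<phi> :: "real \<times> real \<Rightarrow> real"
  proof -
    have int: "integrable lborel (\<lambda>s. \<phi> s *\<^sub>R twist k s (fourier_coef h k))" for k
    proof -
      have "integrable lborel (\<lambda>s. twist k s (\<phi> s *\<^sub>R fourier_coef h k))"
        using \<phi> by (intro integrable_twist integrable_scaleR_left) measurable
      then show ?thesis
        by (simp add: linear_simps(5)[OF bounded_linear_twist])
    qed
    have "(\<lambda>k. (\<integral>s. \<bar>\<phi> s\<bar> \<partial>lborel) * norm (fourier_coef h k)) summable_on UNIV"
      by (intro summable_on_cmult_right sm)
    then have sm': "(\<lambda>k. \<integral>s. norm (\<phi> s *\<^sub>R twist k s (fourier_coef h k)) \<partial>lborel) summable_on UNIV"
      by simp
    show "integrable lborel (\<lambda>s. \<phi> s *\<^sub>R G s)"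
      "(\<integral>s. \<phi> s *\<^sub>R G s \<partial>lborel) = (\<Sum>\<^sub>\<infinity>k. \<integral>s. \<phi> s *\<^sub>R twist k s (fourier_coef h k) \<partial>lborel)"
      using integrable_infsum[OF int sm'] integral_infsum[OF int sm']
      by (simp_all add: G_def infsum_scaleR_right)
  qed
  have "AE s in lborel. periodic_sum h s - G s = 0"
  proof (rule AE_zero_of_bump_integrals)
    show "integrable lborel (\<lambda>s. indicator (square R) s *\<^sub>R (periodic_sum h s - G s))" for R
    proof -
      have "integrable lborel (\<lambda>s. indicator (square R) s :: real)"
        using emeasure_compact_finite[OF compact_square] by (intro integrable_real_indicator) auto
      with integrable_square_periodic_sum[OF h] *(1) show ?thesis
        unfolding scaleR_diff_right by (intro Bochner_Integration.integrable_diff)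
    qed
    show "(\<integral>s. D 0 0 s *\<^sub>R (periodic_sum h s - G s) \<partial>lborel) = 0" if "bump D R" for D R
    proof -
      interpret bump D R by fact
      show ?thesis
        using weak_inversion[OF h] *[OF integrable_D(2)[of 0 0]]
        by (simp add: scaleR_diff_right)
    qed
  qed
  then show ?thesis by (simp add: G_def)
qed

lemma bump_test_function:
  assumes "test_function \<phi>"
  obtains D R where "bump D R" "D 0 0 = \<phi>"
proof -
  define S where "S = closure {s. \<phi> s \<noteq> 0}"
  obtain D where D: "D 0 0 = \<phi>"
    "\<And>m n s. (D m n has_derivative (\<lambda>h. fst h * D (Suc m) n s + snd h * D m (Suc n) s)) (at s)"
    using assms unfolding test_function_def by blast
  have S: "compact S" using assms by (simp add: test_function_def S_def)
  obtain B where B: "\<And>s. s \<in> S \<Longrightarrow> norm s \<le> B"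
    using compact_imp_bounded[OF S] by (auto simp: bounded_iff)
  define R where "R = nat \<lceil>B\<rceil>"
  \<comment> \<open>The family \<open>D\<close> is given merely by existence, so its vanishing off
    the support must be derived. The complement of \<open>S\<close> is open; where
    \<open>D m n\<close> is 0 on it, the Frechet derivative is 0, and its values at (1, 0) and (0,
    1) are the next partial derivatives.\<close>
  have step: "D (Suc m) n s = 0 \<and> D m (Suc n) s = 0"
    if z: "\<And>s. s \<notin> S \<Longrightarrow> D m n s = 0" and s: "s \<notin> S" for m n s
  proof -
    have "open (- S)" using compact_imp_closed[OF S] by auto
    have "((\<lambda>s. 0) has_derivative (\<lambda>h. fst h * D (Suc m) n s + snd h * D m (Suc n) s)) (at s)"
      by (rule has_derivative_transform_within_open[OF D(2) \<open>open (- S)\<close>]) (use s z in auto)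
    then have "(\<lambda>h. fst h * D (Suc m) n s + snd h * D m (Suc n) s) = (\<lambda>h. 0)"
      by (rule has_derivative_unique) simp
    from fun_cong[OF this, of "(1, 0)"] fun_cong[OF this, of "(0, 1)"] show ?thesis by simp
  qed
  have zero_m0: "D m 0 s = 0" if "s \<notin> S" for m s
    using that
  proof (induction m arbitrary: s)
    case 0
    then show ?case using D(1) closure_subset[of "{s. \<phi> s \<noteq> 0}"] by (auto simp: S_def)
  qed (use step in blast)
  have zero: "D m n s = 0" if "s \<notin> S" for m n s
    using that
  proof (induction n arbitrary: s)
    case 0
    then show ?case by (rule zero_m0)
  qed (use step in blast)
  have "bump D R"
  proof
    show "continuous_on UNIV (D m n)" for m n
      using D(2) by (auto intro!: continuous_at_imp_continuous_on has_derivative_continuous)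
    show "D m n s = 0" if "\<bar>fst s\<bar> > real R \<or> \<bar>snd s\<bar> > real R" for m n s
    proof (rule zero)
      have "real R \<ge> B" unfolding R_def by linarith
      then show "s \<notin> S"
        using that B[of s] norm_fst_le[of "fst s" "snd s"] norm_snd_le[of "snd s" "fst s"] by auto
    qed
    show "((\<lambda>x. D m n (x, y)) has_real_derivative D (Suc m) n (x, y)) (at x)" for m n x y
    proof -
      have "((\<lambda>x. (x, y)) has_derivative (\<lambda>h. (h, 0))) (at x)"
        by (auto intro!: derivative_eq_intros)
      from has_derivative_compose[OF this D(2)[of m n "(x, y)"]] show ?thesis
        by (simp add: has_field_derivative_def mult.commute[of _ "D (Suc m) n (x, y)"])
    qed
    show "((\<lambda>y. D m n (x, y)) has_real_derivative D m (Suc n) (x, y)) (at y)" for m n x y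
    proof -
      have "((\<lambda>y. (x, y)) has_derivative (\<lambda>h. (0, h))) (at y)"
        by (auto intro!: derivative_eq_intros)
      from has_derivative_compose[OF this D(2)[of m n "(x, y)"]] show ?thesis
        by (simp add: has_field_derivative_def mult.commute[of _ "D m (Suc n) (x, y)"])
    qed
  qed
  with D(1) show ?thesis by (intro that)
qed

section \<open>Affine substitutions and Borel representatives\<close>

lemma AE_lborel_affine:
  fixes t :: "'a::euclidean_space"
  assumes "AE x in lborel. P x" "c \<noteq> 0"
  shows "AE x in lborel. P (t + c *\<^sub>R x)"
proof -
  obtain N where N: "{x. \<not> P x} \<subseteq> N" "N \<in> null_sets lborel"
    using assms(1) by (auto simp: eventually_ae_filter)
  then have "AE x in density (distr lborel borel (\<lambda>x. t + c *\<^sub>R x)) (\<lambda>_. ennreal (\<bar>c\<bar> ^ DIM('a))). x \<notin> N"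
    by (subst lborel_affine[OF assms(2), symmetric]) (rule AE_not_in)
  then have "AE x in distr lborel borel (\<lambda>x. t + c *\<^sub>R x). x \<notin> N"
    using assms(2) by (subst (asm) AE_density) auto
  then have "AE x in lborel. t + c *\<^sub>R x \<notin> N"
    using N(2) by (subst (asm) AE_distr_iff) auto
  then show ?thesis
    by eventually_elim (use N in auto)
qed

lemma integrable_lborel_affine:
  fixes f :: "'a::euclidean_space \<Rightarrow> 'b::{banach, second_countable_topology}"
  assumes "integrable lborel f" "c \<noteq> 0"
  shows "integrable lborel (\<lambda>x. f (t + c *\<^sub>R x))"
proof -
  have [measurable]: "f \<in> borel_measurable borel" using assms(1) by auto
  have "integrable (density (distr lborel borel (\<lambda>x. t + c *\<^sub>R x)) (\<lambda>_. ennreal (\<bar>c\<bar> ^ DIM('a)))) f"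
    using assms by (subst lborel_affine[OF assms(2), symmetric])
  then have "integrable (distr lborel borel (\<lambda>x. t + c *\<^sub>R x)) (\<lambda>x. \<bar>c\<bar> ^ DIM('a) *\<^sub>R f x)"
    by (subst (asm) integrable_density) auto
  then have "integrable lborel (\<lambda>x. \<bar>c\<bar> ^ DIM('a) *\<^sub>R f (t + c *\<^sub>R x))"
    by (subst (asm) integrable_distr_eq) auto
  from integrable_scaleR_right[OF this, of "inverse (\<bar>c\<bar> ^ DIM('a))"] show ?thesis
    using assms(2) by simp
qed

text \<open>Reduced to the real coordinates; there are finitely many, so their exceptional sets
  combine.\<close>

lemma completion_ex_borel_measurable_euclidean:
  fixes g :: "'a \<Rightarrow> 'b::euclidean_space"
  assumes "g \<in> borel_measurable (completion M)"
  shows "\<exists>g'\<in>borel_measurable M. AE x in M. g x = g' x"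
proof -
  have "\<exists>g'\<in>borel_measurable M. AE x in M. g x \<bullet> b = g' x" for b
    using assms by (intro completion_ex_borel_measurable_real borel_measurable_inner borel_measurable_const)
  then obtain g' where [measurable]: "\<And>b. g' b \<in> borel_measurable M"
    and g': "\<And>b. AE x in M. g x \<bullet> b = g' b x"
    by metis
  show ?thesis
  proof (rule bexI[of _ "\<lambda>x. \<Sum>b\<in>Basis. g' b x *\<^sub>R b"])
    have "AE x in M. \<forall>b\<in>Basis. g x \<bullet> b = g' b x"
      using g' by (intro AE_finite_allI) auto
    then show "AE x in M. g x = (\<Sum>b\<in>Basis. g' b x *\<^sub>R b)"
      by eventually_elim (subst euclidean_representation[symmetric], simp cong: sum.cong)
  qed measurable
qed

lemma borel_measurable_completion_cong_AE:
  assumes "AE x in M. f x = g x" "g \<in> borel_measurable M"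
  shows "f \<in> borel_measurable (completion M)"
proof (rule measurableI)
  fix A :: "'b set" assume A: "A \<in> sets borel"
  show "f -` A \<inter> space (completion M) \<in> sets (completion M)"
  proof (rule completion.in_sets_AE)
    show "AE x in completion M. x \<in> g -` A \<inter> space M \<longleftrightarrow> x \<in> f -` A \<inter> space (completion M)"
      using AE_completion[OF assms(1)] by eventually_elim auto
    show "g -` A \<inter> space M \<in> sets (completion M)"
      using measurable_sets[OF assms(2) A] by (rule sets_completionI_sets)
  qed auto
qed auto

section \<open>The Wigner-Ville distribution\<close>

text \<open>Integrands built from \<open>L2_quat\<close> functions need not be Borel. This transfers
  their integrals to \<open>lborel\<close>, where Fubini is applied.\<close>

lemma lebesgue_integral_cong_AE_lborel:
  fixes F G :: "'a::euclidean_space \<Rightarrow> 'b::{banach, second_countable_topology}"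
  assumes "AE x in lborel. F x = G x" "integrable lborel G"
  shows "integrable lebesgue F" "integral\<^sup>L lebesgue F = integral\<^sup>L lborel G"
proof -
  have [measurable]: "G \<in> borel_measurable lborel" using assms(2) by auto
  have F: "F \<in> borel_measurable lebesgue"
    using assms(1) by (rule borel_measurable_completion_cong_AE) measurable
  have G: "G \<in> borel_measurable lebesgue"
    by (rule measurable_completion) measurable
  have AE: "AE x in lebesgue. G x = F x"
    using AE_completion[OF assms(1)] by eventually_elim simp
  have "integrable lebesgue G"
    using assms(2) by (simp add: integrable_completion)
  then show "integrable lebesgue F"
    by (rule integrable_cong_AE_imp[OF _ F AE])
  have "integral\<^sup>L lebesgue F = integral\<^sup>L lebesgue G"
    using AE by (intro integral_cong_AE F G) (auto simp: eq_commute)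
  then show "integral\<^sup>L lebesgue F = integral\<^sup>L lborel G"
    by (simp add: integral_completion)
qed

text \<open>In this form measurability of the conjugation follows from that of the inner
  product.\<close>

lemma qcnj_eq: "qcnj q = (2 * inner q 1) *\<^sub>R 1 - q"
  by (simp add: quat_eq_iff inner_quat_def)

lemma norm_qcnj [simp]: "norm (qcnj q) = norm q"
  by (simp add: norm_quat_def)

lemma measurable_qcnj [measurable]: "qcnj \<in> borel_measurable borel"
  unfolding qcnj_eq[abs_def] by measurable

lemma slice_commute:
  assumes "\<nu> * \<nu> = -1"
  shows "slice \<nu> z * slice \<nu> w = slice \<nu> w * slice \<nu> z"
  by (simp add: slice_mult[OF assms, symmetric] mult.commute)

lemma exp_scaleR_eq_slice:
  assumes "\<nu> * \<nu> = -1"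
  shows "exp (a *\<^sub>R \<nu>) = slice \<nu> (cis a)"
  unfolding exp_scaleR_unit[OF assms] by (simp add: slice_def of_real_def)

lemma nu_sqrt_nonzero:
  assumes "\<nu> * \<nu> = -1" "r \<noteq> 0"
  shows "nu_sqrt \<nu> r \<noteq> 0"
proof -
  have "nu_sqrt \<nu> r * slice \<nu> (inverse (csqrt (\<i> * complex_of_real r))) = slice \<nu> 1"
    using assms(2) by (simp add: nu_sqrt_def flip: slice_mult[OF assms(1)])
  also have "\<dots> = 1" by (simp add: slice_def)
  finally show ?thesis by auto
qed

text \<open>Root and exponential both lie in the image of \<open>slice \<nu>\<close>, which is
  commutative; multiplying by the inverse root on both sides carries this over to the
  inverse.\<close>

lemma inverse_nu_sqrt_commute:
  assumes "\<nu> * \<nu> = -1" "r \<noteq> 0"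
  shows "inverse (nu_sqrt \<nu> r) * exp (a *\<^sub>R \<nu>) = exp (a *\<^sub>R \<nu>) * inverse (nu_sqrt \<nu> r)"
proof -
  define n where "n = nu_sqrt \<nu> r"
  have n: "n \<noteq> 0" unfolding n_def by (rule nu_sqrt_nonzero[OF assms])
  have commute: "n * exp (a *\<^sub>R \<nu>) = exp (a *\<^sub>R \<nu>) * n"
    unfolding n_def nu_sqrt_def exp_scaleR_eq_slice[OF assms(1)] by (rule slice_commute[OF assms(1)])
  have "inverse n * exp (a *\<^sub>R \<nu>) = inverse n * (exp (a *\<^sub>R \<nu>) * (n * inverse n))"
    using n by simp
  also have "\<dots> = inverse n * (exp (a *\<^sub>R \<nu>) * n) * inverse n"
    by (simp only: mult.assoc)
  also have "\<dots> = (inverse n * n) * exp (a *\<^sub>R \<nu>) * inverse n"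
    by (simp only: commute[symmetric] mult.assoc)
  finally show ?thesis
    using n by (simp add: n_def)
qed

definition chirp :: "quat \<Rightarrow> olct_param \<Rightarrow> real \<Rightarrow> quat" where
  "chirp \<nu> A x = exp ((1 / pb A * x * p\<tau> A + pa A / (2 * pb A) * x\<^sup>2) *\<^sub>R \<nu>)"

text \<open>The part of the phase of \<open>poisson_factor\<close> that is free of \<open>x\<close>;
  the kernel at a sample point carries it with the opposite sign, so the two cancel.\<close>

definition offset_phase :: "olct_param \<Rightarrow> int \<Rightarrow> real" where
  "offset_phase A k = 2 * pi * real_of_int k * (pd A * p\<tau> A - pb A * p\<eta> A)
     - pd A / (2 * pb A) * (4 * pi\<^sup>2 * (pb A)\<^sup>2 * (real_of_int k)\<^sup>2 + (p\<tau> A)\<^sup>2)"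

text \<open>At the sampled frequency the cross term of the quadratic phase becomes -2 pi k x. The
  kernel thus splits into a constant free of \<open>x\<close>, a Fourier character, and a chirp free
  of \<open>k\<close>.\<close>

lemma olct_kernel_sample:
  assumes "pb A \<noteq> 0"
  shows "olct_kernel \<nu> A x (2 * pi * pb A * real_of_int k)
    = inverse (nu_sqrt \<nu> (2 * pi * pb A)) * exp (- offset_phase A k *\<^sub>R \<nu>)
      * exp ((2 * pi * real_of_int k * - x) *\<^sub>R \<nu>) * chirp \<nu> A x"
proof -
  define y where "y = 2 * pi * pb A * real_of_int k"
  have "1 / (2 * pb A) * (pa A * x\<^sup>2 - 2 * x * (y - p\<tau> A) - 2 * y * (pd A * p\<tau> A - pb A * p\<eta> A)
        + pd A * (y\<^sup>2 + (p\<tau> A)\<^sup>2))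
    = - offset_phase A k + 2 * pi * real_of_int k * - x + (1 / pb A * x * p\<tau> A + pa A / (2 * pb A) * x\<^sup>2)"
    using assms by (simp add: y_def offset_phase_def field_simps power2_eq_square)
  then have "olct_kernel \<nu> A x y = inverse (nu_sqrt \<nu> (2 * pi * pb A))
      * exp ((- offset_phase A k + 2 * pi * real_of_int k * - x
          + (1 / pb A * x * p\<tau> A + pa A / (2 * pb A) * x\<^sup>2)) *\<^sub>R \<nu>)"
    unfolding olct_kernel_def by (simp only:)
  also have "\<dots> = inverse (nu_sqrt \<nu> (2 * pi * pb A)) * exp (- offset_phase A k *\<^sub>R \<nu>)
      * exp ((2 * pi * real_of_int k * - x) *\<^sub>R \<nu>) * chirp \<nu> A x"
    unfolding chirp_def exp_scaleR_add[symmetric] by (simp only: mult.assoc)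
  finally show ?thesis
    unfolding y_def .
qed

lemma poisson_factor_eq:
  "poisson_factor \<nu> A k x = exp ((2 * pi * real_of_int k * x) *\<^sub>R \<nu>) * exp (offset_phase A k *\<^sub>R \<nu>)"
  by (simp add: poisson_factor_def offset_phase_def)

definition chirped_product ::
  "olct_param \<Rightarrow> olct_param \<Rightarrow> (real \<times> real \<Rightarrow> quat) \<Rightarrow> (real \<times> real \<Rightarrow> quat) \<Rightarrow>
   real \<times> real \<Rightarrow> real \<times> real \<Rightarrow> quat" where
  "chirped_product A1 A2 f g t s =
     chirp qi A1 (fst s) * f (t + s /\<^sub>R 2) * qcnj (g (t - s /\<^sub>R 2)) * chirp qj A2 (snd s)"

lemma poisson_lhs_term_eq: "poisson_lhs_term A1 A2 f g t s k = chirped_product A1 A2 f g t (s + int_pair k)"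
  by (cases k; cases s) (simp add: poisson_lhs_term_def chirped_product_def chirp_def int_pair_def Let_def)

lemma norm_chirp [simp]: "norm (chirp qi A x) = 1" "norm (chirp qj A x) = 1"
  by (simp_all add: chirp_def)

lemma measurable_chirp [measurable]:
  "chirp qi A \<in> borel_measurable borel" "chirp qj A \<in> borel_measurable borel"
  unfolding chirp_def exp_qi exp_qj by measurable

text \<open>Chirps have modulus 1, and the product of the two remaining norms is at most the sum of
  their squares, which is integrable after the substitutions t + s/2 and t - s/2.\<close>

lemma integrable_chirped_product:
  assumes [measurable]: "f \<in> borel_measurable borel" "g \<in> borel_measurable borel"
    and "integrable lborel (\<lambda>s. (norm (f s))\<^sup>2)" "integrable lborel (\<lambda>s. (norm (g s))\<^sup>2)"
  shows "integrable lborel (chirped_product A1 A2 f g t)"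
proof (rule Bochner_Integration.integrable_bound)
  have "integrable lborel (\<lambda>s. (norm (f (t + s /\<^sub>R 2)))\<^sup>2)"
    by (rule integrable_lborel_affine[OF assms(3)]) simp
  moreover have "integrable lborel (\<lambda>s. (norm (g (t + (- inverse 2) *\<^sub>R s)))\<^sup>2)"
    by (rule integrable_lborel_affine[OF assms(4)]) simp
  ultimately show "integrable lborel (\<lambda>s. (norm (f (t + s /\<^sub>R 2)))\<^sup>2 + (norm (g (t - s /\<^sub>R 2)))\<^sup>2)"
    unfolding scaleR_minus_left add_uminus_conv_diff by (rule Bochner_Integration.integrable_add)
  have [measurable]: "(\<lambda>s::real \<times> real. fst s) \<in> borel_measurable borel" "(\<lambda>s::real \<times> real. snd s) \<in> borel_measurable borel"
    by (intro borel_measurable_continuous_onI continuous_intros)+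
  show "chirped_product A1 A2 f g t \<in> borel_measurable lborel"
    unfolding chirped_product_def by measurable
  have "a * b \<le> a\<^sup>2 + b\<^sup>2" for a b :: real
  proof -
    have "2 * a * b \<le> a\<^sup>2 + b\<^sup>2" "- (2 * a * b) \<le> a\<^sup>2 + b\<^sup>2"
      using sum_squares_bound[of a b] sum_squares_bound[of "- a" b] by auto
    then show ?thesis by linarith
  qed
  then show "AE s in lborel. norm (chirped_product A1 A2 f g t s)
      \<le> norm ((norm (f (t + s /\<^sub>R 2)))\<^sup>2 + (norm (g (t - s /\<^sub>R 2)))\<^sup>2)"
    by (intro AE_I2) (simp add: chirped_product_def norm_mult)
qed

lemma L2_quat_borel:
  assumes "f \<in> L2_quat"
  obtains f' where "f' \<in> borel_measurable borel" "AE s in lborel. f s = f' s" "integrable lborel (\<lambda>s. (norm (f' s))\<^sup>2)"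
proof -
  have f: "f \<in> borel_measurable lebesgue" "integrable lebesgue (\<lambda>s. (norm (f s))\<^sup>2)"
    using assms by (auto simp: L2_quat_def)
  obtain f' where [measurable]: "f' \<in> borel_measurable lborel" and f': "AE s in lborel. f s = f' s"
    using completion_ex_borel_measurable_euclidean[OF f(1)] by blast
  have "integrable lebesgue (\<lambda>s. (norm (f' s))\<^sup>2)"
  proof (rule integrable_cong_AE_imp[OF f(2)])
    show "(\<lambda>s. (norm (f' s))\<^sup>2) \<in> borel_measurable lebesgue"
      by (rule measurable_completion) measurable
    show "AE s in lebesgue. (norm (f s))\<^sup>2 = (norm (f' s))\<^sup>2"
      using AE_completion[OF f'] by eventually_elim simp
  qed
  then have "integrable lborel (\<lambda>s. (norm (f' s))\<^sup>2)"
    by (simp add: integrable_completion)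
  with f' show ?thesis by (intro that[of f']) auto
qed

lemma AE_chirped_product_cong:
  assumes "AE s in lborel. f s = f' s" "AE s in lborel. g s = g' s"
  shows "AE s in lborel. chirped_product A1 A2 f g t s = chirped_product A1 A2 f' g' t s"
proof -
  have "AE s in lborel. f (t + s /\<^sub>R 2) = f' (t + s /\<^sub>R 2)"
    by (rule AE_lborel_affine[OF assms(1)]) simp
  moreover have "AE s in lborel. g (t + (- inverse 2) *\<^sub>R s) = g' (t + (- inverse 2) *\<^sub>R s)"
    by (rule AE_lborel_affine[OF assms(2)]) simp
  ultimately show ?thesis
    unfolding scaleR_minus_left add_uminus_conv_diff
    by eventually_elim (simp add: chirped_product_def)
qed

text \<open>The distribution is an integral, so it sees the product of \<open>f\<close> and
  \<open>g\<close> only up to null sets; this admits a Borel function \<open>h\<close> in its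
  place.\<close>

lemma wvd_qolct_sample:
  assumes "pb A1 \<noteq> 0" "pb A2 \<noteq> 0" and h: "integrable lborel h"
    and eq: "AE s in lborel. chirped_product A1 A2 f g t s = h s"
  shows "wvd_qolct A1 A2 f g t (2 * pi * pb A1 * real_of_int (fst k), 2 * pi * pb A2 * real_of_int (snd k))
    = inverse (nu_sqrt qi (2 * pi * pb A1)) * exp (- offset_phase A1 (fst k) *\<^sub>R qi)
      * fourier_coef h k * (exp (- offset_phase A2 (snd k) *\<^sub>R qj) * inverse (nu_sqrt qj (2 * pi * pb A2)))"
proof -
  define a where "a = inverse (nu_sqrt qi (2 * pi * pb A1)) * exp (- offset_phase A1 (fst k) *\<^sub>R qi)"
  define b where "b = exp (- offset_phase A2 (snd k) *\<^sub>R qj) * inverse (nu_sqrt qj (2 * pi * pb A2))"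
  have qj2: "qj * qj = -1" by (rule quat_units_mult)
  have bounded_linear: "bounded_linear (\<lambda>q. a * q * b)"
    by (rule bounded_linear_compose[OF bounded_linear_mult_left bounded_linear_mult_right])
  \<comment> \<open>The order of the right kernel is reversed so that its constants stand outermost;
    all its factors lie in the subfield of \<open>qj\<close>.\<close>
  have right: "olct_kernel qj A2 x (2 * pi * pb A2 * real_of_int (snd k))
    = chirp qj A2 x * exp ((2 * pi * real_of_int (snd k) * - x) *\<^sub>R qj) * b" for x
  proof -
    have "olct_kernel qj A2 x (2 * pi * pb A2 * real_of_int (snd k))
      = inverse (nu_sqrt qj (2 * pi * pb A2)) * (exp (- offset_phase A2 (snd k) *\<^sub>R qj)
         * (exp ((2 * pi * real_of_int (snd k) * - x) *\<^sub>R qj) * chirp qj A2 x))"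
      unfolding olct_kernel_sample[OF assms(2)] by (simp only: mult.assoc)
    also have "exp (- offset_phase A2 (snd k) *\<^sub>R qj) * (exp ((2 * pi * real_of_int (snd k) * - x) *\<^sub>R qj) * chirp qj A2 x)
       = chirp qj A2 x * exp ((2 * pi * real_of_int (snd k) * - x) *\<^sub>R qj) * exp (- offset_phase A2 (snd k) *\<^sub>R qj)"
      unfolding chirp_def exp_scaleR_add by (simp only: add_ac)
    also have "inverse (nu_sqrt qj (2 * pi * pb A2)) * \<dots> = \<dots> * inverse (nu_sqrt qj (2 * pi * pb A2))"
      unfolding chirp_def exp_scaleR_add using assms(2) by (intro inverse_nu_sqrt_commute qj2) simp
    finally show ?thesis by (simp only: b_def mult.assoc)
  qed
  have "olct_kernel qi A1 (fst s) (2 * pi * pb A1 * real_of_int (fst k)) * f (t + s /\<^sub>R 2) * qcnj (g (t - s /\<^sub>R 2))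
      * olct_kernel qj A2 (snd s) (2 * pi * pb A2 * real_of_int (snd k))
     = a * twist k (- s) (chirped_product A1 A2 f g t s) * b" for s
    unfolding right olct_kernel_sample[OF assms(1)] twist_def chirped_product_def a_def
    by (simp add: mult.assoc)
  then have "wvd_qolct A1 A2 f g t (2 * pi * pb A1 * real_of_int (fst k), 2 * pi * pb A2 * real_of_int (snd k))
    = (LINT s|lebesgue. a * twist k (- s) (chirped_product A1 A2 f g t s) * b)"
    by (simp add: wvd_qolct_def)
  also have "\<dots> = (LINT s|lborel. a * twist k (- s) (h s) * b)"
  proof (rule lebesgue_integral_cong_AE_lborel)
    show "AE s in lborel. a * twist k (- s) (chirped_product A1 A2 f g t s) * b = a * twist k (- s) (h s) * b"
      using eq by eventually_elim simp
    show "integrable lborel (\<lambda>s. a * twist k (- s) (h s) * b)"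
      by (intro integrable_bounded_linear[OF bounded_linear] integrable_twist h) measurable
  qed
  also have "\<dots> = a * fourier_coef h k * b"
    unfolding fourier_coef_def
    by (intro integral_bounded_linear[OF bounded_linear] integrable_twist h) measurable
  finally show ?thesis by (simp add: a_def b_def)
qed

text \<open>Each root moves outward past the factor of its own side. The offset phases then meet
  their opposites and cancel, and only the character survives.\<close>

lemma poisson_rhs_term_eq:
  assumes "pb A1 \<noteq> 0" "pb A2 \<noteq> 0" and h: "integrable lborel h"
    and eq: "AE s in lborel. chirped_product A1 A2 f g t s = h s"
  shows "poisson_rhs_term A1 A2 f g t s k = inverse (nu_sqrt qi (2 * pi * pb A1))
     * twist k s (fourier_coef h k) * inverse (nu_sqrt qj (2 * pi * pb A2))"
proof -
  define n1 where "n1 = inverse (nu_sqrt qi (2 * pi * pb A1))"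
  define n2 where "n2 = inverse (nu_sqrt qj (2 * pi * pb A2))"
  have "poisson_rhs_term A1 A2 f g t s k
     = (poisson_factor qi A1 (fst k) (fst s) * n1) * exp (- offset_phase A1 (fst k) *\<^sub>R qi)
        * fourier_coef h k * (exp (- offset_phase A2 (snd k) *\<^sub>R qj) * (n2 * poisson_factor qj A2 (snd k) (snd s)))"
    by (cases k) (use wvd_qolct_sample[OF assms, of k] in
        \<open>simp add: poisson_rhs_term_def n1_def n2_def mult.assoc\<close>)
  also have "poisson_factor qi A1 (fst k) (fst s) * n1 = n1 * poisson_factor qi A1 (fst k) (fst s)"
    unfolding poisson_factor_eq exp_scaleR_add n1_def
    using assms(1) by (intro inverse_nu_sqrt_commute[symmetric] quat_units_mult) simp
  also have "n2 * poisson_factor qj A2 (snd k) (snd s) = poisson_factor qj A2 (snd k) (snd s) * n2"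
    unfolding poisson_factor_eq exp_scaleR_add n2_def
    using assms(2) by (intro inverse_nu_sqrt_commute quat_units_mult) simp
  also have "n1 * poisson_factor qi A1 (fst k) (fst s) * exp (- offset_phase A1 (fst k) *\<^sub>R qi)
      * fourier_coef h k * (exp (- offset_phase A2 (snd k) *\<^sub>R qj) * (poisson_factor qj A2 (snd k) (snd s) * n2))
    = n1 * (poisson_factor qi A1 (fst k) (fst s) * exp (- offset_phase A1 (fst k) *\<^sub>R qi))
      * fourier_coef h k * (exp (- offset_phase A2 (snd k) *\<^sub>R qj) * poisson_factor qj A2 (snd k) (snd s)) * n2"
    by (simp only: mult.assoc)
  also have "\<dots> = n1 * twist k s (fourier_coef h k) * n2"
    unfolding poisson_factor_eq exp_scaleR_add twist_def by (simp add: mult.assoc)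
  finally show ?thesis by (simp add: n1_def n2_def)
qed

theorem theorem4p10:
  fixes A1 A2 :: olct_param and f g :: "real \<times> real \<Rightarrow> quat" and t :: "real \<times> real"
  assumes "olct_admissible A1" and "olct_admissible A2"
    and "f \<in> L2_quat" and "g \<in> L2_quat"
  shows
    "(AE s in lebesgue. poisson_lhs_term A1 A2 f g t s summable_on UNIV) \<and>
     (AE s in lebesgue. poisson_rhs_term A1 A2 f g t s summable_on UNIV \<longrightarrow>
        (\<Sum>\<^sub>\<infinity>k. poisson_lhs_term A1 A2 f g t s k) =
          nu_sqrt qi (2 * pi * pb A1) *
          (\<Sum>\<^sub>\<infinity>k. poisson_rhs_term A1 A2 f g t s k) *
          nu_sqrt qj (2 * pi * pb A2)) \<and>
     (\<forall>\<phi>. test_function \<phi> \<longrightarrow>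
        integrable lebesgue (\<lambda>s. \<phi> s *\<^sub>R (\<Sum>\<^sub>\<infinity>k. poisson_lhs_term A1 A2 f g t s k)) \<and>
        (\<forall>k. integrable lebesgue (\<lambda>s. \<phi> s *\<^sub>R poisson_rhs_term A1 A2 f g t s k)) \<and>
        (\<lambda>k. LINT s|lebesgue. \<phi> s *\<^sub>R poisson_rhs_term A1 A2 f g t s k) summable_on UNIV \<and>
        (LINT s|lebesgue. \<phi> s *\<^sub>R (\<Sum>\<^sub>\<infinity>k. poisson_lhs_term A1 A2 f g t s k)) =
          nu_sqrt qi (2 * pi * pb A1) *
          (\<Sum>\<^sub>\<infinity>k. LINT s|lebesgue. \<phi> s *\<^sub>R poisson_rhs_term A1 A2 f g t s k) *
          nu_sqrt qj (2 * pi * pb A2))"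
proof -
  define n1 where "n1 = nu_sqrt qi (2 * pi * pb A1)"
  define n2 where "n2 = nu_sqrt qj (2 * pi * pb A2)"
  have b: "pb A1 \<noteq> 0" "pb A2 \<noteq> 0"
    using assms(1,2) by (auto simp: olct_admissible_def)
  have n: "n1 \<noteq> 0" "n2 \<noteq> 0"
    using b nu_sqrt_nonzero[of qi "2 * pi * pb A1"] nu_sqrt_nonzero[of qj "2 * pi * pb A2"]
    by (simp_all add: n1_def n2_def quat_units_mult)
  have mult_n: "bounded_linear (\<lambda>q. n1 * q * n2)" and mult_inverse_n: "bounded_linear (\<lambda>q. inverse n1 * q * inverse n2)"
    by (rule bounded_linear_compose[OF bounded_linear_mult_left bounded_linear_mult_right])+
  have cancel: "n1 * (inverse n1 * q * inverse n2) * n2 = q" for q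
  proof -
    have "n1 * (inverse n1 * q * inverse n2) * n2 = (n1 * inverse n1) * q * (inverse n2 * n2)"
      by (simp only: mult.assoc)
    then show ?thesis using n by simp
  qed
  obtain f' where f': "f' \<in> borel_measurable borel" "AE s in lborel. f s = f' s" "integrable lborel (\<lambda>s. (norm (f' s))\<^sup>2)"
    using L2_quat_borel[OF assms(3)] by blast
  obtain g' where g': "g' \<in> borel_measurable borel" "AE s in lborel. g s = g' s" "integrable lborel (\<lambda>s. (norm (g' s))\<^sup>2)"
    using L2_quat_borel[OF assms(4)] by blast
  define h where "h = chirped_product A1 A2 f' g' t"
  have h: "integrable lborel h"
    unfolding h_def by (intro integrable_chirped_product f' g')
  have eq: "AE s in lborel. chirped_product A1 A2 f g t s = h s"
    unfolding h_def by (intro AE_chirped_product_cong f' g')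
  have "AE s in lborel. chirped_product A1 A2 f g t (s + int_pair k) = h (s + int_pair k)" for k
    using AE_lborel_affine[OF eq, of 1 "int_pair k"] by (simp add: add.commute)
  \<comment> \<open>There are countably many translates, so one null set serves them all.\<close>
  then have "AE s in lborel. \<forall>k. chirped_product A1 A2 f g t (s + int_pair k) = h (s + int_pair k)"
    unfolding AE_all_countable by blast
  then have lhs: "AE s in lborel. poisson_lhs_term A1 A2 f g t s = (\<lambda>k. h (s + int_pair k))"
    by eventually_elim (simp add: poisson_lhs_term_eq fun_eq_iff)
  then have lhs_sum: "AE s in lborel. (\<Sum>\<^sub>\<infinity>k. poisson_lhs_term A1 A2 f g t s k) = periodic_sum h s"
    by eventually_elim (simp add: periodic_sum_def)
  \<comment> \<open>In contrast to \<open>lhs\<close> this holds for every \<open>s\<close>, because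
    the coefficients are integrals and ignore null sets.\<close>
  have rhs: "poisson_rhs_term A1 A2 f g t s = (\<lambda>k. inverse n1 * twist k s (fourier_coef h k) * inverse n2)" for s
    unfolding n1_def n2_def by (intro ext poisson_rhs_term_eq b h eq)
  have summable: "AE s in lborel. poisson_lhs_term A1 A2 f g t s summable_on UNIV"
    using lhs AE_summable_on_translates[OF h] by eventually_elim simp
  have pointwise: "AE s in lborel. poisson_rhs_term A1 A2 f g t s summable_on UNIV \<longrightarrow>
        (\<Sum>\<^sub>\<infinity>k. poisson_lhs_term A1 A2 f g t s k) = n1 * (\<Sum>\<^sub>\<infinity>k. poisson_rhs_term A1 A2 f g t s k) * n2"
  proof (cases "(\<lambda>k. norm (fourier_coef h k)) summable_on UNIV")
    case True
    show ?thesis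
      using lhs_sum AE_periodic_sum_eq[OF h True]
    proof eventually_elim
      case (elim s)
      show ?case
      proof
        assume "poisson_rhs_term A1 A2 f g t s summable_on UNIV"
        from infsumI[OF has_sum_bounded_linear[OF mult_n has_sum_infsum[OF this]]] elim
        show "(\<Sum>\<^sub>\<infinity>k. poisson_lhs_term A1 A2 f g t s k) = n1 * (\<Sum>\<^sub>\<infinity>k. poisson_rhs_term A1 A2 f g t s k) * n2"
          by (simp add: rhs cancel)
      qed
    qed
  next
    case False
    \<comment> \<open>Twisting preserves norms, so absolute divergence of the coefficients excludes
      summability at every \<open>s\<close>, and the implication is vacuous.\<close>
    have "\<not> poisson_rhs_term A1 A2 f g t s summable_on UNIV" for s
    proof
      assume "poisson_rhs_term A1 A2 f g t s summable_on UNIV"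
      from summable_on_bounded_linear[OF mult_n this]
      have "(\<lambda>k. twist k s (fourier_coef h k)) summable_on UNIV"
        by (simp add: rhs cancel)
      with False show False
        by (simp add: summable_on_iff_norm_summable_on[of "\<lambda>k. twist k s (fourier_coef h k)"])
    qed
    then show ?thesis by simp
  qed
  have weak: "integrable lebesgue (\<lambda>s. \<phi> s *\<^sub>R (\<Sum>\<^sub>\<infinity>k. poisson_lhs_term A1 A2 f g t s k)) \<and>
        (\<forall>k. integrable lebesgue (\<lambda>s. \<phi> s *\<^sub>R poisson_rhs_term A1 A2 f g t s k)) \<and>
        (\<lambda>k. LINT s|lebesgue. \<phi> s *\<^sub>R poisson_rhs_term A1 A2 f g t s k) summable_on UNIV \<and>
        (LINT s|lebesgue. \<phi> s *\<^sub>R (\<Sum>\<^sub>\<infinity>k. poisson_lhs_term A1 A2 f g t s k)) =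
          n1 * (\<Sum>\<^sub>\<infinity>k. LINT s|lebesgue. \<phi> s *\<^sub>R poisson_rhs_term A1 A2 f g t s k) * n2"
    if tf: "test_function \<phi>" for \<phi>
  proof -
    obtain D R where "bump D R" and D: "D 0 0 = \<phi>"
      by (rule bump_test_function[OF tf])
    then interpret bump D R by simp
    have AE: "AE s in lborel. \<phi> s *\<^sub>R (\<Sum>\<^sub>\<infinity>k. poisson_lhs_term A1 A2 f g t s k) = \<phi> s *\<^sub>R periodic_sum h s"
      using lhs_sum by eventually_elim simp
    note L = lebesgue_integral_cong_AE_lborel[OF AE weak_inversion(1)[OF h, unfolded D]]
    have rhs': "\<phi> s *\<^sub>R poisson_rhs_term A1 A2 f g t s k
       = inverse n1 * (\<phi> s *\<^sub>R twist k s (fourier_coef h k)) * inverse n2" for s k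
      by (simp add: rhs)
    have int: "integrable lborel (\<lambda>s. \<phi> s *\<^sub>R poisson_rhs_term A1 A2 f g t s k)" for k
      unfolding rhs' by (rule integrable_bounded_linear[OF mult_inverse_n integrable_phi_twist[unfolded D]])
    have integral: "(LINT s|lebesgue. \<phi> s *\<^sub>R poisson_rhs_term A1 A2 f g t s k)
      = inverse n1 * (\<integral>s. \<phi> s *\<^sub>R twist k s (fourier_coef h k) \<partial>lborel) * inverse n2" for k
      using lebesgue_integral_cong_AE_lborel(2)[OF _ int[of k]]
        integral_bounded_linear[OF mult_inverse_n integrable_phi_twist[unfolded D], of k "fourier_coef h k"]
      by (simp add: rhs')
    note sm = summable_on_phi_twist_fourier_coef[OF h, unfolded D]
    have sm': "(\<lambda>k. LINT s|lebesgue. \<phi> s *\<^sub>R poisson_rhs_term A1 A2 f g t s k) summable_on UNIV"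
      unfolding integral by (rule summable_on_bounded_linear[OF mult_inverse_n sm])
    have "n1 * (\<Sum>\<^sub>\<infinity>k. LINT s|lebesgue. \<phi> s *\<^sub>R poisson_rhs_term A1 A2 f g t s k) * n2
      = (\<Sum>\<^sub>\<infinity>k. n1 * (LINT s|lebesgue. \<phi> s *\<^sub>R poisson_rhs_term A1 A2 f g t s k) * n2)"
      by (rule infsumI[symmetric, OF has_sum_bounded_linear[OF mult_n has_sum_infsum[OF sm']]])
    also have "\<dots> = (LINT s|lebesgue. \<phi> s *\<^sub>R (\<Sum>\<^sub>\<infinity>k. poisson_lhs_term A1 A2 f g t s k))"
      unfolding integral cancel L(2) weak_inversion(2)[OF h, unfolded D] ..
    moreover have "integrable lebesgue (\<lambda>s. \<phi> s *\<^sub>R poisson_rhs_term A1 A2 f g t s k)" for k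
      by (rule lebesgue_integral_cong_AE_lborel(1)[OF _ int[of k]]) simp
    ultimately show ?thesis
      using L(1) sm' by simp
  qed
  show ?thesis
    unfolding n1_def[symmetric] n2_def[symmetric]
    using AE_completion[OF summable] AE_completion[OF pointwise] weak by blast
qed

end
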